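(* Let $A,B\in\widetilde\Theta_\triangle(n)$ be such that $\mathrm{co}(B)=\mathrm{ro}(A)$. Then there exist unique (up to reordering) pairwise distinct matrices $X_1,\dots,X_m\in\widetilde\Theta_\triangle(n)$ and unique nonzero $P_1(x),\dots,P_m(x)\in\mathcal Z_1$, and an integer $a_0\ge 0$, such that for all integers $a\ge a_0$ $$[{}_aB]_1[{}_aA]_1=\sum_{1\le i\le m}P_i(a)\,[{}_aX_i]_1$$ in the affine Schur algebra $\mathcal S_\triangle(n,an+\sigma(A))_{\mathbb Z}$.
   Context: Matrices. Let $n\ge2$ be an integer, $\mathbb N=\{0,1,2,\dots\}$. $M_{\triangle,n}(\mathbb Z)$ is the set of integer matrices $A=(a_{i,j})_{i,j\in\mathbb Z}$ with $a_{i,j}=a_{i+n,j+n}$ and with finitely many nonzero entries in every row and column. $\widetilde\Theta_\triangle(n)=\{A\in M_{\triangle,n}(\mathbb Z): a_{i,j}\ge0\ \forall i\ne j\}$; $\Theta_\triangle(n)$ is the subset of matrices with all entries in $\mathbb N$. $\mathbb Z^n_\triangle$ is the set of $n$-periodic integer sequences $(\lambda_i)_{i\in\mathbb Z}$ (identified with $\mathbb Z^n$ via $(\lambda_1,\dots,\lambda_n)$), and $\mathbb N^n_\triangle$ its subset of nonnegative sequences. $\sigma(\lambda)=\sum_{i=1}^n\lambda_i$, $\sigma(A)=\sum_{1\le i\le n,\,j\in\mathbb Z}a_{i,j}$, $\Lambda_\triangle(n,r)=\{\lambda\in\mathbb N^n_\triangle:\sigma(\lambda)=r\}$, $\Theta_\triangle(n,r)=\{A\in\Theta_\triangle(n):\sigma(A)=r\}$.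 $\mathrm{ro}(A)=(\sum_ja_{i,j})_i$ and $\mathrm{co}(A)=(\sum_ia_{i,j})_j$ are the row and column sum vectors. For $a\in\mathbb Z$, ${}_aA=A+aI$ with $I$ the identity matrix. $\mathcal Z_1$ is the subring of $\mathbb Q[x]$ generated by $1$ and the polynomials $\binom{a+x}{t}$, $a\in\mathbb Z$, $t\in\mathbb N$. Affine Schur algebras. Let $r\ge0$. $\mathfrak S_{\triangle,r}$ is the group of permutations $w$ of $\mathbb Z$ with $w(i+r)=w(i)+r$ for all $i$ (the trivial group if $r=0$). $W$ is the subgroup of those $w$ with $\sum_{i=1}^rw(i)=\sum_{i=1}^ri$; it is the affine Weyl group of type $A$ with simple reflections $s_i$ ($1\le i\le r$), $s_i(j)=j+1$ if $j\equiv i$, $j-1$ if $j\equiv i+1$, and $j$ otherwise (mod $r$) ($W$ is trivial if $r\le1$). Let $\rho(j)=j+1$; then $\mathfrak S_{\triangle,r}=\langle\rho\rangle\ltimes W$ and the length function $\ell$ of $W$ is extended by $\ell(\rho^mw)=\ell(w)$. $s_1,\dots,s_{r-1}$ generate the symmetric group $\mathfrak S_r$. Let $\mathcal Z=\mathbb Z[v,v^{-1}]$. The extended affine Hecke algebra $\mathcal H_\triangle(r)$ is the $\mathcal Z$-algebra with basis $\{T_w\}_{w\in\mathfrak S_{\triangle,r}}$ and relations $T_{s_i}^2=(v^2-1)T_{s_i}+v^2$, and $T_wT_{w'}=T_{ww'}$ if $\ell(ww')=\ell(w)+\ell(w')$. For $\lambda\in\Lambda_\triangle(n,r)$ let $\mathfrak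 S_\lambda\subseteq\mathfrak S_r$ be the standard Young subgroup of $(\lambda_1,\dots,\lambda_n)$, $x_\lambda=\sum_{w\in\mathfrak S_\lambda}T_w$, and $\mathcal S_\triangle(n,r)=\mathrm{End}_{\mathcal H_\triangle(r)}\big(\bigoplus_{\lambda\in\Lambda_\triangle(n,r)}x_\lambda\mathcal H_\triangle(r)\big)$. Let $\mathscr D_\lambda=\{d:\ell(wd)=\ell(w)+\ell(d)\ \forall w\in\mathfrak S_\lambda\}$ and $\mathscr D_{\lambda,\mu}=\mathscr D_\lambda\cap\mathscr D_\mu^{-1}$. For $d\in\mathscr D_{\lambda,\mu}$ define $\phi^d_{\lambda,\mu}(x_\nu h)=\delta_{\mu\nu}\sum_{w\in\mathfrak S_\lambda d\mathfrak S_\mu}T_wh$; these form a $\mathcal Z$-basis of $\mathcal S_\triangle(n,r)$. Put $R^\lambda_{i+kn}=\{\lambda_{k,i-1}+1,\dots,\lambda_{k,i-1}+\lambda_i\}$, $\lambda_{k,i-1}=kr+\sum_{1\le t\le i-1}\lambda_t$ ($1\le i\le n$, $k\in\mathbb Z$). The map $(\lambda,d,\mu)\mapsto A=(|R^\lambda_k\cap dR^\mu_l|)_{k,l}$ is a bijection from triples with $\lambda,\mu\in\Lambda_\triangle(n,r)$, $d\in\mathscr D_{\lambda,\mu}$ onto $\Theta_\triangle(n,r)$; write $e_A=\phi^d_{\lambda,\mu}$ and $[A]=v^{-d_A}e_A$ with $d_A=\sum_{1\le i\le n,\ i\ge k,\ j<l}a_{i,j}a_{k,l}$. $\mathcal S_\triangle(n,r)_{\mathbb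 Z}=\mathcal S_\triangle(n,r)\otimes_{\mathcal Z}\mathbb Z$ is the specialization at $v=1$, with $\mathbb Z$-basis $[A]_1=[A]\otimes1$, $A\in\Theta_\triangle(n,r)$. For $A\in\widetilde\Theta_\triangle(n)$ with $\sigma(A)=r$ and some $a_{i,i}<0$, put $[A]_1=0$. *)

theory Defs
  imports
    "HOL-Library.Poly_Mapping"
    "HOL-Library.Multiset"
    "HOL-Computational_Algebra.Polynomial"
    "HOL-Algebra.QuotRing"
begin

section \<open>Periodic sequences and matrices\<close>

type_synonym zseq = "int \<Rightarrow> int"
type_synonym zmat = "int \<Rightarrow> int \<Rightarrow> int"

definition M_aff :: "nat \<Rightarrow> zmat set" where
  "M_aff n = {A. (\<forall>i j. A i j = A (i + int n) (j + int n)) \<and>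
                 (\<forall>i. finite {j. A i j \<noteq> 0}) \<and> (\<forall>j. finite {i. A i j \<noteq> 0})}"

definition Theta_tilde :: "nat \<Rightarrow> zmat set" where
  "Theta_tilde n = {A \<in> M_aff n. \<forall>i j. i \<noteq> j \<longrightarrow> 0 \<le> A i j}"

definition Theta_aff :: "nat \<Rightarrow> zmat set" where
  "Theta_aff n = {A \<in> M_aff n. \<forall>i j. 0 \<le> A i j}"

definition ro :: "zmat \<Rightarrow> zseq" where
  "ro A = (\<lambda>i. \<Sum>j | A i j \<noteq> 0. A i j)"

definition co :: "zmat \<Rightarrow> zseq" where
  "co A = (\<lambda>j. \<Sum>i | A i j \<noteq> 0. A i j)"

definition sigma_seq :: "nat \<Rightarrow> zseq \<Rightarrow> int" where
  "sigma_seq n l = (\<Sum>i = 1..int n. l i)"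

definition sigma_mat :: "nat \<Rightarrow> zmat \<Rightarrow> int" where
  "sigma_mat n A = (\<Sum>i = 1..int n. \<Sum>j | A i j \<noteq> 0. A i j)"

definition Lambda_aff :: "nat \<Rightarrow> nat \<Rightarrow> zseq set" where
  "Lambda_aff n r = {l. (\<forall>i. l (i + int n) = l i) \<and> (\<forall>i. 0 \<le> l i) \<and> sigma_seq n l = int r}"

definition Theta_aff_r :: "nat \<Rightarrow> nat \<Rightarrow> zmat set" where
  "Theta_aff_r n r = {A \<in> Theta_aff n. sigma_mat n A = int r}"

text \<open>The matrix \<open>A + a I\<close>.\<close>

definition shift_diag :: "int \<Rightarrow> zmat \<Rightarrow> zmat" where
  "shift_diag a A = (\<lambda>i j. A i j + (if i = j then a else 0))"


section \<open>The ring of integer-valued polynomials \<open>Z1\<close>\<close>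

definition binom_poly :: "int \<Rightarrow> nat \<Rightarrow> rat poly" where
  "binom_poly a t = smult (1 / fact t) (\<Prod>i<t. [:of_int a - of_nat i, 1:])"

lemma poly_binom_poly: "poly (binom_poly a t) x = (of_int a + x) gchoose t"
  by (simp add: binom_poly_def poly_prod gbinomial_prod_rev lessThan_atLeast0 algebra_simps)

inductive_set Z1 :: "rat poly set" where
  Z1_one: "1 \<in> Z1"
| Z1_binom: "binom_poly a t \<in> Z1"
| Z1_uminus: "P \<in> Z1 \<Longrightarrow> - P \<in> Z1"
| Z1_add: "P \<in> Z1 \<Longrightarrow> Q \<in> Z1 \<Longrightarrow> P + Q \<in> Z1"
| Z1_mult: "P \<in> Z1 \<Longrightarrow> Q \<in> Z1 \<Longrightarrow> P * Q \<in> Z1"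

lemma Z1_integer_valued:
  assumes "P \<in> Z1"
  shows "poly P (of_int k) \<in> \<int>"
  using assms
proof induction
  case (Z1_binom a t)
  have "(of_int a + of_int k :: rat) gchoose t \<in> \<int>"
    by (simp flip: of_int_add of_int_gbinomial)
  then show ?case by (simp add: poly_binom_poly)
qed auto


section \<open>The extended affine symmetric group\<close>

definition S_aff :: "nat \<Rightarrow> (int \<Rightarrow> int) set" where
  "S_aff r = (if r = 0 then {id} else {w. bij w \<and> (\<forall>i. w (i + int r) = w i + int r)})"

definition W_aff :: "nat \<Rightarrow> (int \<Rightarrow> int) set" where
  "W_aff r = {w \<in> S_aff r. (\<Sum>i = 1..int r. w i) = (\<Sum>i = 1..int r. i)}"

definition s_refl :: "nat \<Rightarrow> int \<Rightarrow> int \<Rightarrow> int" where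
  "s_refl r i = (\<lambda>j. if j mod int r = i mod int r then j + 1
                     else if j mod int r = (i + 1) mod int r then j - 1
                     else j)"

text \<open>There are no simple reflections for \<open>r \<le> 1\<close>, where \<open>W_aff r\<close> is trivial.\<close>

definition simple_refls :: "nat \<Rightarrow> (int \<Rightarrow> int) set" where
  "simple_refls r = (if r \<le> 1 then {} else s_refl r ` {1..int r})"

definition coxeter_length :: "nat \<Rightarrow> (int \<Rightarrow> int) \<Rightarrow> nat" where
  "coxeter_length r w =
     (LEAST k. \<exists>ss. length ss = k \<and> set ss \<subseteq> simple_refls r \<and> foldr (\<circ>) ss id = w)"

text \<open>The power \<open>\<rho>\<^sup>m\<close> of \<open>\<rho>(j) = j + 1\<close>.\<close>

definition rho_pow :: "int \<Rightarrow> int \<Rightarrow> int" where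
  "rho_pow m = (\<lambda>j. j + m)"

definition ell :: "nat \<Rightarrow> (int \<Rightarrow> int) \<Rightarrow> nat" where
  "ell r w = coxeter_length r (THE u. u \<in> W_aff r \<and> (\<exists>m. w = rho_pow m \<circ> u))"


section \<open>The extended affine Hecke algebra\<close>

text \<open>
  Laurent polynomials in \<open>v\<close> over the integers are the group ring of the additive group of
  integers: \<open>Poly_Mapping.single k c\<close> is \<open>c v\<^sup>k\<close>.
\<close>

type_synonym laurent = "int \<Rightarrow>\<^sub>0 int"

definition v_pow :: "int \<Rightarrow> laurent" where
  "v_pow k = Poly_Mapping.single k 1"

text \<open>Finite formal linear combinations of the symbols \<open>T w\<close>.\<close>

type_synonym hecke = "(int \<Rightarrow> int) \<Rightarrow>\<^sub>0 laurent"

definition T :: "(int \<Rightarrow> int) \<Rightarrow> hecke" where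
  "T w = Poly_Mapping.single w 1"

definition hscale :: "laurent \<Rightarrow> hecke \<Rightarrow> hecke" where
  "hscale c = Poly_Mapping.map ((*) c)"

definition hecke_ring_of :: "nat \<Rightarrow> (hecke \<Rightarrow> hecke \<Rightarrow> hecke) \<Rightarrow> hecke ring" where
  "hecke_ring_of r m =
     \<lparr>carrier = {h. Poly_Mapping.keys h \<subseteq> S_aff r}, mult = m, one = T id, zero = 0, add = (+)\<rparr>"

definition is_hecke_mult :: "nat \<Rightarrow> (hecke \<Rightarrow> hecke \<Rightarrow> hecke) \<Rightarrow> bool" where
  "is_hecke_mult r m \<longleftrightarrow>
     ring (hecke_ring_of r m) \<and>
     (\<forall>c. \<forall>x\<in>carrier (hecke_ring_of r m). \<forall>y\<in>carrier (hecke_ring_of r m).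
        m (hscale c x) y = hscale c (m x y) \<and> m x (hscale c y) = hscale c (m x y)) \<and>
     (\<forall>s\<in>simple_refls r.
        m (T s) (T s) = hscale (v_pow 2 - 1) (T s) + hscale (v_pow 2) (T id)) \<and>
     (\<forall>w\<in>S_aff r. \<forall>u\<in>S_aff r. ell r (w \<circ> u) = ell r w + ell r u \<longrightarrow>
        m (T w) (T u) = T (w \<circ> u))"

text \<open>
  Such a multiplication exists and is uniquely determined on the carrier (Iwahori--Matsumoto);
  its values off the carrier are irrelevant.
\<close>

definition hecke_alg :: "nat \<Rightarrow> hecke ring" where
  "hecke_alg r = hecke_ring_of r (SOME m. is_hecke_mult r m)"


section \<open>The affine Schur algebra\<close>

text \<open>The sets \<open>R\<^sup>\<lambda>\<^sub>j\<close>; here \<open>j = i + k n\<close> with \<open>1 \<le> i \<le> n\<close>.\<close>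

definition R_set :: "nat \<Rightarrow> nat \<Rightarrow> zseq \<Rightarrow> int \<Rightarrow> int set" where
  "R_set n r l j =
     (let i = (j - 1) mod int n + 1; k = (j - 1) div int n;
          b = k * int r + (\<Sum>t = 1..i - 1. l t)
      in {b + 1..b + l i})"

definition young :: "nat \<Rightarrow> nat \<Rightarrow> zseq \<Rightarrow> (int \<Rightarrow> int) set" where
  "young n r l = {w \<in> S_aff r. \<forall>i\<in>{1..int n}. w ` R_set n r l i = R_set n r l i}"

definition x_elt :: "nat \<Rightarrow> nat \<Rightarrow> zseq \<Rightarrow> hecke" where
  "x_elt n r l = (\<Sum>w\<in>young n r l. T w)"

definition x_ideal :: "nat \<Rightarrow> nat \<Rightarrow> zseq \<Rightarrow> hecke set" where
  "x_ideal n r l = {x_elt n r l \<otimes>\<^bsub>hecke_alg r\<^esub> h |h. h \<in> carrier (hecke_alg r)}"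

text \<open>
  The direct sum of the right modules \<open>x\<^sub>\<lambda> H\<close>, where \<open>\<lambda>\<close> runs over the finite set
  \<open>Lambda_aff n r\<close>. A family is zero outside this set.
\<close>

type_synonym tensor = "zseq \<Rightarrow> hecke"

definition tensor_space :: "nat \<Rightarrow> nat \<Rightarrow> tensor set" where
  "tensor_space n r =
     {f. (\<forall>l\<in>Lambda_aff n r. f l \<in> x_ideal n r l) \<and> (\<forall>l. l \<notin> Lambda_aff n r \<longrightarrow> f l = 0)}"

definition inj_comp :: "zseq \<Rightarrow> hecke \<Rightarrow> tensor" where
  "inj_comp l x = (\<lambda>l'. if l' = l then x else 0)"

definition right_act :: "nat \<Rightarrow> tensor \<Rightarrow> hecke \<Rightarrow> tensor" where
  "right_act r f h = (\<lambda>l. f l \<otimes>\<^bsub>hecke_alg r\<^esub> h)"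

definition tensor_add :: "tensor \<Rightarrow> tensor \<Rightarrow> tensor" where
  "tensor_add f g = (\<lambda>l. f l + g l)"

text \<open>
  Endomorphisms of right modules; they are automatically linear over the Laurent polynomials.
\<close>

definition schur_alg :: "nat \<Rightarrow> nat \<Rightarrow> (tensor \<Rightarrow> tensor) ring" where
  "schur_alg n r =
     \<lparr>carrier = {p. p \<in> tensor_space n r \<rightarrow>\<^sub>E tensor_space n r \<and>
        (\<forall>f\<in>tensor_space n r. \<forall>g\<in>tensor_space n r.
           p (tensor_add f g) = tensor_add (p f) (p g)) \<and>
        (\<forall>f\<in>tensor_space n r. \<forall>h\<in>carrier (hecke_alg r).
           p (right_act r f h) = right_act r (p f) h)},
      mult = (\<lambda>p q. compose (tensor_space n r) p q),
      one = (\<lambda>f\<in>tensor_space n r. f),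
      zero = (\<lambda>f\<in>tensor_space n r. (\<lambda>l. 0)),
      add = (\<lambda>p q. \<lambda>f\<in>tensor_space n r. tensor_add (p f) (q f))\<rparr>"

definition schur_scale :: "nat \<Rightarrow> nat \<Rightarrow> laurent \<Rightarrow> (tensor \<Rightarrow> tensor) \<Rightarrow> tensor \<Rightarrow> tensor" where
  "schur_scale n r c p = (\<lambda>f\<in>tensor_space n r. \<lambda>l. hscale c (p f l))"

definition dist_reps :: "nat \<Rightarrow> nat \<Rightarrow> zseq \<Rightarrow> (int \<Rightarrow> int) set" where
  "dist_reps n r l =
     {d \<in> S_aff r. \<forall>w\<in>young n r l. ell r (w \<circ> d) = ell r w + ell r d}"

definition dist_double_reps :: "nat \<Rightarrow> nat \<Rightarrow> zseq \<Rightarrow> zseq \<Rightarrow> (int \<Rightarrow> int) set" where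
  "dist_double_reps n r l m = dist_reps n r l \<inter> inv_into UNIV ` dist_reps n r m"

definition double_coset_sum ::
  "nat \<Rightarrow> nat \<Rightarrow> zseq \<Rightarrow> (int \<Rightarrow> int) \<Rightarrow> zseq \<Rightarrow> hecke" where
  "double_coset_sum n r l d m = (\<Sum>w\<in>{u \<circ> d \<circ> u' |u u'. u \<in> young n r l \<and> u' \<in> young n r m}. T w)"

definition phi :: "nat \<Rightarrow> nat \<Rightarrow> zseq \<Rightarrow> (int \<Rightarrow> int) \<Rightarrow> zseq \<Rightarrow> tensor \<Rightarrow> tensor" where
  "phi n r l d m =
     (THE p. p \<in> carrier (schur_alg n r) \<and>
        (\<forall>k\<in>Lambda_aff n r. \<forall>h\<in>carrier (hecke_alg r).
           p (inj_comp k (x_elt n r k \<otimes>\<^bsub>hecke_alg r\<^esub> h)) =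
           inj_comp l (if m = k then double_coset_sum n r l d m \<otimes>\<^bsub>hecke_alg r\<^esub> h else 0)))"

definition mat_of_triple :: "nat \<Rightarrow> nat \<Rightarrow> zseq \<Rightarrow> (int \<Rightarrow> int) \<Rightarrow> zseq \<Rightarrow> zmat" where
  "mat_of_triple n r l d m = (\<lambda>i j. int (card (R_set n r l i \<inter> d ` R_set n r m j)))"

definition e_basis :: "nat \<Rightarrow> nat \<Rightarrow> zmat \<Rightarrow> tensor \<Rightarrow> tensor" where
  "e_basis n r A =
     (case (THE (l, d, m). l \<in> Lambda_aff n r \<and> m \<in> Lambda_aff n r \<and>
              d \<in> dist_double_reps n r l m \<and> A = mat_of_triple n r l d m)
      of (l, d, m) \<Rightarrow> phi n r l d m)"

text \<open>
  Only finitely many of the terms of \<open>d_A\<close> are nonzero; the sum is restricted to those.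
\<close>

definition d_exp :: "nat \<Rightarrow> zmat \<Rightarrow> int" where
  "d_exp n A =
     (\<Sum>(i, j, k, l) \<in> {(i, j, k, l). 1 \<le> i \<and> i \<le> int n \<and> i \<ge> k \<and> j < l \<and> A i j * A k l \<noteq> 0}.
        A i j * A k l)"

definition bracket :: "nat \<Rightarrow> nat \<Rightarrow> zmat \<Rightarrow> tensor \<Rightarrow> tensor" where
  "bracket n r A = schur_scale n r (v_pow (- d_exp n A)) (e_basis n r A)"


section \<open>Specialization at \<open>v = 1\<close>\<close>

text \<open>
  The map \<open>v \<mapsto> 1\<close> from Laurent polynomials onto the integers has kernel generated by \<open>v - 1\<close>,
  so the base change of the Schur algebra \<open>S\<close> along it is the quotient ring \<open>S / (v - 1) S\<close>, with
  \<open>p \<otimes> 1\<close> the class of \<open>p\<close>.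
\<close>

definition v1_ideal :: "nat \<Rightarrow> nat \<Rightarrow> (tensor \<Rightarrow> tensor) set" where
  "v1_ideal n r = schur_scale n r (v_pow 1 - 1) ` carrier (schur_alg n r)"

definition schur_alg_Z :: "nat \<Rightarrow> nat \<Rightarrow> (tensor \<Rightarrow> tensor) set ring" where
  "schur_alg_Z n r = schur_alg n r Quot v1_ideal n r"

text \<open>To be used for \<open>A\<close> in \<open>Theta_tilde n\<close> with \<open>sigma_mat n A = int r\<close>.\<close>

definition bracket1 :: "nat \<Rightarrow> nat \<Rightarrow> zmat \<Rightarrow> (tensor \<Rightarrow> tensor) set" where
  "bracket1 n r A =
     (if A \<in> Theta_aff_r n r then v1_ideal n r +>\<^bsub>schur_alg n r\<^esub> bracket n r A
      else \<zero>\<^bsub>schur_alg_Z n r\<^esub>)"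


section \<open>Stable expansions of products\<close>

text \<open>
  The list \<open>XPs\<close> consists of the pairs \<open>(X\<^sub>i, P\<^sub>i)\<close>. The condition \<open>sigma_mat n X = sigma_mat n A\<close>
  says that all \<open>[\<^sub>aX\<^sub>i]\<^sub>1\<close> live in the algebra of degree \<open>a n + \<sigma>(A)\<close>, and the bound on
  \<open>a\<^sub>0\<close> that this degree is nonnegative. The values \<open>P\<^sub>i(a)\<close> are integers by
  \<open>Z1_integer_valued\<close>, so the floor merely changes their type.
\<close>

definition stable_expansion :: "nat \<Rightarrow> zmat \<Rightarrow> zmat \<Rightarrow> (zmat \<times> rat poly) list \<Rightarrow> bool" where
  "stable_expansion n B A XPs \<longleftrightarrow>
     distinct (map fst XPs) \<and>
     (\<forall>(X, P)\<in>set XPs. X \<in> Theta_tilde n \<and> sigma_mat n X = sigma_mat n A \<and> P \<in> Z1 \<and> P \<noteq> 0) \<and>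
     (\<exists>a0::int. 0 \<le> a0 \<and> 0 \<le> a0 * int n + sigma_mat n A \<and>
        (\<forall>a\<ge>a0. let r = nat (a * int n + sigma_mat n A); S = schur_alg_Z n r in
           bracket1 n r (shift_diag a B) \<otimes>\<^bsub>S\<^esub> bracket1 n r (shift_diag a A) =
           (\<Oplus>\<^bsub>S\<^esub>i\<in>{..<length XPs}.
              [\<lfloor>poly (snd (XPs ! i)) (of_int a)\<rfloor>] \<cdot>\<^bsub>S\<^esub>
                bracket1 n r (shift_diag a (fst (XPs ! i))))))"

end

theory Submission
  imports Defs
begin

text \<open>The proof rests on three observations.

  At \<open>v = 1\<close> the product of two basis elements can be counted. The basis element of a matrix \<open>A\<close> acts
  through the sum over a double coset of Young subgroups, and at \<open>v = 1\<close> the Hecke algebra becomes a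
  group ring (\<open>eps_T_star\<close>). A coset of the Young subgroup of \<open>\<mu>\<close> is the same thing as a periodic
  colouring of the integers in which \<open>\<mu>\<^sub>j\<close> integers have colour \<open>j\<close>, and the matrix of a double coset
  records the joint distribution of two colourings. So the coefficient of \<open>[X]\<^sub>1\<close> in \<open>[B]\<^sub>1 [A]\<^sub>1\<close> is
  the number of colourings \<open>f\<close> that have joint distribution \<open>B\<close> with a first and \<open>A\<close> with a second
  colouring, where these two have joint distribution \<open>X\<close> (\<open>chi_product\<close>).

  These colourings can be sorted by the array \<open>t\<close> whose entry \<open>t i c j\<close> is the number of integers with
  first colour \<open>i\<close>, second colour \<open>j\<close> and \<open>f\<close>-colour \<open>c\<close>. Its sums over \<open>j\<close>, \<open>i\<close> and \<open>c\<close> are \<open>B\<close>, \<open>A\<close>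
  and \<open>X\<close>, and the colourings with a given array are counted by a product of multinomial
  coefficients, one for each pair \<open>(i, j)\<close> up to periodicity (\<open>card_colourings\<close>).

  Adding \<open>a\<close> to the diagonals of \<open>A\<close> and \<open>B\<close> adds \<open>a\<close> to the entries \<open>t i i i\<close> and leaves the others alone
  (\<open>arrays_shift\<close>). The remaining entries are bounded, so one finite set of arrays serves all large \<open>a\<close>
  (\<open>finite_arrays\<close>). In the multinomial coefficient of a pair \<open>(i, i)\<close> only the class of colour \<open>i\<close> grows with
  \<open>a\<close>, so it is a constant multiple of a binomial coefficient \<open>x + a\<close> over \<open>k\<close> with \<open>x\<close> and \<open>k\<close> fixed, and the
  other factors are constant. Hence the coefficients are values at \<open>a\<close> of polynomials in \<open>Z1\<close>
  (\<open>card_colourings_poly\<close>). Uniqueness follows because the \<open>[X]\<^sub>1\<close> are linearly independent and a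
  polynomial is determined by its values at large integers (\<open>stable_expansion_coeffs\<close>).

  To get there, the Hecke algebra has to be shown to exist, as the commutant of the right
  multiplication operators, and the length function is identified with the number of inversions.
  The double coset basis is constructed from shortest coset representatives, which are the
  permutations whose inverse is increasing on blocks. Since the expansion only concerns large \<open>a\<close>, all
  of this is done for rank at least two.\<close>

section \<open>The extended affine symmetric group\<close>

lemma quasi_periodic:
  fixes f :: "int \<Rightarrow> int" and R N :: int
  assumes "\<And>i. f (i + R) = f i + N"
  shows "f (i + k * R) = f i + k * N"
proof (induction k rule: int_induct[where k = 0])
  case base show ?case by simp
next
  case (step1 k)
  have "f (i + (k + 1) * R) = f ((i + k * R) + R)" by (simp add: algebra_simps)
  then show ?case using assms[of "i + k * R"] step1 by (simp add: algebra_simps)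
next
  case (step2 k)
  have "f (i + k * R) = f ((i + (k - 1) * R) + R)" by (simp add: algebra_simps)
  then show ?case using assms[of "i + (k - 1) * R"] step2 by (simp add: algebra_simps)
qed

abbreviation ginv :: "('a \<Rightarrow> 'b) \<Rightarrow> 'b \<Rightarrow> 'a" where
  "ginv \<equiv> inv_into UNIV"

text \<open>Inversions are counted modulo the simultaneous shift of both positions by \<open>r\<close>: the first position is
  kept in one period. This makes their number finite; it is the Coxeter length.\<close>

definition invs :: "nat \<Rightarrow> (int \<Rightarrow> int) \<Rightarrow> (int \<times> int) set" where
  "invs r w = {(i, j). 1 \<le> i \<and> i \<le> int r \<and> i < j \<and> w j < w i}"

definition inum :: "nat \<Rightarrow> (int \<Rightarrow> int) \<Rightarrow> nat" where
  "inum r w = card (invs r w)"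

locale affine_rank =
  fixes r :: nat
  assumes r2: "2 \<le> r"
begin

abbreviation "G \<equiv> S_aff r"
abbreviation "s \<equiv> s_refl r"

lemma G_iff: "w \<in> G \<longleftrightarrow> bij w \<and> (\<forall>i. w (i + int r) = w i + int r)"
  using r2 by (simp add: S_aff_def)

lemma G_bij: "w \<in> G \<Longrightarrow> bij w"
  by (simp add: G_iff)

lemma G_period: "w \<in> G \<Longrightarrow> w (i + k * int r) = w i + k * int r"
  by (rule quasi_periodic) (simp add: G_iff)

lemma G_id [simp]: "id \<in> G"
  by (simp add: G_iff)

lemma G_comp: "w \<in> G \<Longrightarrow> u \<in> G \<Longrightarrow> w \<circ> u \<in> G"
  by (simp add: G_iff bij_comp)

lemma G_inv: assumes "w \<in> G" shows "ginv w \<in> G"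
proof -
  have b: "bij w" using assms by (rule G_bij)
  have "ginv w (i + int r) = ginv w i + int r" for i
  proof -
    have "w (ginv w i + int r) = i + int r"
      using assms by (simp add: G_iff surj_f_inv_f bij_is_surj)
    then show ?thesis using b by (metis bij_inv_eq_iff)
  qed
  then show ?thesis using b by (simp add: G_iff bij_imp_bij_inv)
qed

lemma G_inv_f [simp]: "w \<in> G \<Longrightarrow> ginv w (w i) = i"
  by (simp add: G_bij bij_is_inj inv_f_f)

lemma G_f_inv [simp]: "w \<in> G \<Longrightarrow> w (ginv w i) = i"
  by (simp add: G_bij bij_is_surj surj_f_inv_f)

lemma G_inv_comp [simp]: "w \<in> G \<Longrightarrow> ginv w \<circ> w = id" "w \<in> G \<Longrightarrow> w \<circ> ginv w = id"
  by auto

lemma G_inv_inv [simp]: "w \<in> G \<Longrightarrow> ginv (ginv w) = w"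
  by (simp add: G_bij inv_inv_eq)

lemma G_inv_of_comp: "w \<in> G \<Longrightarrow> u \<in> G \<Longrightarrow> ginv (w \<circ> u) = ginv u \<circ> ginv w"
  by (simp add: G_bij o_inv_distrib)

lemma G_eq_iff: "w \<in> G \<Longrightarrow> w i = w j \<longleftrightarrow> i = j"
  by (metis G_inv_f)

lemma rho_G [simp]: "rho_pow m \<in> G"
proof -
  have "bij (rho_pow m)"
    by (rule bij_betw_byWitness[where f' = "rho_pow (- m)"]) (auto simp: rho_pow_def)
  then show ?thesis by (simp add: G_iff rho_pow_def)
qed

lemma rho_comp [simp]: "rho_pow a \<circ> rho_pow b = rho_pow (a + b)"
  by (auto simp: rho_pow_def)

lemma rho_0 [simp]: "rho_pow 0 = id"
  by (auto simp: rho_pow_def)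

lemma rho_inv [simp]: "ginv (rho_pow m) = rho_pow (- m)"
  by (rule inv_unique_comp) simp_all

lemma mod_plus1_neq: "x mod int r = t mod int r \<Longrightarrow> (x + 1) mod int r \<noteq> t mod int r"
proof
  assume "x mod int r = t mod int r" "(x + 1) mod int r = t mod int r"
  then have "int r dvd (x + 1) - x" by (metis mod_eq_dvd_iff)
  then show False using r2 by simp
qed

lemma mod_shift_iff: "x mod int r = (t + 1) mod int r \<longleftrightarrow> (x - 1) mod int r = t mod int r"
  by (simp add: mod_eq_dvd_iff algebra_simps)

lemma s_eq: "s t x = (if x mod int r = t mod int r then x + 1
    else if (x - 1) mod int r = t mod int r then x - 1 else x)"
  by (simp add: s_refl_def mod_shift_iff)

lemma s_at [simp]: "s t t = t + 1" "s t (t + 1) = t"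
  using mod_plus1_neq[of t t] by (auto simp: s_eq)

lemma s_mod: "s (t mod int r) = s t"
  by (rule ext) (simp add: s_eq)

lemma s_invol [simp]: "s t (s t x) = x"
  using mod_plus1_neq[of x t] mod_plus1_neq[of "x - 1" t] by (auto simp: s_eq)

lemma s_comp_s [simp]: "s t \<circ> s t = id" "s t \<circ> (s t \<circ> w) = w" "w \<circ> s t \<circ> s t = w"
  by auto

lemma s_G [simp]: "s t \<in> G"
proof -
  have "bij (s t)"
    by (rule bij_betw_byWitness[where f' = "s t"]) auto
  moreover have "s t (i + int r) = s t i + int r" for i
  proof -
    have "(i + int r - 1) mod int r = (i - 1) mod int r"
      by (metis add_diff_eq add.commute diff_add_eq mod_add_self2)
    then show ?thesis by (simp add: s_eq)
  qed
  ultimately show ?thesis by (simp add: G_iff)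
qed

lemma s_inv [simp]: "ginv (s t) = s t"
  by (rule inv_unique_comp) simp_all

lemma s_less_iff:
  assumes "x \<noteq> y"
  shows "s t y < s t x \<longleftrightarrow>
    (y < x \<and> \<not> (x = y + 1 \<and> y mod int r = t mod int r)) \<or> (y = x + 1 \<and> x mod int r = t mod int r)"
proof -
  have ne: "s t x \<noteq> s t y" using assms by (metis s_invol)
  have b: "x - 1 \<le> s t x" "s t x \<le> x + 1" "y - 1 \<le> s t y" "s t y \<le> y + 1"
    by (simp_all add: s_eq)
  have far: ?thesis if "x \<noteq> y + 1" "y \<noteq> x + 1"
    using that ne b assms by linarith
  have near1: ?thesis if "x = y + 1"
    using that mod_plus1_neq[of y t] mod_plus1_neq[of "y - 1" t] mod_plus1_neq[of "y + 1" t]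
    by (auto simp: s_eq)
  have near2: ?thesis if "y = x + 1"
    using that mod_plus1_neq[of x t] mod_plus1_neq[of "x - 1" t] mod_plus1_neq[of "x + 1" t]
    by (auto simp: s_eq)
  show ?thesis using far near1 near2 by blast
qed

lemma G_bounded:
  assumes "w \<in> G"
  obtains C where "\<And>i. \<bar>w i - i\<bar> \<le> C"
proof
  fix i
  define C where "C = Max ((\<lambda>i. \<bar>w i - i\<bar>) ` {0..<int r})"
  have "w i = w (i mod int r) + (i div int r) * int r"
    using G_period[OF assms, of "i mod int r" "i div int r"] by simp
  moreover have "i mod int r + (i div int r) * int r = i" by simp
  ultimately have "w i - i = w (i mod int r) - i mod int r" by linarith
  moreover have "\<bar>w (i mod int r) - i mod int r\<bar> \<le> C"
    unfolding C_def using r2 by (intro Max_ge) auto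
  ultimately show "\<bar>w i - i\<bar> \<le> Max ((\<lambda>i. \<bar>w i - i\<bar>) ` {0..<int r})"
    unfolding C_def by simp
qed

lemma finite_invs: assumes "w \<in> G" shows "finite (invs r w)"
proof -
  obtain C where C: "\<And>i. \<bar>w i - i\<bar> \<le> C" using G_bounded[OF assms] by blast
  have "invs r w \<subseteq> {1..int r} \<times> {1..int r + 2 * C}"
  proof
    fix p assume "p \<in> invs r w"
    then obtain i j where p: "p = (i, j)" "1 \<le> i" "i \<le> int r" "i < j" "w j < w i"
      by (auto simp: invs_def)
    then show "p \<in> {1..int r} \<times> {1..int r + 2 * C}"
      using C[of i] C[of j] by auto
  qed
  then show ?thesis by (rule finite_subset) auto
qed

lemma inum_rho_comp: "inum r (rho_pow m \<circ> w) = inum r w"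
  by (simp add: inum_def invs_def rho_pow_def)

lemma inum_rho [simp]: "inum r (rho_pow m) = 0"
proof -
  have "invs r (rho_pow m) = {}" by (auto simp: invs_def rho_pow_def)
  then show ?thesis by (simp add: inum_def)
qed

lemma residue_decomp: obtains k where "1 \<le> i + k * int r" "i + k * int r \<le> int r"
proof
  have "i + (- ((i - 1) div int r)) * int r = (i - 1) mod int r + 1"
    by (simp add: minus_mult_div_eq_mod[symmetric] algebra_simps)
  then show "1 \<le> i + (- ((i - 1) div int r)) * int r"
    and "i + (- ((i - 1) div int r)) * int r \<le> int r"
    using r2 pos_mod_bound[of "int r" "i - 1"] pos_mod_sign[of "int r" "i - 1"] by linarith+
qed

lemma residue_unique:
  assumes "1 \<le> i" "i \<le> int r" "1 \<le> i + k * int r" "i + k * int r \<le> int r"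
  shows "k = 0"
proof -
  have b: "k * int r < int r" "- int r < k * int r" using assms by linarith+
  have "\<not> 1 \<le> k"
    using mult_right_mono[of 1 k "int r"] b by linarith
  moreover have "\<not> k \<le> -1"
    using mult_right_mono[of k "-1" "int r"] b by linarith
  ultimately show ?thesis by linarith
qed

text \<open>Composing with \<open>s t\<close> on the left exchanges the values \<open>t + k r\<close> and \<open>t + 1 + k r\<close>. These are
  adjacent, so no comparison with a third value changes, and exactly one orbit of pairs is affected.\<close>

lemma inum_step_up:
  assumes w: "w \<in> G" and up: "ginv w t < ginv w (t + 1)"
  shows "inum r (s t \<circ> w) = Suc (inum r w)"
proof -
  obtain k where k: "1 \<le> ginv w t + k * int r" "ginv w t + k * int r \<le> int r"
    using residue_decomp by blast
  \<comment> \<open>The positions of the values \<open>t\<close> and \<open>t + 1\<close>, moved so that the first lies in the first period.\<close>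
  define p q where "p = ginv w t + k * int r" and "q = ginv w (t + 1) + k * int r"
  have wp: "w p = t + k * int r" and wq: "w q = t + 1 + k * int r"
    using w by (simp_all add: p_def q_def G_period)
  have pq: "p < q" using up by (simp add: p_def q_def)
  have "invs r (s t \<circ> w) = insert (p, q) (invs r w)"
  proof (rule Set.set_eqI)
    fix ij :: "int \<times> int"
    obtain i j where ij_eq: "ij = (i, j)" by (cases ij)
    have "(i, j) \<in> invs r (s t \<circ> w) \<longleftrightarrow> (i, j) \<in> insert (p, q) (invs r w)"
    proof (cases "1 \<le> i \<and> i \<le> int r \<and> i < j")
      case True
      then have ij: "1 \<le> i" "i \<le> int r" "i < j" by auto
      have "w i \<noteq> w j" using ij w by (simp add: G_eq_iff)
      note eq = s_less_iff[OF this, of t]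
      have no: "\<not> (w i = w j + 1 \<and> w j mod int r = t mod int r)"
      proof
        assume a: "w i = w j + 1 \<and> w j mod int r = t mod int r"
        then have "int r dvd w j - t" by (simp add: mod_eq_dvd_iff)
        then obtain l where "w j = t + l * int r" by (metis dvdE add.commute diff_add_cancel mult.commute)
        then have "w j = w (ginv w t + l * int r)" "w i = w (ginv w (t + 1) + l * int r)"
          using w a by (simp_all add: G_period)
        then have "j = ginv w t + l * int r" "i = ginv w (t + 1) + l * int r"
          using w by (simp_all add: G_eq_iff)
        then show False using ij up by simp
      qed
      have yes: "w j = w i + 1 \<and> w i mod int r = t mod int r \<longleftrightarrow> i = p \<and> j = q"
      proof
        assume a: "w j = w i + 1 \<and> w i mod int r = t mod int r"
        then have "int r dvd w i - t" by (simp add: mod_eq_dvd_iff)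
        then obtain l where "w i = t + l * int r" by (metis dvdE add.commute diff_add_cancel mult.commute)
        then have "w i = w (ginv w t + l * int r)" "w j = w (ginv w (t + 1) + l * int r)"
          using w a by (simp_all add: G_period)
        then have e: "i = ginv w t + l * int r" "j = ginv w (t + 1) + l * int r"
          using w by (simp_all add: G_eq_iff)
        have "p = i + (k - l) * int r" by (simp add: p_def e algebra_simps)
        then have "k - l = 0" using ij k residue_unique[of i "k - l"] by (simp add: p_def)
        then show "i = p \<and> j = q" by (simp add: e p_def q_def)
      next
        assume "i = p \<and> j = q"
        then show "w j = w i + 1 \<and> w i mod int r = t mod int r" by (simp add: wp wq)
      qed
      show ?thesis using eq no yes ij by (auto simp: invs_def)
    next
      case False
      then show ?thesis using k pq by (auto simp: invs_def p_def[symmetric])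
    qed
    then show "ij \<in> invs r (s t \<circ> w) \<longleftrightarrow> ij \<in> insert (p, q) (invs r w)"
      by (simp add: ij_eq)
  qed
  moreover have "(p, q) \<notin> invs r w" by (simp add: invs_def wp wq)
  ultimately show ?thesis using finite_invs[OF w] by (simp add: inum_def)
qed

lemma inv_s_comp: "w \<in> G \<Longrightarrow> ginv (s t \<circ> w) = ginv w \<circ> s t"
  by (simp add: G_inv_of_comp)

lemma inv_comp_s: "w \<in> G \<Longrightarrow> ginv (w \<circ> s t) = s t \<circ> ginv w"
  by (simp add: G_inv_of_comp)

lemma inum_step_down:
  assumes w: "w \<in> G" and down: "\<not> ginv w t < ginv w (t + 1)"
  shows "inum r w = Suc (inum r (s t \<circ> w))"
proof -
  have "ginv w t \<noteq> ginv w (t + 1)" using w by (metis G_f_inv add_cancel_right_right zero_neq_one)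
  then have "ginv (s t \<circ> w) t < ginv (s t \<circ> w) (t + 1)"
    using down w by (simp add: inv_s_comp)
  from inum_step_up[OF G_comp[OF s_G w] this] show ?thesis by (simp add: comp_assoc)
qed

text \<open>An increasing bijection cannot skip a value: there would be no position left for it.\<close>

lemma strict_mono_G_imp_rho:
  assumes w: "w \<in> G" and mono: "\<And>t. w t < w (t + 1)"
  shows "\<exists>m. w = rho_pow m"
proof -
  have less: "w x < w y" if "x < y" for x y
    using that
  proof (induction rule: int_gr_induct)
    case base
    show ?case by (rule mono)
  next
    case (step y)
    then show ?case using mono[of y] by linarith
  qed
  have "w (t + 1) = w t + 1" for t
  proof (rule ccontr)
    assume "w (t + 1) \<noteq> w t + 1"
    then have a: "w t < w t + 1" "w t + 1 < w (t + 1)" using mono[of t] by linarith+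
    define x where "x = ginv w (w t + 1)"
    have wx: "w x = w t + 1" using w by (simp add: x_def)
    have "\<not> x \<le> t" using less[of x t] wx by (cases "x = t") auto
    moreover have "\<not> x \<ge> t + 1" using less[of "t + 1" x] wx a by (cases "x = t + 1") auto
    ultimately show False by linarith
  qed
  then have q: "w (0 + k * 1) = w 0 + k * 1" for k by (rule quasi_periodic[of w 1 1])
  have "w k = rho_pow (w 0) k" for k
    unfolding rho_pow_def using q[of k] by simp
  then have "w = rho_pow (w 0)" by (rule ext)
  then show ?thesis by (rule exI)
qed

text \<open>A permutation that is not a shift can be shortened by a simple reflection on the left, which
  gives an induction principle over the group.\<close>

lemma G_induct [consumes 1, case_names rho step]:
  assumes "w \<in> G"
    and rho: "\<And>m. P (rho_pow m)"
    and step: "\<And>t w. w \<in> G \<Longrightarrow> ginv w t < ginv w (t + 1) \<Longrightarrow> P w \<Longrightarrow> P (s t \<circ> w)"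
  shows "P w"
  using assms(1)
proof (induction "inum r w" arbitrary: w rule: less_induct)
  case less
  show ?case
  proof (cases "\<forall>t. ginv w t < ginv w (t + 1)")
    case True
    then obtain m where "ginv w = rho_pow m"
      using strict_mono_G_imp_rho[OF G_inv[OF less.prems]] by blast
    then have "w = rho_pow (- m)" using less.prems by (metis G_inv_inv rho_inv)
    then show ?thesis using rho by simp
  next
    case False
    then obtain t where t: "\<not> ginv w t < ginv w (t + 1)" by blast
    have u: "s t \<circ> w \<in> G" using less.prems by (simp add: G_comp)
    have "ginv w t \<noteq> ginv w (t + 1)"
      using less.prems by (metis G_f_inv add_cancel_right_right zero_neq_one)
    then have up: "ginv (s t \<circ> w) t < ginv (s t \<circ> w) (t + 1)"
      using t less.prems by (simp add: inv_s_comp)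
    have "P (s t \<circ> w)" using less.hyps u inum_step_down[OF less.prems t] by simp
    from step[OF u up this] show ?thesis by (simp add: comp_assoc)
  qed
qed

text \<open>Exchanging positions and values turns inversions of \<open>w\<close> into inversions of its inverse.\<close>

lemma inum_inv: assumes w: "w \<in> G" shows "inum r (ginv w) = inum r w"
proof -
  \<comment> \<open>Moves a pair along its diagonal until its first entry lies in the first period.\<close>
  define nrm where "nrm = (\<lambda>x y. (x + (- ((x - 1) div int r)) * int r, y + (- ((x - 1) div int r)) * int r))"
  define h :: "(int \<Rightarrow> int) \<Rightarrow> int \<times> int \<Rightarrow> int \<times> int" where "h = (\<lambda>w (i, j). nrm (w j) (w i))"
  have strip: "1 \<le> fst (nrm x y)" "fst (nrm x y) \<le> int r" for x y
  proof -
    have "fst (nrm x y) = (x - 1) mod int r + 1"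
      by (simp add: nrm_def minus_mult_div_eq_mod[symmetric] algebra_simps)
    then show "1 \<le> fst (nrm x y)" "fst (nrm x y) \<le> int r"
      using r2 pos_mod_bound[of "int r" "x - 1"] pos_mod_sign[of "int r" "x - 1"] by linarith+
  qed
  have nrm: "nrm (i + k * int r) (j + k * int r) = (i, j)" if "1 \<le> i" "i \<le> int r" for i j k
  proof -
    define l where "l = k - (i + k * int r - 1) div int r"
    have e: "nrm (i + k * int r) (j + k * int r) = (i + l * int r, j + l * int r)"
      by (simp add: nrm_def l_def algebra_simps)
    then have "l = 0" using strip[of "i + k * int r" "j + k * int r"] that
      by (intro residue_unique[of i]) auto
    then show ?thesis using e by simp
  qed
  have hh: "h (ginv w) (h w p) = p \<and> h w p \<in> invs r (ginv w)" if w: "w \<in> G" and p: "p \<in> invs r w" for p w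
  proof -
    obtain i j where ij: "p = (i, j)" "1 \<le> i" "i \<le> int r" "i < j" "w j < w i"
      using p by (auto simp: invs_def)
    define k where "k = - ((w j - 1) div int r)"
    have hp: "h w p = (w j + k * int r, w i + k * int r)" by (simp add: h_def ij nrm_def k_def)
    have "ginv w (w i + k * int r) = i + k * int r" "ginv w (w j + k * int r) = j + k * int r"
      using w G_period[OF G_inv[OF w]] by simp_all
    then have "h (ginv w) (h w p) = (i, j)" "h w p \<in> invs r (ginv w)"
      using nrm ij strip[of "w j" "w i"] hp by (auto simp: h_def invs_def)
    then show ?thesis by (simp add: ij)
  qed
  have "bij_betw (h w) (invs r w) (invs r (ginv w))"
    using hh[OF w] hh[OF G_inv[OF w]] w by (intro bij_betw_byWitness[where f' = "h (ginv w)"]) auto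
  then show ?thesis by (simp add: inum_def bij_betw_same_card)
qed

lemma inum_zero: assumes "w \<in> G" "inum r w = 0" shows "\<exists>m. w = rho_pow m"
proof -
  have "ginv w t < ginv w (t + 1)" for t
    using assms inum_step_down[of w t] by auto
  then obtain m where "ginv w = rho_pow m"
    using strict_mono_G_imp_rho[OF G_inv[OF assms(1)]] by blast
  then show ?thesis using assms by (metis G_inv_inv rho_inv)
qed

text \<open>The values on a period represent each residue class modulo \<open>r\<close> once.\<close>

lemma sum_periodic_G:
  fixes f :: "int \<Rightarrow> int"
  assumes w: "w \<in> G" and f: "\<And>i. f (i + int r) = f i"
  shows "(\<Sum>i = 1..int r. f (w i)) = (\<Sum>i = 1..int r. f i)"
proof -
  have fk: "f (i + k * int r) = f i" for i k
    using quasi_periodic[of f "int r" 0 i k] f by simp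
  define g where "g = (\<lambda>i. (i - 1) mod int r + 1)"
  have g: "g x = x + (- ((x - 1) div int r)) * int r" for x
    by (simp add: g_def minus_mult_div_eq_mod[symmetric] algebra_simps)
  have gr: "1 \<le> g x" "g x \<le> int r" for x
    using r2 pos_mod_bound[of "int r" "x - 1"] pos_mod_sign[of "int r" "x - 1"]
    unfolding g_def by linarith+
  have gg: "g (i + k * int r) = i" if "1 \<le> i" "i \<le> int r" for i k
  proof -
    have "g (i + k * int r) = i + (k - (i + k * int r - 1) div int r) * int r"
      by (simp add: g algebra_simps)
    moreover from this have "k - (i + k * int r - 1) div int r = 0"
      using that gr[of "i + k * int r"] by (intro residue_unique[of i]) auto
    ultimately show ?thesis by simp
  qed
  have gp: "g (u (g (ginv u i))) = i" if "1 \<le> i" "i \<le> int r" "u \<in> G" for i u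
  proof -
    have "u (g (ginv u i)) = i + (- ((ginv u i - 1) div int r)) * int r"
      unfolding g[of "ginv u i"] using that
      by (simp only: G_period[OF that(3)] G_f_inv)
    then show ?thesis using gg[OF that(1,2)] by (simp only:)
  qed
  show ?thesis
  proof (rule sum.reindex_bij_witness[where i = "\<lambda>i. g (ginv w i)" and j = "\<lambda>i. g (w i)"])
    fix a assume "a \<in> {1..int r}"
    then show "g (ginv w (g (w a))) = a" using gp[of a "ginv w"] w by (simp add: G_inv)
    show "f (g (w a)) = f (w a)" by (simp only: g fk)
  qed (use gr gp[OF _ _ w] in auto)
qed

text \<open>The total displacement over a period. It is a homomorphism to the integers that vanishes on
  reflections and is \<open>m r\<close> on the shift by \<open>m\<close>; so it tells the affine Weyl group from the shifts.\<close>

definition disp :: "(int \<Rightarrow> int) \<Rightarrow> int" where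
  "disp w = (\<Sum>i = 1..int r. w i - i)"

lemma disp_comp: assumes w: "w \<in> G" and u: "u \<in> G" shows "disp (w \<circ> u) = disp w + disp u"
proof -
  have "(\<Sum>i = 1..int r. w (u i) - u i) = (\<Sum>i = 1..int r. w i - i)"
    by (rule sum_periodic_G[OF u, of "\<lambda>x. w x - x"]) (use w in \<open>simp add: G_iff\<close>)
  moreover have "disp (w \<circ> u) = (\<Sum>i = 1..int r. (w (u i) - u i) + (u i - i))"
    by (simp add: disp_def)
  ultimately show ?thesis by (simp only: sum.distrib disp_def)
qed

lemma disp_rho: "disp (rho_pow m) = m * int r"
  by (simp add: disp_def rho_pow_def)

lemma disp_s: "disp (s t) = 0"
proof -
  have "disp (s t \<circ> s t) = disp (s t) + disp (s t)" by (rule disp_comp) auto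
  then show ?thesis by (simp add: disp_def)
qed

lemma W_iff: "w \<in> W_aff r \<longleftrightarrow> w \<in> G \<and> disp w = 0"
  by (auto simp: W_aff_def disp_def sum_subtractf)

lemma s_simple: "s t \<in> simple_refls r"
proof -
  obtain k where "1 \<le> t + k * int r" "t + k * int r \<le> int r" using residue_decomp by blast
  moreover have "s t = s (t + k * int r)" by (metis s_mod mod_mult_self1)
  ultimately show ?thesis using r2 by (auto simp: simple_refls_def)
qed

lemma simple_refls_eq: "simple_refls r = range s"
  using s_simple r2 by (auto simp: simple_refls_def)

definition word_prod :: "(int \<Rightarrow> int) list \<Rightarrow> int \<Rightarrow> int" where
  "word_prod ss = foldr (\<circ>) ss id"

lemma word_prod_simps: "word_prod [] = id" "word_prod (a # ss) = a \<circ> word_prod ss"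
  by (simp_all only: word_prod_def foldr.simps o_apply id_apply)

lemma word_props:
  assumes "set ss \<subseteq> simple_refls r"
  shows "word_prod ss \<in> G \<and> disp (word_prod ss) = 0 \<and> inum r (word_prod ss) \<le> length ss"
  using assms
proof (induction ss)
  case Nil
  have "id \<in> G" by (rule G_id)
  then show ?case using inum_rho[of 0] disp_rho[of 0] unfolding word_prod_simps rho_0 mult_zero_left of_nat_0 list.size by (intro conjI; linarith)
next
  case (Cons a ss)
  then obtain t where a: "a = s t" by (auto simp: simple_refls_eq)
  let ?u = "word_prod ss"
  have u: "?u \<in> G" "disp ?u = 0" "inum r ?u \<le> length ss" using Cons by auto
  have "inum r (s t \<circ> ?u) \<le> Suc (inum r ?u)"
    using inum_step_up[OF u(1), of t] inum_step_down[OF u(1), of t] by linarith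
  then have "s t \<circ> ?u \<in> G \<and> disp (s t \<circ> ?u) = 0 \<and> inum r (s t \<circ> ?u) \<le> length (a # ss)"
    using u by (simp add: G_comp disp_comp disp_s)
  then show ?case unfolding a word_prod_simps .
qed

lemma reduced_word:
  assumes "w \<in> G"
  shows "\<exists>ss m. set ss \<subseteq> simple_refls r \<and> length ss = inum r w \<and> w = word_prod ss \<circ> rho_pow m"
  using assms
proof (induction rule: G_induct)
  case (rho m)
  have "set [] \<subseteq> simple_refls r \<and> length [] = inum r (rho_pow m) \<and> rho_pow m = word_prod [] \<circ> rho_pow m"
    by (simp add: word_prod_simps)
  then show ?case by (intro exI)
next
  case (step t w)
  then obtain ss m where "set ss \<subseteq> simple_refls r" "length ss = inum r w" "w = word_prod ss \<circ> rho_pow m"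
    by blast
  then have "set (s t # ss) \<subseteq> simple_refls r" "length (s t # ss) = inum r (s t \<circ> w)"
    "s t \<circ> w = word_prod (s t # ss) \<circ> rho_pow m"
    using step s_simple[of t] unfolding word_prod_simps by (simp_all add: inum_step_up comp_assoc)
  then show ?case by (intro exI conjI)
qed

text \<open>A word of this length exists because every element can be sorted by descents, and none is shorter
  because each letter changes the number of inversions by at most one.\<close>

lemma coxeter_length_eq: assumes "u \<in> W_aff r" shows "coxeter_length r u = inum r u"
  unfolding coxeter_length_def word_prod_def[symmetric]
proof (rule Least_equality)
  obtain ss m where ss: "set ss \<subseteq> simple_refls r" "length ss = inum r u" "u = word_prod ss \<circ> rho_pow m"
    using reduced_word assms W_iff by blast
  have "disp u = disp (word_prod ss) + m * int r"
    using ss word_props[OF ss(1)] by (simp add: disp_comp disp_rho)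
  then have "m = 0" using assms word_props[OF ss(1)] r2 by (simp add: W_iff)
  then show "\<exists>ss'. length ss' = inum r u \<and> set ss' \<subseteq> simple_refls r \<and> word_prod ss' = u"
    using ss by auto
next
  fix k assume "\<exists>ss. length ss = k \<and> set ss \<subseteq> simple_refls r \<and> word_prod ss = u"
  then show "inum r u \<le> k" using word_props by blast
qed

lemma ell_eq_inum: assumes "w \<in> G" shows "ell r w = inum r w"
proof -
  obtain ss m where ss: "set ss \<subseteq> simple_refls r" "w = word_prod ss \<circ> rho_pow m"
    using reduced_word[OF assms] by blast
  have "disp w = m * int r"
    using ss word_props[OF ss(1)] by (simp add: disp_comp disp_rho)
  define u where "u = rho_pow (- m) \<circ> w"
  have wu: "w = rho_pow m \<circ> u" by (simp add: u_def comp_assoc[symmetric])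
  have u: "u \<in> W_aff r"
    using assms \<open>disp w = _\<close> by (simp add: u_def W_iff G_comp disp_comp disp_rho)
  have "(THE u. u \<in> W_aff r \<and> (\<exists>m. w = rho_pow m \<circ> u)) = u"
  proof (rule the_equality)
    show "u \<in> W_aff r \<and> (\<exists>m. w = rho_pow m \<circ> u)" using u wu by blast
  next
    fix u' assume a: "u' \<in> W_aff r \<and> (\<exists>m. w = rho_pow m \<circ> u')"
    then obtain m' where m': "w = rho_pow m' \<circ> u'" by blast
    have "disp w = m' * int r" using a by (simp add: m' disp_comp disp_rho W_iff)
    then have "m' = m" using \<open>disp w = m * int r\<close> r2 by simp
    then show "u' = u" using m' by (simp add: u_def comp_assoc[symmetric])
  qed
  then show ?thesis by (simp add: ell_def coxeter_length_eq[OF u] wu inum_rho_comp)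
qed

end

section \<open>Formal linear combinations of group elements\<close>

abbreviation lk :: "('a \<Rightarrow>\<^sub>0 'b::zero) \<Rightarrow> 'a \<Rightarrow> 'b" where
  "lk \<equiv> Poly_Mapping.lookup"

abbreviation q :: laurent where
  "q \<equiv> v_pow 2"

lemma lk_hscale [simp]: "lk (hscale c h) w = c * lk h w"
  by (simp add: hscale_def Poly_Mapping.map.rep_eq when_def)

lemma lk_T: "lk (T w) u = (if u = w then 1 else 0)"
  by (simp add: T_def lookup_single when_def)

lemma hscale_add: "hscale c (x + y) = hscale c x + hscale c y"
  by (rule poly_mapping_eqI) (simp add: lookup_add distrib_left)

lemma hscale_hscale: "hscale c (hscale d x) = hscale (c * d) x"
  by (rule poly_mapping_eqI) (simp add: mult.assoc)

lemma hscale_1 [simp]: "hscale 1 x = x"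
  by (rule poly_mapping_eqI) simp

lemma hscale_0 [simp]: "hscale 0 x = 0" "hscale c 0 = 0"
  by (rule poly_mapping_eqI, simp)+

lemma hscale_sum: "hscale c (sum f A) = (\<Sum>a\<in>A. hscale c (f a))"
  by (rule poly_mapping_eqI) (simp add: lookup_sum sum_distrib_left)

lemma hscale_uminus: "hscale (- c) x = - hscale c x" "hscale c (- x) = - hscale c x"
  by (rule poly_mapping_eqI, simp)+

lemma expand_T: "h = (\<Sum>w\<in>Poly_Mapping.keys h. hscale (lk h w) (T w))"
proof (rule poly_mapping_eqI)
  fix u
  have "(\<Sum>w\<in>Poly_Mapping.keys h. lk h w * (if u = w then 1 else 0)) =
      (if u \<in> Poly_Mapping.keys h then lk h u else 0)"
    by (simp add: if_distrib[of "\<lambda>x. _ * x"] sum.delta cong: if_cong)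
  then show "lk h u = lk (\<Sum>w\<in>Poly_Mapping.keys h. hscale (lk h w) (T w)) u"
    by (simp add: lookup_sum lk_T in_keys_iff)
qed

lemma keys_subset_iff: "Poly_Mapping.keys h \<subseteq> X \<longleftrightarrow> (\<forall>w. w \<notin> X \<longrightarrow> lk h w = 0)"
  by (auto simp: in_keys_iff)

section \<open>Existence of the affine Hecke algebra\<close>

text \<open>The coefficients that \<open>T s y\<close> must have, where \<open>s\<close> is a simple reflection, according to the rules
  \<open>T s T w = T (s w)\<close> if \<open>s w\<close> is longer than \<open>w\<close> and \<open>T s T w = (q - 1) T w + q T (s w)\<close> otherwise.\<close>

definition Lop :: "nat \<Rightarrow> int \<Rightarrow> hecke \<Rightarrow> hecke" where
  "Lop r t y = Abs_poly_mapping (\<lambda>w. if ginv w t < ginv w (t + 1) then q * lk y (s_refl r t \<circ> w)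
     else lk y (s_refl r t \<circ> w) + (q - 1) * lk y w)"

definition Rop :: "nat \<Rightarrow> int \<Rightarrow> hecke \<Rightarrow> hecke" where
  "Rop r t y = Abs_poly_mapping (\<lambda>w. if w t < w (t + 1) then q * lk y (w \<circ> s_refl r t)
     else lk y (w \<circ> s_refl r t) + (q - 1) * lk y w)"

definition Lrho :: "int \<Rightarrow> hecke \<Rightarrow> hecke" where
  "Lrho m y = Abs_poly_mapping (\<lambda>w. lk y (rho_pow (- m) \<circ> w))"

definition Rrho :: "int \<Rightarrow> hecke \<Rightarrow> hecke" where
  "Rrho m y = Abs_poly_mapping (\<lambda>w. lk y (w \<circ> rho_pow (- m)))"

lemma rho_comp_global [simp]: "rho_pow a \<circ> (rho_pow b \<circ> w) = rho_pow (a + b) \<circ> w"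
  "w \<circ> rho_pow a \<circ> rho_pow b = w \<circ> rho_pow (a + b)" "rho_pow 0 \<circ> w = w" "w \<circ> rho_pow 0 = w"
  by (auto simp: rho_pow_def fun_eq_iff add.commute add.left_commute)

lemma lk_Lrho: "lk (Lrho m y) w = lk y (rho_pow (- m) \<circ> w)"
proof -
  have "{w. lk y (rho_pow (- m) \<circ> w) \<noteq> 0} \<subseteq> (\<lambda>u. rho_pow m \<circ> u) ` Poly_Mapping.keys y"
  proof
    fix w assume "w \<in> {w. lk y (rho_pow (- m) \<circ> w) \<noteq> 0}"
    then show "w \<in> (\<lambda>u. rho_pow m \<circ> u) ` Poly_Mapping.keys y"
      by (intro image_eqI[of _ _ "rho_pow (- m) \<circ> w"]) (auto simp: in_keys_iff)
  qed
  then have "finite {w. lk y (rho_pow (- m) \<circ> w) \<noteq> 0}"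
    by (rule finite_subset) simp
  then show ?thesis by (simp add: Lrho_def)
qed

lemma lk_Rrho: "lk (Rrho m y) w = lk y (w \<circ> rho_pow (- m))"
proof -
  have "{w. lk y (w \<circ> rho_pow (- m)) \<noteq> 0} \<subseteq> (\<lambda>u. u \<circ> rho_pow m) ` Poly_Mapping.keys y"
  proof
    fix w assume "w \<in> {w. lk y (w \<circ> rho_pow (- m)) \<noteq> 0}"
    then show "w \<in> (\<lambda>u. u \<circ> rho_pow m) ` Poly_Mapping.keys y"
      by (intro image_eqI[of _ _ "w \<circ> rho_pow (- m)"]) (auto simp: in_keys_iff)
  qed
  then have "finite {w. lk y (w \<circ> rho_pow (- m)) \<noteq> 0}"
    by (rule finite_subset) simp
  then show ?thesis by (simp add: Rrho_def)
qed

context affine_rank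
begin

lemma lk_Lop: "lk (Lop r t y) w = (if ginv w t < ginv w (t + 1) then q * lk y (s t \<circ> w)
     else lk y (s t \<circ> w) + (q - 1) * lk y w)"
proof -
  let ?f = "\<lambda>w. if ginv w t < ginv w (t + 1) then q * lk y (s t \<circ> w)
     else lk y (s t \<circ> w) + (q - 1) * lk y w"
  have "{w. ?f w \<noteq> 0} \<subseteq> Poly_Mapping.keys y \<union> (\<lambda>u. s t \<circ> u) ` Poly_Mapping.keys y"
  proof
    fix w assume "w \<in> {w. ?f w \<noteq> 0}"
    then have "lk y (s t \<circ> w) \<noteq> 0 \<or> lk y w \<noteq> 0" by (auto split: if_splits)
    moreover have "w \<in> (\<lambda>u. s t \<circ> u) ` Poly_Mapping.keys y" if "lk y (s t \<circ> w) \<noteq> 0"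
      using that by (intro image_eqI[of _ _ "s t \<circ> w"]) (auto simp: in_keys_iff)
    ultimately show "w \<in> Poly_Mapping.keys y \<union> (\<lambda>u. s t \<circ> u) ` Poly_Mapping.keys y"
      by (auto simp: in_keys_iff)
  qed
  then have "finite {w. ?f w \<noteq> 0}" by (rule finite_subset) simp
  then show ?thesis by (simp add: Lop_def)
qed

lemma lk_Rop: "lk (Rop r t y) w = (if w t < w (t + 1) then q * lk y (w \<circ> s t)
     else lk y (w \<circ> s t) + (q - 1) * lk y w)"
proof -
  let ?f = "\<lambda>w. if w t < w (t + 1) then q * lk y (w \<circ> s t)
     else lk y (w \<circ> s t) + (q - 1) * lk y w"
  have "{w. ?f w \<noteq> 0} \<subseteq> Poly_Mapping.keys y \<union> (\<lambda>u. u \<circ> s t) ` Poly_Mapping.keys y"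
  proof
    fix w assume "w \<in> {w. ?f w \<noteq> 0}"
    then have "lk y (w \<circ> s t) \<noteq> 0 \<or> lk y w \<noteq> 0" by (auto split: if_splits)
    moreover have "w \<in> (\<lambda>u. u \<circ> s t) ` Poly_Mapping.keys y" if "lk y (w \<circ> s t) \<noteq> 0"
      using that by (intro image_eqI[of _ _ "w \<circ> s t"]) (auto simp: in_keys_iff)
    ultimately show "w \<in> Poly_Mapping.keys y \<union> (\<lambda>u. u \<circ> s t) ` Poly_Mapping.keys y"
      by (auto simp: in_keys_iff)
  qed
  then have "finite {w. ?f w \<noteq> 0}" by (rule finite_subset) simp
  then show ?thesis by (simp add: Rop_def)
qed

definition K :: "hecke set" where
  "K = {h. Poly_Mapping.keys h \<subseteq> G}"

lemma K_iff: "h \<in> K \<longleftrightarrow> (\<forall>w. w \<notin> G \<longrightarrow> lk h w = 0)"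
  by (simp add: K_def keys_subset_iff)

lemma K_keys: "h \<in> K \<Longrightarrow> w \<in> Poly_Mapping.keys h \<Longrightarrow> w \<in> G"
  by (auto simp: K_def)

lemma T_K: "w \<in> G \<Longrightarrow> T w \<in> K"
  by (auto simp: K_iff lk_T)

lemma K_0 [simp]: "0 \<in> K" by (simp add: K_iff)

lemma K_add: "x \<in> K \<Longrightarrow> y \<in> K \<Longrightarrow> x + y \<in> K" by (simp add: K_iff lookup_add)

lemma K_uminus: "x \<in> K \<Longrightarrow> - x \<in> K" by (simp add: K_iff)

lemma K_hscale: "x \<in> K \<Longrightarrow> hscale c x \<in> K" by (simp add: K_iff)

lemma K_sum: "(\<And>a. a \<in> A \<Longrightarrow> f a \<in> K) \<Longrightarrow> sum f A \<in> K"
  by (simp add: K_iff lookup_sum)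

lemma s_comp_G_iff: "s t \<circ> w \<in> G \<longleftrightarrow> w \<in> G"
  by (metis G_comp s_G s_comp_s(2))

lemma comp_s_G_iff: "w \<circ> s t \<in> G \<longleftrightarrow> w \<in> G"
  by (metis G_comp s_G s_comp_s(3))

lemma rho_comp_G_iff: "rho_pow m \<circ> w \<in> G \<longleftrightarrow> w \<in> G"
proof
  assume "rho_pow m \<circ> w \<in> G"
  then have "rho_pow (- m) \<circ> (rho_pow m \<circ> w) \<in> G" by (rule G_comp[OF rho_G])
  then show "w \<in> G" by simp
qed (simp add: G_comp)

lemma comp_rho_G_iff: "w \<circ> rho_pow m \<in> G \<longleftrightarrow> w \<in> G"
proof
  assume "w \<circ> rho_pow m \<in> G"
  then have "w \<circ> rho_pow m \<circ> rho_pow (- m) \<in> G" by (rule G_comp[OF _ rho_G])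
  then show "w \<in> G" by simp
qed (simp add: G_comp)

lemma K_Lop: "y \<in> K \<Longrightarrow> Lop r t y \<in> K" by (simp add: K_iff lk_Lop s_comp_G_iff)
lemma K_Rop: "y \<in> K \<Longrightarrow> Rop r t y \<in> K" by (simp add: K_iff lk_Rop comp_s_G_iff)
lemma K_Lrho: "y \<in> K \<Longrightarrow> Lrho m y \<in> K" by (simp add: K_iff lk_Lrho rho_comp_G_iff)
lemma K_Rrho: "y \<in> K \<Longrightarrow> Rrho m y \<in> K" by (simp add: K_iff lk_Rrho comp_rho_G_iff)

lemma cong_witness:
  assumes "x mod int r = t mod int r"
  obtains k where "x = t + k * int r"
proof -
  have "int r dvd x - t" using assms by (simp add: mod_eq_dvd_iff)
  then obtain k where "x - t = int r * k" by (rule dvdE)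
  then show ?thesis using that[of k] by (simp add: mult.commute)
qed

lemma s_comp_eq_comp_s:
  assumes w: "w \<in> G" and a: "w u = t + k * int r" "w (u + 1) = t + 1 + k * int r"
  shows "s t \<circ> w = w \<circ> s u"
proof (rule ext)
  fix x
  have c1: "(w x) mod int r = t mod int r \<longleftrightarrow> x mod int r = u mod int r" for x
  proof
    assume "w x mod int r = t mod int r"
    then obtain l where "w x = t + l * int r" by (rule cong_witness)
    moreover have "w (u + (l - k) * int r) = w u + (l - k) * int r" by (rule G_period[OF w])
    ultimately have "w x = w (u + (l - k) * int r)" using a by (simp add: left_diff_distrib)
    then show "x mod int r = u mod int r" using w by (simp add: G_eq_iff)
  next
    assume "x mod int r = u mod int r"
    then obtain l where "x = u + l * int r" by (rule cong_witness)
    then have "w x = t + (k + l) * int r" using w a by (simp add: G_period algebra_simps)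
    then show "w x mod int r = t mod int r" by simp
  qed
  have c2: "(w x - 1) mod int r = t mod int r \<longleftrightarrow> (x - 1) mod int r = u mod int r" for x
  proof
    assume "(w x - 1) mod int r = t mod int r"
    then obtain l where "w x - 1 = t + l * int r" by (rule cong_witness)
    moreover have "w (u + 1 + (l - k) * int r) = w (u + 1) + (l - k) * int r" by (rule G_period[OF w])
    ultimately have "w x = w (u + 1 + (l - k) * int r)" using a by (simp add: left_diff_distrib)
    then show "(x - 1) mod int r = u mod int r" using w by (simp add: G_eq_iff)
  next
    assume "(x - 1) mod int r = u mod int r"
    then obtain l where "x - 1 = u + l * int r" by (rule cong_witness)
    then have "x = u + 1 + l * int r" by simp
    moreover have "w (u + 1 + l * int r) = w (u + 1) + l * int r" by (rule G_period[OF w])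
    ultimately have "w x - 1 = t + (k + l) * int r" using a by (simp add: distrib_right)
    then show "(w x - 1) mod int r = t mod int r" by simp
  qed
  show "(s t \<circ> w) x = (w \<circ> s u) x"
  proof (cases "x mod int r = u mod int r")
    case True
    then obtain l where l: "x = u + l * int r" by (rule cong_witness)
    have "w (x + 1) = w (u + 1 + l * int r)" by (simp add: l algebra_simps)
    then show ?thesis using True c1 w a by (simp add: s_eq l G_period)
  next
    case n: False
    show ?thesis
    proof (cases "(x - 1) mod int r = u mod int r")
      case True
      then obtain l where "x - 1 = u + l * int r" by (rule cong_witness)
      then have l: "x = u + 1 + l * int r" by simp
      have "w (x - 1) = w (u + l * int r)" by (simp add: l algebra_simps)
      moreover have "w x = t + 1 + k * int r + l * int r" unfolding l using w a by (simp add: G_period)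
      moreover have "w (u + l * int r) = w u + l * int r" by (rule G_period[OF w])
      ultimately have "w (x - 1) = w x - 1" using a by linarith
      moreover have "s t (w x) = w x - 1" using True n unfolding s_eq c1 c2 by simp
      moreover have "s u x = x - 1" using True n unfolding s_eq by simp
      ultimately show ?thesis by simp
    next
      case False
      then show ?thesis using n c1 c2 by (simp add: s_eq)
    qed
  qed
qed

text \<open>Composing with \<open>s t\<close> reverses the order of two values only if they are adjacent and are exchanged by
  \<open>s t\<close>. If they sit at the positions \<open>u\<close> and \<open>u + 1\<close>, exchanging them is the same as exchanging the
  positions.\<close>

lemma exchange_right:
  assumes w: "w \<in> G" and ch: "(s t (w u) < s t (w (u + 1))) \<noteq> (w u < w (u + 1))"
  shows "s t \<circ> w = w \<circ> s u" and "(ginv w t < ginv w (t + 1)) = (w u < w (u + 1))"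
proof -
  have "w u \<noteq> w (u + 1)" using w by (simp add: G_eq_iff)
  then consider "w (u + 1) = w u + 1 \<and> w u mod int r = t mod int r"
    | "w u = w (u + 1) + 1 \<and> w (u + 1) mod int r = t mod int r"
    using s_less_iff[of "w (u + 1)" "w u" t] ch by fastforce
  then have "s t \<circ> w = w \<circ> s u \<and> (ginv w t < ginv w (t + 1)) = (w u < w (u + 1))"
  proof cases
    case 1
    then obtain k where k: "w u = t + k * int r" using cong_witness by blast
    have "ginv w t = ginv w (w (u + (- k) * int r))" "ginv w (t + 1) = ginv w (w (u + 1 + (- k) * int r))"
      using w k 1 by (simp_all only: G_period) simp_all
    then have "ginv w t = u + (- k) * int r" "ginv w (t + 1) = u + 1 + (- k) * int r"
      using w by (simp_all only: G_inv_f)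
    then show ?thesis using s_comp_eq_comp_s[OF w, of u t k] k 1 by auto
  next
    case 2
    then obtain k where k: "w (u + 1) = t + k * int r" using cong_witness by blast
    have "ginv w t = ginv w (w (u + 1 + (- k) * int r))" "ginv w (t + 1) = ginv w (w (u + (- k) * int r))"
      using w k 2 by (simp_all only: G_period) simp_all
    then have e: "ginv w t = u + 1 + (- k) * int r" "ginv w (t + 1) = u + (- k) * int r"
      using w by (simp_all only: G_inv_f)
    let ?v = "s t \<circ> w"
    have v: "?v \<in> G" using w by (simp add: G_comp)
    have "s t (t + k * int r) = t + 1 + k * int r" "s t (t + 1 + k * int r) = t + k * int r"
      by (metis G_period s_G s_at(1), metis G_period s_G s_at(2))
    then have "?v u = t + k * int r" "?v (u + 1) = t + 1 + k * int r"
      using 2 k by (simp_all add: algebra_simps)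
    from s_comp_eq_comp_s[OF v this] have "w \<circ> s u = s t \<circ> w" by (metis s_comp_s(2,3))
    then show ?thesis using e 2 by auto
  qed
  then show "s t \<circ> w = w \<circ> s u" "(ginv w t < ginv w (t + 1)) = (w u < w (u + 1))" by auto
qed

lemma exchange_left:
  assumes w: "w \<in> G" and ch: "(s u (ginv w t) < s u (ginv w (t + 1))) \<noteq> (ginv w t < ginv w (t + 1))"
  shows "s t \<circ> w = w \<circ> s u"
proof -
  have "s u \<circ> ginv w = ginv w \<circ> s t"
    by (rule exchange_right(1)[OF G_inv[OF w] ch])
  then have "ginv (s u \<circ> ginv w) = ginv (ginv w \<circ> s t)" by simp
  then show ?thesis using w by (simp add: G_inv_of_comp G_inv)
qed

text \<open>If \<open>s t w\<close> and \<open>w s u\<close> differ, neither reflection affects the comparison made by the other operator,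
  and the two compositions are the same expression. If they agree, both comparisons have the same
  outcome at \<open>w\<close> and the opposite one at \<open>s t w\<close>.\<close>

lemma Lop_Rop_commute:
  assumes y: "y \<in> K"
  shows "Lop r t (Rop r u y) = Rop r u (Lop r t y)"
proof (rule poly_mapping_eqI)
  fix w
  show "lk (Lop r t (Rop r u y)) w = lk (Rop r u (Lop r t y)) w"
  proof (cases "w \<in> G")
    case False
    then show ?thesis using K_Lop[OF K_Rop[OF y]] K_Rop[OF K_Lop[OF y]] by (simp add: K_iff)
  next
    case w: True
    have g1: "ginv (w \<circ> s u) x = s u (ginv w x)" for x using w by (simp add: inv_comp_s)
    show ?thesis
    proof (cases "s t \<circ> w = w \<circ> s u")
      case False
      then have e: "(s t (w u) < s t (w (u + 1))) = (w u < w (u + 1))"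
        "(s u (ginv w t) < s u (ginv w (t + 1))) = (ginv w t < ginv w (t + 1))"
        using exchange_right(1)[OF w] exchange_left[OF w] by blast+
      show ?thesis
        by (simp add: lk_Lop lk_Rop g1 e comp_assoc) (simp add: algebra_simps)
    next
      case True
      have "w u \<noteq> w (u + 1)" using w by (simp add: G_eq_iff)
      moreover have "s t (w u) = w (u + 1)" "s t (w (u + 1)) = w u"
        using fun_cong[OF True, of u] fun_cong[OF True, of "u + 1"] by simp_all
      ultimately have "(s t (w u) < s t (w (u + 1))) \<noteq> (w u < w (u + 1))" by auto
      from exchange_right(2)[OF w this] have e: "(ginv w t < ginv w (t + 1)) = (w u < w (u + 1))" .
      have e2: "s u (ginv w t) = ginv w (t + 1)" "s u (ginv w (t + 1)) = ginv w t"
        using True w by (metis G_inv_f G_f_inv comp_apply s_at(1), metis G_inv_f G_f_inv comp_apply s_at(2))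
      have c: "s t \<circ> (w \<circ> s u) = w" by (simp add: True[symmetric])
      have "ginv w t \<noteq> ginv w (t + 1)" using w by (metis G_f_inv add_cancel_right_right zero_neq_one)
      then have f: "(ginv w (t + 1) < ginv w t) = (\<not> w u < w (u + 1))"
        "(w (u + 1) < w u) = (\<not> w u < w (u + 1))"
        using e \<open>w u \<noteq> w (u + 1)\<close> by auto
      show ?thesis
        by (simp add: lk_Lop lk_Rop g1 e e2 f True c \<open>s t (w u) = _\<close> \<open>s t (w (u + 1)) = _\<close> comp_assoc)
    qed
  qed
qed

lemma Lop_Rrho_commute:
  assumes y: "y \<in> K"
  shows "Lop r t (Rrho m y) = Rrho m (Lop r t y)"
proof (rule poly_mapping_eqI)
  fix w
  show "lk (Lop r t (Rrho m y)) w = lk (Rrho m (Lop r t y)) w"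
  proof (cases "w \<in> G")
    case False
    then show ?thesis using K_Lop[OF K_Rrho[OF y]] K_Rrho[OF K_Lop[OF y]] by (simp add: K_iff)
  next
    case w: True
    have "ginv (w \<circ> rho_pow (- m)) x = ginv w x + m" for x
      using w by (simp add: G_inv_of_comp) (simp add: rho_pow_def)
    then show ?thesis by (simp add: lk_Lop lk_Rrho comp_assoc)
  qed
qed

lemma Lrho_Rop_commute: "Lrho m (Rop r u y) = Rop r u (Lrho m y)"
proof (rule poly_mapping_eqI)
  fix w
  have "rho_pow (- m) x < rho_pow (- m) y \<longleftrightarrow> x < y" for x y by (simp add: rho_pow_def)
  then show "lk (Lrho m (Rop r u y)) w = lk (Rop r u (Lrho m y)) w"
    by (simp add: lk_Lrho lk_Rop comp_assoc)
qed

lemma Lrho_Rrho_commute: "Lrho m (Rrho m' y) = Rrho m' (Lrho m y)"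
  by (rule poly_mapping_eqI) (simp add: lk_Lrho lk_Rrho comp_assoc)

text \<open>Linearity on elements supported in the group; outside the group the functions are arbitrary.\<close>

definition klin :: "(hecke \<Rightarrow> hecke) \<Rightarrow> bool" where
  "klin f \<longleftrightarrow> (\<forall>x\<in>K. \<forall>y\<in>K. f (x + y) = f x + f y) \<and> (\<forall>c. \<forall>x\<in>K. f (hscale c x) = hscale c (f x))"

lemma klin_0: "klin f \<Longrightarrow> f 0 = 0"
  using K_0 hscale_0 unfolding klin_def by metis

lemma klin_sum:
  assumes "klin f" "\<And>a. a \<in> A \<Longrightarrow> g a \<in> K"
  shows "f (sum g A) = (\<Sum>a\<in>A. f (g a))"
  using assms(2)
proof (induction A rule: infinite_finite_induct)
  case (insert a A)
  then have "f (g a + sum g A) = f (g a) + f (sum g A)"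
    using assms(1) K_sum[of A g] by (auto simp: klin_def)
  then show ?case using insert by simp
qed (simp_all add: klin_0[OF assms(1)])

lemma klin_expand:
  assumes f: "klin f" and x: "x \<in> K"
  shows "f x = (\<Sum>w\<in>Poly_Mapping.keys x. hscale (lk x w) (f (T w)))"
proof -
  have "f x = f (\<Sum>w\<in>Poly_Mapping.keys x. hscale (lk x w) (T w))"
    using expand_T[of x] by simp
  also have "\<dots> = (\<Sum>w\<in>Poly_Mapping.keys x. f (hscale (lk x w) (T w)))"
    using K_keys[OF x] by (intro klin_sum f K_hscale T_K)
  also have "\<dots> = (\<Sum>w\<in>Poly_Mapping.keys x. hscale (lk x w) (f (T w)))"
    using f K_keys[OF x] by (intro sum.cong) (auto simp: klin_def T_K)
  finally show ?thesis .
qed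

lemma klin_eq:
  assumes "klin f" "klin g" "\<And>w. w \<in> G \<Longrightarrow> f (T w) = g (T w)" "x \<in> K"
  shows "f x = g x"
  unfolding klin_expand[OF assms(1,4)] klin_expand[OF assms(2,4)]
  using assms(3) K_keys[OF assms(4)] by (intro sum.cong) auto

lemma klin_Lop: "klin (Lop r t)"
  unfolding klin_def
  by (intro conjI ballI allI; rule poly_mapping_eqI; simp add: lk_Lop lookup_add algebra_simps)

lemma klin_Rop: "klin (Rop r t)"
  unfolding klin_def
  by (intro conjI ballI allI; rule poly_mapping_eqI; simp add: lk_Rop lookup_add algebra_simps)

lemma klin_Lrho: "klin (Lrho m)"
  unfolding klin_def
  by (intro conjI ballI allI; rule poly_mapping_eqI; simp add: lk_Lrho lookup_add algebra_simps)

lemma klin_Rrho: "klin (Rrho m)"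
  unfolding klin_def
  by (intro conjI ballI allI; rule poly_mapping_eqI; simp add: lk_Rrho lookup_add algebra_simps)

lemma Lop_T_up:
  assumes w: "w \<in> G" and up: "ginv w t < ginv w (t + 1)"
  shows "Lop r t (T w) = T (s t \<circ> w)"
proof (rule poly_mapping_eqI)
  fix u
  have "\<not> ginv u t < ginv u (t + 1)" if "u = s t \<circ> w"
    using up w by (simp add: that inv_s_comp)
  moreover have "s t \<circ> u = w \<longleftrightarrow> u = s t \<circ> w" by auto
  ultimately show "lk (Lop r t (T w)) u = lk (T (s t \<circ> w)) u"
    using up by (auto simp: lk_Lop lk_T)
qed

lemma Rop_T_up:
  assumes w: "w \<in> G" and up: "w t < w (t + 1)"
  shows "Rop r t (T w) = T (w \<circ> s t)"
proof (rule poly_mapping_eqI)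
  fix u
  have "\<not> u t < u (t + 1)" if "u = w \<circ> s t"
    using up by (simp add: that)
  moreover have "w \<circ> s t \<noteq> w" using up by (metis comp_apply order_less_irrefl s_at(1))
  moreover have "u \<circ> s t = w \<longleftrightarrow> u = w \<circ> s t" by auto
  ultimately show "lk (Rop r t (T w)) u = lk (T (w \<circ> s t)) u"
    using up by (auto simp: lk_Rop lk_T)
qed

lemma Lop_T_down:
  assumes w: "w \<in> G" and down: "\<not> ginv w t < ginv w (t + 1)"
  shows "Lop r t (T w) = hscale (q - 1) (T w) + hscale q (T (s t \<circ> w))"
proof (rule poly_mapping_eqI)
  fix u
  have "ginv w t \<noteq> ginv w (t + 1)" using w by (metis G_f_inv add_cancel_right_right zero_neq_one)
  then have "ginv u t < ginv u (t + 1)" if "u = s t \<circ> w"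
    using down w by (simp add: that inv_s_comp)
  moreover have "s t \<circ> u = w \<longleftrightarrow> u = s t \<circ> w" by auto
  ultimately show "lk (Lop r t (T w)) u = lk (hscale (q - 1) (T w) + hscale q (T (s t \<circ> w))) u"
    using down by (auto simp: lk_Lop lk_T lookup_add)
qed

lemma Lrho_T: "Lrho m (T w) = T (rho_pow m \<circ> w)"
proof (rule poly_mapping_eqI)
  fix u
  have "rho_pow (- m) \<circ> u = w \<longleftrightarrow> u = rho_pow m \<circ> w" by auto
  then show "lk (Lrho m (T w)) u = lk (T (rho_pow m \<circ> w)) u" by (simp add: lk_Lrho lk_T)
qed

lemma Rrho_T: "Rrho m (T w) = T (w \<circ> rho_pow m)"
proof (rule poly_mapping_eqI)
  fix u
  have "u \<circ> rho_pow (- m) = w \<longleftrightarrow> u = w \<circ> rho_pow m" by auto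
  then show "lk (Rrho m (T w)) u = lk (T (w \<circ> rho_pow m)) u" by (simp add: lk_Rrho lk_T)
qed

text \<open>The operators that commute with all right multiplications. Such an operator is determined by its
  value at \<open>T id\<close>, since right multiplications generate every \<open>T w\<close> from it, and every value occurs. So
  the commutant is a copy of the Hecke algebra in which associativity is that of composition.\<close>

definition commutant :: "(hecke \<Rightarrow> hecke) set" where
  "commutant = {F. klin F \<and> (\<forall>y\<in>K. F y \<in> K) \<and> (\<forall>t. \<forall>y\<in>K. F (Rop r t y) = Rop r t (F y)) \<and>
     (\<forall>m. \<forall>y\<in>K. F (Rrho m y) = Rrho m (F y))}"

lemma commutantD:
  assumes "F \<in> commutant"
  shows "klin F" "y \<in> K \<Longrightarrow> F y \<in> K" "y \<in> K \<Longrightarrow> F (Rop r t y) = Rop r t (F y)"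
    "y \<in> K \<Longrightarrow> F (Rrho m y) = Rrho m (F y)"
  using assms by (auto simp: commutant_def)

lemma commutant_unique:
  assumes F: "F \<in> commutant" and F': "F' \<in> commutant" and e: "F (T id) = F' (T id)" and y: "y \<in> K"
  shows "F y = F' y"
proof (rule klin_eq[OF _ _ _ y])
  fix w assume w: "w \<in> G"
  have "F (T (ginv v)) = F' (T (ginv v))" if "v \<in> G" for v
    using that
  proof (induction rule: G_induct)
    case (rho m)
    have "T (rho_pow (- m)) = Rrho (- m) (T id)" by (simp add: Rrho_T)
    then show ?case using F F' e by (simp add: commutantD(4) T_K)
  next
    case (step t v)
    have "T (ginv (s t \<circ> v)) = Rop r t (T (ginv v))"
      using step by (simp add: Rop_T_up G_inv inv_s_comp)
    then show "F (T (ginv (s t \<circ> v))) = F' (T (ginv (s t \<circ> v)))"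
      using step F F' by (simp add: commutantD(3) T_K G_inv)
  qed
  from this[OF G_inv[OF w]] show "F (T w) = F' (T w)" using w by simp
qed (use F F' in \<open>auto dest: commutantD\<close>)

lemma commutant_Lop: "Lop r t \<in> commutant"
  by (simp add: commutant_def klin_Lop K_Lop Lop_Rop_commute Lop_Rrho_commute)

lemma commutant_Lrho: "Lrho m \<in> commutant"
  by (simp add: commutant_def klin_Lrho K_Lrho Lrho_Rop_commute Lrho_Rrho_commute)

lemma commutant_comp: "F \<in> commutant \<Longrightarrow> F' \<in> commutant \<Longrightarrow> (\<lambda>y. F (F' y)) \<in> commutant"
  by (auto simp: commutant_def klin_def)

lemma commutant_id: "(\<lambda>y. y) \<in> commutant"
  by (auto simp: commutant_def klin_def)

lemma commutant_add:
  assumes "F \<in> commutant" "F' \<in> commutant"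
  shows "(\<lambda>y. F y + F' y) \<in> commutant"
  using assms klin_Rop klin_Rrho
  by (auto simp: commutant_def klin_def hscale_add K_add algebra_simps)

lemma commutant_hscale:
  assumes "F \<in> commutant"
  shows "(\<lambda>y. hscale c (F y)) \<in> commutant"
  using assms klin_Rop klin_Rrho
  by (auto simp: commutant_def klin_def hscale_add hscale_hscale K_hscale mult.commute)

lemma commutant_sum:
  assumes "\<And>a. a \<in> A \<Longrightarrow> F a \<in> commutant"
  shows "(\<lambda>y. \<Sum>a\<in>A. F a y) \<in> commutant"
  using assms
proof (induction A rule: infinite_finite_induct)
  case (insert a A)
  then have "(\<lambda>y. F a y + (\<Sum>a\<in>A. F a y)) \<in> commutant" by (intro commutant_add) auto
  then show ?case using insert by simp
qed (simp_all add: commutant_def klin_def klin_0[OF klin_Rop] klin_0[OF klin_Rrho])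

lemma commutant_T: assumes "w \<in> G" shows "\<exists>F\<in>commutant. F (T id) = T w"
  using assms
proof (induction rule: G_induct)
  case (rho m)
  have "Lrho m (T id) = T (rho_pow m)" by (simp add: Lrho_T)
  then show ?case using commutant_Lrho by blast
next
  case (step t w)
  then obtain F where F: "F \<in> commutant" "F (T id) = T w" by blast
  then have "Lop r t (F (T id)) = T (s t \<circ> w)" using step by (simp add: Lop_T_up)
  then show ?case using commutant_comp[OF commutant_Lop F(1), of t] by (intro bexI)
qed

text \<open>The operator in the commutant with value \<open>x\<close> at \<open>T id\<close>. The choice of operators for the single \<open>T w\<close>
  does not matter on the Hecke algebra by uniqueness.\<close>

definition left_mult :: "hecke \<Rightarrow> hecke \<Rightarrow> hecke" where
  "left_mult x = (\<lambda>y. \<Sum>w\<in>Poly_Mapping.keys x.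
     hscale (lk x w) ((SOME F. F \<in> commutant \<and> F (T id) = T w) y))"

lemma left_mult_commutant:
  assumes x: "x \<in> K"
  shows "left_mult x \<in> commutant" "left_mult x (T id) = x"
proof -
  let ?F = "\<lambda>w. SOME F. F \<in> commutant \<and> F (T id) = T w"
  have F: "?F w \<in> commutant \<and> ?F w (T id) = T w" if "w \<in> Poly_Mapping.keys x" for w
    using commutant_T[OF K_keys[OF x that]] by (intro someI_ex[of "\<lambda>F. F \<in> commutant \<and> F (T id) = T w"]) blast
  then show "left_mult x \<in> commutant"
    unfolding left_mult_def by (intro commutant_sum commutant_hscale) blast
  have "left_mult x (T id) = (\<Sum>w\<in>Poly_Mapping.keys x. hscale (lk x w) (T w))"
    unfolding left_mult_def using F by (intro sum.cong) auto
  then show "left_mult x (T id) = x" using expand_T[of x] by simp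
qed

lemma left_mult_eqI:
  assumes "x \<in> K" "F \<in> commutant" "F (T id) = x" "y \<in> K"
  shows "left_mult x y = F y"
  by (rule commutant_unique[OF left_mult_commutant(1)[OF assms(1)] assms(2) _ assms(4)])
    (simp add: left_mult_commutant(2)[OF assms(1)] assms(3))

text \<open>If the lengths add up, then each letter of a reduced word of \<open>w\<close> increases the length of what it is
  applied to, and there the operators are mere translations. The bound on the length drives the
  induction.\<close>

lemma left_mult_T_T:
  assumes w: "w \<in> G" and u: "u \<in> G"
  shows "inum r (w \<circ> u) \<le> inum r w + inum r u \<and>
    (inum r (w \<circ> u) = inum r w + inum r u \<longrightarrow> left_mult (T w) (T u) = T (w \<circ> u))"
  using w
proof (induction rule: G_induct)
  case (rho m)
  have "left_mult (T (rho_pow m)) (T u) = Lrho m (T u)"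
    by (rule left_mult_eqI[OF T_K[OF rho_G] commutant_Lrho _ T_K[OF u]]) (simp add: Lrho_T)
  then show "inum r (rho_pow m \<circ> u) \<le> inum r (rho_pow m) + inum r u \<and>
    (inum r (rho_pow m \<circ> u) = inum r (rho_pow m) + inum r u \<longrightarrow>
     left_mult (T (rho_pow m)) (T u) = T (rho_pow m \<circ> u))" using u by (simp add: inum_rho_comp Lrho_T)
next
  case (step t w)
  have IH: "inum r (w \<circ> u) \<le> inum r w + inum r u \<and>
    (inum r (w \<circ> u) = inum r w + inum r u \<longrightarrow> left_mult (T w) (T u) = T (w \<circ> u))"
    by (rule step(3))
  have lw: "inum r (s t \<circ> w) = Suc (inum r w)" using step by (simp add: inum_step_up)
  have wu: "w \<circ> u \<in> G" using step u by (simp add: G_comp)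
  have c: "s t \<circ> w \<circ> u = s t \<circ> (w \<circ> u)" by (simp add: comp_assoc)
  have le: "inum r (s t \<circ> (w \<circ> u)) \<le> Suc (inum r (w \<circ> u))"
    using inum_step_up[OF wu, of t] inum_step_down[OF wu, of t] by linarith
  have "left_mult (T (s t \<circ> w)) (T u) = T (s t \<circ> (w \<circ> u))"
    if eq: "inum r (s t \<circ> (w \<circ> u)) = inum r (s t \<circ> w) + inum r u"
  proof -
    have e: "inum r (w \<circ> u) = inum r w + inum r u" using eq lw le IH by linarith
    have up: "ginv (w \<circ> u) t < ginv (w \<circ> u) (t + 1)"
      using eq e lw inum_step_down[OF wu, of t] by linarith
    have "left_mult (T (s t \<circ> w)) (T u) = Lop r t (left_mult (T w) (T u))"
    proof (rule left_mult_eqI)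
      show "(\<lambda>y. Lop r t (left_mult (T w) y)) \<in> commutant"
        by (rule commutant_comp[OF commutant_Lop left_mult_commutant(1)[OF T_K[OF step(1)]]])
      show "Lop r t (left_mult (T w) (T id)) = T (s t \<circ> w)"
        using step by (simp add: left_mult_commutant T_K Lop_T_up)
    qed (use step u in \<open>simp_all add: T_K G_comp\<close>)
    then show ?thesis using IH e Lop_T_up[OF wu up] by simp
  qed
  then show "inum r (s t \<circ> w \<circ> u) \<le> inum r (s t \<circ> w) + inum r u \<and>
    (inum r (s t \<circ> w \<circ> u) = inum r (s t \<circ> w) + inum r u \<longrightarrow>
     left_mult (T (s t \<circ> w)) (T u) = T (s t \<circ> w \<circ> u))" using IH le lw unfolding c by auto
qed

lemma hecke_ring_left_mult: "ring (hecke_ring_of r left_mult)"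
proof -
  let ?R = "hecke_ring_of r left_mult"
  have car: "carrier ?R = K" by (simp add: hecke_ring_of_def K_def)
  have ops: "mult ?R = left_mult" "one ?R = T id" "zero ?R = 0" "add ?R = (+)"
    by (simp_all add: hecke_ring_of_def)
  have cl: "left_mult x y \<in> K" if "x \<in> K" "y \<in> K" for x y
    using left_mult_commutant[OF that(1)] that commutantD by blast
  have assoc: "left_mult (left_mult x y) z = left_mult x (left_mult y z)"
    if "x \<in> K" "y \<in> K" "z \<in> K" for x y z
    by (rule left_mult_eqI[OF cl[OF that(1,2)]
          commutant_comp[OF left_mult_commutant(1)[OF that(1)] left_mult_commutant(1)[OF that(2)]] _ that(3)])
      (simp add: left_mult_commutant(2)[OF that(2)])
  have "abelian_group ?R"
  proof (rule abelian_groupI, unfold car ops)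
    fix x assume "x \<in> K"
    then show "\<exists>y\<in>K. y + x = 0" by (intro bexI[of _ "- x"]) (simp_all add: K_uminus)
  qed (simp_all add: K_add algebra_simps)
  moreover have "monoid ?R"
  proof (rule monoidI, unfold car ops)
    fix x assume "x \<in> K"
    then show "left_mult (T id) x = x"
      by (intro left_mult_eqI[OF T_K[OF G_id] commutant_id refl])
  qed (simp_all add: cl assoc T_K left_mult_commutant)
  ultimately show ?thesis
  proof (rule ringI, unfold car ops)
    fix x y z assume x: "x \<in> K" and y: "y \<in> K" and z: "z \<in> K"
    show "left_mult (x + y) z = left_mult x z + left_mult y z"
      by (rule left_mult_eqI[OF K_add[OF x y]
            commutant_add[OF left_mult_commutant(1)[OF x] left_mult_commutant(1)[OF y]] _ z])
        (simp add: left_mult_commutant(2) x y)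
    show "left_mult z (x + y) = left_mult z x + left_mult z y"
      using commutantD(1)[OF left_mult_commutant(1)[OF z]] x y by (simp add: klin_def)
  qed
qed

lemma is_hecke_mult_left_mult: "is_hecke_mult r left_mult"
proof -
  have car: "carrier (hecke_ring_of r left_mult) = K" by (simp add: hecke_ring_of_def K_def)
  have scale: "left_mult (hscale c x) y = hscale c (left_mult x y) \<and>
      left_mult x (hscale c y) = hscale c (left_mult x y)" if "x \<in> K" "y \<in> K" for c x y
  proof
    show "left_mult (hscale c x) y = hscale c (left_mult x y)"
      by (rule left_mult_eqI[OF K_hscale[OF that(1)]
            commutant_hscale[OF left_mult_commutant(1)[OF that(1)]] _ that(2)])
        (simp add: left_mult_commutant(2)[OF that(1)])
    show "left_mult x (hscale c y) = hscale c (left_mult x y)"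
      using commutantD(1)[OF left_mult_commutant(1)[OF that(1)]] that by (simp add: klin_def)
  qed
  have quad: "left_mult (T (s t)) (T (s t)) = hscale (q - 1) (T (s t)) + hscale q (T id)" for t
  proof -
    have "left_mult (T (s t)) (T (s t)) = Lop r t (T (s t))"
      by (rule left_mult_eqI[OF T_K[OF s_G] commutant_Lop _ T_K[OF s_G]]) (simp add: Lop_T_up)
    then show ?thesis by (simp add: Lop_T_down)
  qed
  show ?thesis
    unfolding is_hecke_mult_def car
    using hecke_ring_left_mult scale quad left_mult_T_T
    by (auto simp: simple_refls_eq ell_eq_inum G_comp)
qed

end

section \<open>Specializing Laurent polynomials at one\<close>

text \<open>The specialization \<open>v = 1\<close>.\<close>

definition eps :: "laurent \<Rightarrow> int" where
  "eps p = (\<Sum>k\<in>Poly_Mapping.keys p. lk p k)"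

lemma eps_superset:
  assumes "finite S" "Poly_Mapping.keys p \<subseteq> S"
  shows "eps p = (\<Sum>k\<in>S. lk p k)"
  unfolding eps_def using assms by (intro sum.mono_neutral_left) (auto simp: in_keys_iff)

lemma eps_add: "eps (p + p') = eps p + eps p'"
proof -
  let ?S = "Poly_Mapping.keys p \<union> Poly_Mapping.keys p'"
  have "Poly_Mapping.keys (p + p') \<subseteq> ?S" by (rule Poly_Mapping.keys_add)
  then show ?thesis
    by (simp add: eps_superset[of ?S] lookup_add sum.distrib)
qed

lemma eps_0 [simp]: "eps 0 = 0" by (simp add: eps_def)

lemma eps_uminus: "eps (- p) = - eps p"
  using eps_add[of p "- p"] by simp

lemma eps_diff: "eps (p - p') = eps p - eps p'"
  using eps_add[of p "- p'"] by (simp add: eps_uminus)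

lemma eps_sum: "eps (sum f A) = (\<Sum>a\<in>A. eps (f a))"
  by (induction A rule: infinite_finite_induct) (simp_all add: eps_add)

lemma eps_single: "eps (Poly_Mapping.single k c) = c"
  by (simp add: eps_def)

lemma eps_v_pow [simp]: "eps (v_pow k) = 1"
  by (simp add: v_pow_def eps_single)

lemma eps_1 [simp]: "eps 1 = 1"
  using eps_v_pow[of 0] by (simp add: v_pow_def)

lemma laurent_expand: "p = (\<Sum>k\<in>Poly_Mapping.keys p. Poly_Mapping.single k (lk p k))"
proof (rule poly_mapping_eqI)
  fix j
  have "(\<Sum>k\<in>Poly_Mapping.keys p. lk (Poly_Mapping.single k (lk p k)) j) =
      (\<Sum>k\<in>Poly_Mapping.keys p. if k = j then lk p k else 0)"
    by (intro sum.cong) (auto simp: lookup_single when_def)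
  also have "\<dots> = lk p j" by (simp add: sum.delta in_keys_iff)
  finally show "lk p j = lk (\<Sum>k\<in>Poly_Mapping.keys p. Poly_Mapping.single k (lk p k)) j"
    by (simp add: lookup_sum)
qed

lemma eps_mult: "eps (p * p') = eps p * eps p'"
proof -
  have "p * p' = (\<Sum>k\<in>Poly_Mapping.keys p. \<Sum>j\<in>Poly_Mapping.keys p'.
      Poly_Mapping.single (k + j) (lk p k * lk p' j))"
    by (subst laurent_expand[of p], subst laurent_expand[of p']) (simp add: sum_product mult_single)
  then have "eps (p * p') = (\<Sum>k\<in>Poly_Mapping.keys p. \<Sum>j\<in>Poly_Mapping.keys p'. lk p k * lk p' j)"
    by (simp add: eps_sum eps_single)
  then show ?thesis by (simp add: eps_def sum_product)
qed

lemma v_minus_1_dvd_v_pow: "v_pow 1 - 1 dvd v_pow k - 1"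
proof (induction k rule: int_induct[where k = 0])
  case base
  show ?case by (simp add: v_pow_def)
next
  case (step1 k)
  have e: "v_pow (k + 1) - 1 = v_pow 1 * (v_pow k - 1) + (v_pow 1 - 1)"
    by (simp add: v_pow_def mult_single right_diff_distrib add.commute)
  show ?case unfolding e by (intro dvd_add dvd_mult dvd_refl step1(2))
next
  case (step2 k)
  have "v_pow (k - 1) - 1 = v_pow (-1) * (v_pow k - 1) - v_pow (-1) * (v_pow 1 - 1)"
    by (simp add: v_pow_def mult_single right_diff_distrib add.commute)
  then show ?case using step2 by (simp add: dvd_diff)
qed

text \<open>Every power of \<open>v\<close> is congruent to \<open>1\<close> modulo \<open>v - 1\<close>.\<close>

lemma v_minus_1_dvd: "v_pow 1 - 1 dvd p - of_int (eps p)"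
proof -
  have "v_pow 1 - 1 dvd Poly_Mapping.single k c - of_int c" for k c
  proof -
    have "Poly_Mapping.single k c - of_int c = of_int c * (v_pow k - 1 :: laurent)"
      unfolding v_pow_def single_of_int[symmetric] mult_single right_diff_distrib by simp
    then show ?thesis using v_minus_1_dvd_v_pow[of k] by simp
  qed
  then have "v_pow 1 - 1 dvd (\<Sum>k\<in>Poly_Mapping.keys p. Poly_Mapping.single k (lk p k) - of_int (lk p k))"
    by (intro dvd_sum) auto
  also have "(\<Sum>k\<in>Poly_Mapping.keys p. Poly_Mapping.single k (lk p k) - of_int (lk p k)) = p - of_int (eps p)"
    using laurent_expand[of p] by (simp add: sum_subtractf eps_def of_int_sum)
  finally show ?thesis .
qed

lemma eps_eq_0_iff: "eps p = 0 \<longleftrightarrow> v_pow 1 - 1 dvd p"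
proof
  assume "eps p = 0"
  then show "v_pow 1 - 1 dvd p" using v_minus_1_dvd[of p] by simp
next
  assume "v_pow 1 - 1 dvd p"
  then show "eps p = 0" by (auto elim!: dvdE simp: eps_mult eps_diff)
qed

lemma v_minus_1_neq_0: "v_pow 1 - 1 \<noteq> (0 :: laurent)"
proof
  assume "v_pow 1 - 1 = (0 :: laurent)"
  then have "lk (v_pow 1 - 1 :: laurent) 1 = 0" by simp
  then show False by (simp add: v_pow_def lookup_minus lookup_one)
qed

section \<open>Multiplication in the affine Hecke algebra\<close>

context affine_rank
begin

abbreviation star :: "hecke \<Rightarrow> hecke \<Rightarrow> hecke" (infixl "\<star>" 70) where
  "x \<star> y \<equiv> x \<otimes>\<^bsub>hecke_alg r\<^esub> y"

lemma hecke_ops: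
  "carrier (hecke_alg r) = K" "one (hecke_alg r) = T id" "zero (hecke_alg r) = 0" "add (hecke_alg r) = (+)"
  by (simp_all add: hecke_alg_def hecke_ring_of_def K_def)

lemma hecke_mult: "is_hecke_mult r (mult (hecke_alg r))"
proof -
  have "mult (hecke_alg r) = (SOME m. is_hecke_mult r m)"
    by (simp add: hecke_alg_def hecke_ring_of_def)
  then show ?thesis using someI[of "is_hecke_mult r", OF is_hecke_mult_left_mult] by simp
qed

lemma hecke_eq: "hecke_ring_of r (mult (hecke_alg r)) = hecke_alg r"
  by (simp add: hecke_alg_def hecke_ring_of_def)

lemma hecke_ring: "ring (hecke_alg r)"
  using hecke_mult by (simp add: is_hecke_mult_def hecke_eq)

lemma star_closed: "x \<in> K \<Longrightarrow> y \<in> K \<Longrightarrow> x \<star> y \<in> K"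
  using ring.ring_simprules(5)[OF hecke_ring] by (simp add: hecke_ops)

lemma star_assoc: "x \<in> K \<Longrightarrow> y \<in> K \<Longrightarrow> z \<in> K \<Longrightarrow> x \<star> y \<star> z = x \<star> (y \<star> z)"
  using monoid.m_assoc[OF ring.is_monoid[OF hecke_ring]] by (simp add: hecke_ops)

lemma star_id [simp]: "x \<in> K \<Longrightarrow> T id \<star> x = x" "x \<in> K \<Longrightarrow> x \<star> T id = x"
  using monoid.l_one[OF ring.is_monoid[OF hecke_ring]] monoid.r_one[OF ring.is_monoid[OF hecke_ring]]
  by (simp_all add: hecke_ops)

lemma star_add_left: "x \<in> K \<Longrightarrow> y \<in> K \<Longrightarrow> z \<in> K \<Longrightarrow> (x + y) \<star> z = x \<star> z + y \<star> z"
  using ring.ring_simprules(13)[OF hecke_ring] by (simp add: hecke_ops)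

lemma star_add_right: "x \<in> K \<Longrightarrow> y \<in> K \<Longrightarrow> z \<in> K \<Longrightarrow> z \<star> (x + y) = z \<star> x + z \<star> y"
  using ring.ring_simprules(23)[OF hecke_ring] by (simp add: hecke_ops)

lemma star_hscale:
  "x \<in> K \<Longrightarrow> y \<in> K \<Longrightarrow> hscale c x \<star> y = hscale c (x \<star> y)"
  "x \<in> K \<Longrightarrow> y \<in> K \<Longrightarrow> x \<star> hscale c y = hscale c (x \<star> y)"
  using hecke_mult by (simp_all add: is_hecke_mult_def hecke_eq hecke_ops)

lemma star_quadratic: "T (s t) \<star> T (s t) = hscale (q - 1) (T (s t)) + hscale q (T id)"
  using hecke_mult s_simple by (simp add: is_hecke_mult_def)

lemma star_T_T:
  "w \<in> G \<Longrightarrow> u \<in> G \<Longrightarrow> inum r (w \<circ> u) = inum r w + inum r u \<Longrightarrow> T w \<star> T u = T (w \<circ> u)"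
  using hecke_mult by (simp add: is_hecke_mult_def ell_eq_inum G_comp)

lemma klin_star_right: "x \<in> K \<Longrightarrow> klin (\<lambda>y. x \<star> y)"
  by (simp add: klin_def star_add_right star_hscale)

lemma klin_star_left: "y \<in> K \<Longrightarrow> klin (\<lambda>x. x \<star> y)"
  by (simp add: klin_def star_add_left star_hscale)

lemma inum_s: "inum r (s t) = 1"
  using inum_step_up[of id t] inum_rho[of 0] by simp

lemma star_T_s: assumes y: "y \<in> K" shows "T (s t) \<star> y = Lop r t y"
proof (rule klin_eq[OF klin_star_right[OF T_K[OF s_G]] klin_Lop _ y])
  fix w assume w: "w \<in> G"
  show "T (s t) \<star> T w = Lop r t (T w)"
  proof (cases "ginv w t < ginv w (t + 1)")
    case True
    then show ?thesis using w by (simp add: Lop_T_up star_T_T inum_s inum_step_up)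
  next
    case False
    let ?v = "s t \<circ> w"
    have v: "?v \<in> G" using w by (simp add: G_comp)
    have l: "inum r w = Suc (inum r ?v)" by (rule inum_step_down[OF w False])
    have "T (s t) \<star> T ?v = T w" using v l by (simp add: star_T_T inum_s)
    then have "T (s t) \<star> T w = T (s t) \<star> T (s t) \<star> T ?v"
      using v by (simp add: star_assoc T_K)
    also have "\<dots> = hscale (q - 1) (T (s t) \<star> T ?v) + hscale q (T ?v)"
      using v by (simp add: star_quadratic star_add_left star_hscale K_hscale T_K)
    finally show ?thesis using w False \<open>T (s t) \<star> T ?v = T w\<close> by (simp add: Lop_T_down)
  qed
qed

lemma star_T_rho: assumes y: "y \<in> K" shows "T (rho_pow m) \<star> y = Lrho m y"
  by (rule klin_eq[OF klin_star_right[OF T_K[OF rho_G]] klin_Lrho _ y])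
    (simp add: star_T_T inum_rho_comp Lrho_T)

text \<open>At \<open>v = 1\<close> the quadratic relation says that simple reflections square to one, so the Hecke algebra
  degenerates to the group ring.\<close>

lemma eps_T_star:
  assumes w: "w \<in> G" and y: "y \<in> K"
  shows "eps (lk (T w \<star> y) g) = eps (lk y (ginv w \<circ> g))"
  using w
proof (induction arbitrary: g rule: G_induct)
  case (rho m)
  show "eps (lk (T (rho_pow m) \<star> y) g) = eps (lk y (ginv (rho_pow m) \<circ> g))"
    using y by (simp add: star_T_rho lk_Lrho)
next
  case (step t w)
  have "T (s t \<circ> w) = T (s t) \<star> T w"
    using step by (simp add: star_T_T inum_s inum_step_up)
  then have "T (s t \<circ> w) \<star> y = Lop r t (T w \<star> y)"
    using star_assoc[OF T_K[OF s_G] T_K[OF step(1)] y, of t]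
      star_T_s[OF star_closed[OF T_K[OF step(1)] y], of t] by simp
  then have "eps (lk (T (s t \<circ> w) \<star> y) g) = eps (lk (T w \<star> y) (s t \<circ> g))"
    by (simp add: lk_Lop eps_mult eps_add eps_diff)
  also have "\<dots> = eps (lk y (ginv w \<circ> (s t \<circ> g)))" by (rule step(3))
  finally show "eps (lk (T (s t \<circ> w) \<star> y) g) = eps (lk y (ginv (s t \<circ> w) \<circ> g))"
    using step by (simp add: inv_s_comp comp_assoc)
qed

lemma eps_star:
  assumes x: "x \<in> K" and y: "y \<in> K"
  shows "eps (lk (x \<star> y) g) = (\<Sum>w\<in>Poly_Mapping.keys x. eps (lk x w) * eps (lk y (ginv w \<circ> g)))"
proof -
  have "x \<star> y = (\<Sum>w\<in>Poly_Mapping.keys x. hscale (lk x w) (T w \<star> y))"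
    by (rule klin_expand[OF klin_star_left[OF y] x])
  then show ?thesis using K_keys[OF x] y
    by (simp add: lookup_sum eps_sum eps_mult eps_T_star)
qed

end

section \<open>Young subgroups, double cosets and matrices\<close>

locale affine_blocks = affine_rank +
  fixes n :: nat
  assumes n1: "1 \<le> n"
begin

abbreviation "\<Lambda> \<equiv> Lambda_aff n r"

lemma residue_range: "1 \<le> (x - 1) mod int r + 1" "(x - 1) mod int r + 1 \<le> int r"
proof -
  have "0 < int r" using r2 by simp
  from pos_mod_bound[OF this, of "x - 1"] pos_mod_sign[OF this, of "x - 1"]
  show "1 \<le> (x - 1) mod int r + 1" "(x - 1) mod int r + 1 \<le> int r" by linarith+
qed

lemma Lambda_period: "l \<in> \<Lambda> \<Longrightarrow> l (i + int n) = l i"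
  and Lambda_nonneg: "l \<in> \<Lambda> \<Longrightarrow> 0 \<le> l i"
  and Lambda_sum: "l \<in> \<Lambda> \<Longrightarrow> (\<Sum>i = 1..int n. l i) = int r"
  by (auto simp: Lambda_aff_def sigma_seq_def)

lemma Lambda_period_mult: "l \<in> \<Lambda> \<Longrightarrow> l (i + k * int n) = l i"
  using quasi_periodic[of l "int n" 0 i k] by (simp add: Lambda_period)

text \<open>The blocks with positive index at most \<open>j\<close> reach up to this number.\<close>

definition psum :: "zseq \<Rightarrow> int \<Rightarrow> int" where
  "psum l j = (j div int n) * int r + (\<Sum>t = 1..j mod int n. l t)"

lemma sum_int_Suc: "0 \<le> (m :: int) \<Longrightarrow> (\<Sum>t = 1..m + 1. f t) = (\<Sum>t = 1..m. f t) + (f (m + 1) :: int)"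
proof -
  assume "0 \<le> m"
  then have "{1..m + 1} = insert (m + 1) {1..m}" by auto
  then show ?thesis by simp
qed

lemma psum_step:
  assumes l: "l \<in> \<Lambda>"
  shows "psum l j = psum l (j - 1) + l j"
proof -
  define m where "m = (j - 1) mod int n"
  define k where "k = (j - 1) div int n"
  have m: "0 \<le> m" "m < int n" using n1 by (simp_all add: m_def)
  have j: "j = m + 1 + k * int n"
    by (simp add: m_def k_def minus_mult_div_eq_mod[symmetric] algebra_simps)
  have lj: "l j = l (m + 1)" unfolding j by (rule Lambda_period_mult[OF l])
  show ?thesis
  proof (cases "m + 1 < int n")
    case True
    then have "j div int n = k" "j mod int n = m + 1" using m by (simp_all add: j)
    then show ?thesis using m lj sum_int_Suc[of m l]
      by (simp add: psum_def m_def[symmetric] k_def[symmetric])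
  next
    case False
    then have mn: "m + 1 = int n" using m by linarith
    have "j = (k + 1) * int n" using j mn by (simp add: distrib_right)
    then have "j div int n = k + 1" "j mod int n = 0" using n1 by simp_all
    moreover have "(\<Sum>t = 1..m. l t) + l (m + 1) = int r"
      using Lambda_sum[OF l] sum_int_Suc[of m l] m mn by simp
    ultimately show ?thesis using lj
      by (simp add: psum_def m_def[symmetric] k_def[symmetric] distrib_right)
  qed
qed

lemma R_eq:
  assumes l: "l \<in> \<Lambda>"
  shows "R_set n r l j = {psum l (j - 1) + 1..psum l j}"
proof -
  have "j = (j - 1) mod int n + 1 + ((j - 1) div int n) * int n"
    by (simp add: minus_mult_div_eq_mod[symmetric] algebra_simps)
  then have "l j = l ((j - 1) mod int n + 1)" using Lambda_period_mult[OF l] by metis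
  then show ?thesis using psum_step[OF l, of j] by (simp add: R_set_def Let_def psum_def)
qed

lemma psum_shift: "psum l (j + int n) = psum l j + int r"
  using n1 by (simp add: psum_def algebra_simps)

lemma psum_mono: assumes l: "l \<in> \<Lambda>" and "i \<le> j" shows "psum l i \<le> psum l j"
  using assms(2)
proof (induction j rule: int_ge_induct)
  case (step j)
  then show ?case using psum_step[OF l, of "j + 1"] Lambda_nonneg[OF l, of "j + 1"] by simp
qed simp

lemma R_ex: assumes l: "l \<in> \<Lambda>" shows "\<exists>j. x \<in> R_set n r l j"
proof -
  define k where "k = (x - 1) div int r"
  have "k * int r < x" "x \<le> k * int r + int r"
    using minus_mult_div_eq_mod[of "x - 1" "int r"] residue_range[of x]
    unfolding k_def mult.commute[of _ "int r"] by linarith+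
  then have k: "k * int r < x" "x \<le> (k + 1) * int r" by (simp_all add: distrib_right)
  define P where "P = (\<lambda>m. x \<le> psum l (k * int n + int m))"
  have "psum l (k * int n) = k * int r" using n1 by (simp add: psum_def)
  moreover have "psum l (k * int n + int n) = (k + 1) * int r"
    using n1 psum_shift[of l "k * int n"] calculation by (simp add: algebra_simps)
  ultimately have P: "\<not> P 0" "P n" using k by (simp_all add: P_def)
  define m where "m = (LEAST m. P m)"
  have "P m" unfolding m_def using P(2) by (rule LeastI)
  moreover from this have "m \<noteq> 0" using P(1) by metis
  moreover have "\<not> P (m - 1)" using \<open>m \<noteq> 0\<close> unfolding m_def by (metis diff_less less_one not_gr_zero not_less_Least)
  ultimately have "x \<in> R_set n r l (k * int n + int m)"
    by (simp add: R_eq[OF l] P_def of_nat_diff algebra_simps)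
  then show ?thesis by blast
qed

lemma R_less:
  assumes l: "l \<in> \<Lambda>" and "i < j" "x \<in> R_set n r l i" "y \<in> R_set n r l j"
  shows "x < y"
  using assms psum_mono[OF l, of i "j - 1"] by (simp add: R_eq)

text \<open>The index of the block that contains a given integer; a Young subgroup is the stabilizer of
  this colouring of the integers.\<close>

definition blk :: "zseq \<Rightarrow> int \<Rightarrow> int" where
  "blk l x = (THE j. x \<in> R_set n r l j)"

lemma R_iff: assumes l: "l \<in> \<Lambda>" shows "x \<in> R_set n r l j \<longleftrightarrow> blk l x = j"
proof -
  obtain i where i: "x \<in> R_set n r l i" using R_ex[OF l] by blast
  have u: "j = i" if "x \<in> R_set n r l j" for j
    using R_less[OF l _ that i] R_less[OF l _ i that] by (metis less_irrefl linorder_neqE_linordered_idom)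
  have "blk l x = i" unfolding blk_def using i u by (rule the_equality)
  then show ?thesis using i u by blast
qed

lemma blk_shift: assumes l: "l \<in> \<Lambda>" shows "blk l (x + int r) = blk l x + int n"
proof -
  have "x \<in> R_set n r l (blk l x)" using R_iff[OF l] by simp
  then have "x + int r \<in> R_set n r l (blk l x + int n)"
    using psum_shift[of l "blk l x"] psum_shift[of l "blk l x - 1"] by (simp add: R_eq[OF l] algebra_simps)
  then show ?thesis using R_iff[OF l] by simp
qed

lemma blk_shift_mult: "l \<in> \<Lambda> \<Longrightarrow> blk l (x + k * int r) = blk l x + k * int n"
  by (rule quasi_periodic) (rule blk_shift)

lemma blk_mono: assumes l: "l \<in> \<Lambda>" and "x \<le> y" shows "blk l x \<le> blk l y"
proof (rule ccontr)
  assume "\<not> blk l x \<le> blk l y"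
  then have "y < x" using R_less[OF l, of "blk l y" "blk l x" y x] R_iff[OF l] by auto
  then show False using assms by simp
qed

lemma blk_set: "l \<in> \<Lambda> \<Longrightarrow> {x. blk l x = j} = R_set n r l j"
  using R_iff by auto

lemma finite_blk: "l \<in> \<Lambda> \<Longrightarrow> finite {x. blk l x = j}"
  by (simp add: blk_set R_eq)

lemma card_blk: "l \<in> \<Lambda> \<Longrightarrow> int (card {x. blk l x = j}) = l j"
  using psum_step[of l j] Lambda_nonneg[of l j] by (simp add: blk_set R_eq)

lemma blk_range: assumes l: "l \<in> \<Lambda>" shows "blk l x \<in> {1..int n} \<longleftrightarrow> x \<in> {1..int r}"
proof -
  have x: "x \<in> R_set n r l (blk l x)" using R_iff[OF l] by simp
  then have b: "psum l (blk l x - 1) < x" "x \<le> psum l (blk l x)" by (simp_all add: R_eq[OF l])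
  have p: "psum l 0 = 0" "psum l (int n) = int r" using n1 by (simp_all add: psum_def)
  show ?thesis
  proof
    assume "blk l x \<in> {1..int n}"
    then show "x \<in> {1..int r}"
      using b p psum_mono[OF l, of 0 "blk l x - 1"] psum_mono[OF l, of "blk l x" "int n"] by auto
  next
    assume a: "x \<in> {1..int r}"
    have "\<not> blk l x \<le> 0" using psum_mono[OF l, of "blk l x" 0] b p a by auto
    moreover have "\<not> int n \<le> blk l x - 1" using psum_mono[OF l, of "int n" "blk l x - 1"] b p a by auto
    ultimately show "blk l x \<in> {1..int n}" by auto
  qed
qed

lemma young_iff:
  assumes l: "l \<in> \<Lambda>"
  shows "w \<in> young n r l \<longleftrightarrow> w \<in> G \<and> (\<forall>x. blk l (w x) = blk l x)"
proof
  assume "w \<in> young n r l"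
  then have w: "w \<in> G" and im: "\<And>i. i \<in> {1..int n} \<Longrightarrow> w ` R_set n r l i = R_set n r l i"
    by (auto simp: young_def)
  have "blk l (w x) = blk l x" for x
  proof -
    define k where "k = (x - 1) div int r"
    define x' where "x' = x - k * int r"
    have "x' = (x - 1) mod int r + 1"
      by (simp add: x'_def k_def minus_mult_div_eq_mod[symmetric] algebra_simps)
    then have "x' \<in> {1..int r}" using residue_range[of x] by simp
    then have "w ` R_set n r l (blk l x') = R_set n r l (blk l x')" using im blk_range[OF l] by blast
    then have "blk l (w x') = blk l x'" using R_iff[OF l] by blast
    moreover have "x = x' + k * int r" by (simp add: x'_def)
    ultimately show ?thesis using w l by (simp add: G_period blk_shift_mult)
  qed
  then show "w \<in> G \<and> (\<forall>x. blk l (w x) = blk l x)" using w by blast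
next
  assume a: "w \<in> G \<and> (\<forall>x. blk l (w x) = blk l x)"
  have "w ` {x. blk l x = i} = {x. blk l x = i}" for i
  proof (intro equalityI subsetI)
    fix y assume "y \<in> {x. blk l x = i}"
    then have "ginv w y \<in> {x. blk l x = i}" "y = w (ginv w y)" using a by (simp_all, metis G_f_inv)
    then show "y \<in> w ` {x. blk l x = i}" by blast
  qed (use a in auto)
  then show "w \<in> young n r l" using a by (simp add: young_def blk_set[OF l])
qed

lemma young_G: "w \<in> young n r l \<Longrightarrow> w \<in> G"
  by (simp add: young_def)

lemma young_blk: "l \<in> \<Lambda> \<Longrightarrow> w \<in> young n r l \<Longrightarrow> blk l (w x) = blk l x"
  by (simp add: young_iff)

lemma young_id: "l \<in> \<Lambda> \<Longrightarrow> id \<in> young n r l"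
  by (simp add: young_iff)

lemma young_comp: "l \<in> \<Lambda> \<Longrightarrow> w \<in> young n r l \<Longrightarrow> u \<in> young n r l \<Longrightarrow> w \<circ> u \<in> young n r l"
  by (simp add: young_iff G_comp)

lemma young_inv: "l \<in> \<Lambda> \<Longrightarrow> w \<in> young n r l \<Longrightarrow> ginv w \<in> young n r l"
  by (simp add: young_iff G_inv) (metis G_f_inv)

lemma finite_young: assumes l: "l \<in> \<Lambda>" shows "finite (young n r l)"
proof -
  have "inj_on (\<lambda>w. restrict w {1..int r}) (young n r l)"
  proof (rule inj_onI)
    fix w u assume w: "w \<in> young n r l" and u: "u \<in> young n r l"
      and e: "restrict w {1..int r} = restrict u {1..int r}"
    show "w = u"
    proof (rule ext)
      fix x
      obtain k where "1 \<le> x + k * int r" "x + k * int r \<le> int r" using residue_decomp by blast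
      then have "w (x + k * int r) = u (x + k * int r)" using e by (metis atLeastAtMost_iff restrict_apply')
      then show "w x = u x" using young_G[OF w] young_G[OF u] by (simp add: G_period)
    qed
  qed
  moreover have "(\<lambda>w. restrict w {1..int r}) ` young n r l \<subseteq> {1..int r} \<rightarrow>\<^sub>E {1..int r}"
    by (auto simp: PiE_iff blk_range[OF l, symmetric] young_blk[OF l] simp del: atLeastAtMost_iff)
  ultimately show ?thesis using finite_PiE[of "{1..int r}" "\<lambda>_. {1..int r}"]
    by (meson finite_atLeastAtMost_int finite_imageD finite_subset)
qed

lemma s_young: assumes l: "l \<in> \<Lambda>" and t: "blk l t = blk l (t + 1)" shows "s t \<in> young n r l"
proof -
  have "blk l (s t x) = blk l x" for x
  proof (cases "x mod int r = t mod int r")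
    case True
    then obtain k where k: "x = t + k * int r" by (rule cong_witness)
    have "blk l (t + k * int r + 1) = blk l (t + 1 + k * int r)" by (simp add: algebra_simps)
    then show ?thesis using True t by (simp add: s_eq k blk_shift_mult[OF l])
  next
    case F: False
    show ?thesis
    proof (cases "(x - 1) mod int r = t mod int r")
      case True
      then obtain k where "x - 1 = t + k * int r" by (rule cong_witness)
      then have k: "x = t + 1 + k * int r" by simp
      have "blk l (x - 1) = blk l (t + k * int r)" by (simp add: k)
      moreover have "s t x = x - 1" using True F by (simp add: s_eq)
      moreover have "blk l x = blk l (t + 1) + k * int n" unfolding k by (rule blk_shift_mult[OF l])
      ultimately show ?thesis using t by (simp add: blk_shift_mult[OF l])
    next
      case False
      then show ?thesis using F by (simp add: s_eq)
    qed
  qed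
  then show ?thesis using young_iff[OF l] by simp
qed

lemma rho_young: assumes l: "l \<in> \<Lambda>" and "rho_pow m \<in> young n r l" shows "m = 0"
proof -
  have "blk l (0 + m) = blk l 0 + 0" "\<And>x. blk l (x + m) = blk l x + 0"
    using young_blk[OF l assms(2), of 0] young_blk[OF l assms(2)] by (simp_all add: rho_pow_def)
  then have "blk l (0 + int r * m) = blk l 0 + int r * 0"
    using quasi_periodic[of "blk l" m 0 0 "int r"] by simp
  moreover have "blk l (0 + m * int r) = blk l 0 + m * int n" by (rule blk_shift_mult[OF l])
  ultimately show ?thesis using n1 by (simp add: mult.commute)
qed

text \<open>Positions in different blocks are always in the right order, because the blocks are intervals that
  the element preserves. So without a descent inside a block the element is increasing, hence a shift,
  and the only shift that preserves the blocks is trivial.\<close>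

lemma young_descent:
  assumes l: "l \<in> \<Lambda>" and w: "w \<in> young n r l" "w \<noteq> id"
  obtains t where "blk l t = blk l (t + 1)" "\<not> ginv w t < ginv w (t + 1)"
proof -
  have "\<exists>t. blk l t = blk l (t + 1) \<and> \<not> ginv w t < ginv w (t + 1)"
  proof (rule ccontr)
    assume a: "\<nexists>t. blk l t = blk l (t + 1) \<and> \<not> ginv w t < ginv w (t + 1)"
    have "ginv w t < ginv w (t + 1)" for t
    proof (cases "blk l t = blk l (t + 1)")
      case True
      then show ?thesis using a by blast
    next
      case False
      then have "blk l (ginv w t) < blk l (ginv w (t + 1))"
        using blk_mono[OF l, of t "t + 1"] young_blk[OF l young_inv[OF l w(1)]] by simp
      then show ?thesis using blk_mono[OF l] by (meson not_less)
    qed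
    then obtain m where m: "ginv w = rho_pow m"
      using strict_mono_G_imp_rho[OF G_inv[OF young_G[OF w(1)]]] by blast
    then have "m = 0" using rho_young[OF l] young_inv[OF l w(1)] by simp
    then have "ginv w = id" using m by simp
    then have "w = id" using young_G[OF w(1)] by (metis G_inv_inv rho_0 rho_inv minus_zero)
    then show False using w by simp
  qed
  then show thesis using that by blast
qed

lemma young_induct [consumes 2, case_names id step]:
  assumes l: "l \<in> \<Lambda>" and "w \<in> young n r l"
    and id: "P id"
    and step: "\<And>t w. w \<in> young n r l \<Longrightarrow> blk l t = blk l (t + 1) \<Longrightarrow>
      ginv w t < ginv w (t + 1) \<Longrightarrow> P w \<Longrightarrow> P (s t \<circ> w)"
  shows "P w"
  using assms(2)
proof (induction "inum r w" arbitrary: w rule: less_induct)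
  case less
  show ?case
  proof (cases "w = id")
    case True
    then show ?thesis using id by simp
  next
    case False
    then obtain t where t: "blk l t = blk l (t + 1)" "\<not> ginv w t < ginv w (t + 1)"
      using young_descent[OF l less.prems] by blast
    have w: "w \<in> G" using less.prems by (rule young_G)
    have u: "s t \<circ> w \<in> young n r l" using young_comp[OF l s_young[OF l t(1)] less.prems] .
    have "ginv w t \<noteq> ginv w (t + 1)" using w by (metis G_f_inv add_cancel_right_right zero_neq_one)
    then have up: "ginv (s t \<circ> w) t < ginv (s t \<circ> w) (t + 1)"
      using t w by (simp add: inv_s_comp)
    have "P (s t \<circ> w)" using less.hyps u inum_step_down[OF w t(2)] by simp
    from step[OF u t(1) up this] show ?thesis by (simp add: comp_assoc)
  qed
qed

lemma increasing_on_block: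
  assumes l: "l \<in> \<Lambda>" and inc: "\<And>t. blk l t = blk l (t + 1) \<Longrightarrow> f t < (f (t + 1) :: int)"
    and "x < y" "blk l x = blk l y"
  shows "f x < f y"
  using assms(3,4)
proof (induction y rule: int_gr_induct)
  case base
  then show ?case by (rule inc)
next
  case (step y)
  have "blk l x \<le> blk l y" "blk l y \<le> blk l (y + 1)" using step(1) by (auto intro!: blk_mono[OF l])
  then have "blk l x = blk l y" "blk l y = blk l (y + 1)" using step by auto
  then show ?case using step inc[of y] by auto
qed

text \<open>The condition on the whole Young subgroup follows from that on its simple reflections: in a reduced
  word, each letter exchanges two values whose positions are in one block, where the inverse of \<open>d\<close> is
  increasing.\<close>

lemma dist_iff:
  assumes l: "l \<in> \<Lambda>"
  shows "d \<in> dist_reps n r l \<longleftrightarrow>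
    d \<in> G \<and> (\<forall>t. blk l t = blk l (t + 1) \<longrightarrow> ginv d t < ginv d (t + 1))"
proof
  assume "d \<in> dist_reps n r l"
  then have d: "d \<in> G" and add: "\<And>w. w \<in> young n r l \<Longrightarrow> inum r (w \<circ> d) = inum r w + inum r d"
    by (auto simp: dist_reps_def ell_eq_inum G_comp young_G)
  have "ginv d t < ginv d (t + 1)" if "blk l t = blk l (t + 1)" for t
    using add[OF s_young[OF l that]] inum_step_down[OF d, of t] by (auto simp: inum_s)
  then show "d \<in> G \<and> (\<forall>t. blk l t = blk l (t + 1) \<longrightarrow> ginv d t < ginv d (t + 1))" using d by blast
next
  assume a: "d \<in> G \<and> (\<forall>t. blk l t = blk l (t + 1) \<longrightarrow> ginv d t < ginv d (t + 1))"
  then have d: "d \<in> G" and inc: "\<And>t. blk l t = blk l (t + 1) \<Longrightarrow> ginv d t < ginv d (t + 1)" by auto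
  have less: "ginv d x < ginv d y" if "x < y" "blk l x = blk l y" for x y
    by (rule increasing_on_block[OF l _ that]) (rule inc)
  have "inum r (w \<circ> d) = inum r w + inum r d" if "w \<in> young n r l" for w
    using l that
  proof (induction rule: young_induct)
    case id
    show "inum r (id \<circ> d) = inum r id + inum r d" using inum_rho[of 0] by simp
  next
    case (step t w)
    have w: "w \<in> G" using step by (simp add: young_G)
    have wd: "w \<circ> d \<in> G" using w d by (rule G_comp)
    have IH: "inum r (w \<circ> d) = inum r w + inum r d" by (rule step(4))
    have "blk l (ginv w t) = blk l (ginv w (t + 1))"
      using step young_blk[OF l young_inv[OF l step(1)]] by simp
    then have "ginv (w \<circ> d) t < ginv (w \<circ> d) (t + 1)"
      using less[OF step(3)] w d by (simp add: G_inv_of_comp)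
    then have "inum r (s t \<circ> (w \<circ> d)) = Suc (inum r (w \<circ> d))" by (rule inum_step_up[OF wd])
    then show "inum r (s t \<circ> w \<circ> d) = inum r (s t \<circ> w) + inum r d"
      using IH inum_step_up[OF w step(3)] by (simp add: comp_assoc)
  qed
  then show "d \<in> dist_reps n r l"
    using d by (simp add: dist_reps_def ell_eq_inum G_comp young_G)
qed

lemma dist_G: "d \<in> dist_reps n r l \<Longrightarrow> d \<in> G"
  by (simp add: dist_reps_def)

lemma dist_add:
  assumes d: "d \<in> dist_reps n r l" and w: "w \<in> young n r l"
  shows "inum r (w \<circ> d) = inum r w + inum r d"
proof -
  have "ell r (w \<circ> d) = ell r w + ell r d" using d w by (simp add: dist_reps_def)
  then show ?thesis using dist_G[OF d] young_G[OF w] by (simp add: ell_eq_inum G_comp)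
qed

text \<open>A descent inside a block can be removed by a simple reflection of the Young subgroup, and this
  decreases the length.\<close>

lemma dist_rep_ex:
  assumes l: "l \<in> \<Lambda>" and g: "g \<in> G"
  shows "\<exists>d\<in>dist_reps n r l. \<exists>u\<in>young n r l. g = u \<circ> d"
  using g
proof (induction "inum r g" arbitrary: g rule: less_induct)
  case less
  show ?case
  proof (cases "g \<in> dist_reps n r l")
    case True
    then show ?thesis using young_id[OF l] by (metis comp_id id_comp)
  next
    case False
    then obtain t where t: "blk l t = blk l (t + 1)" "\<not> ginv g t < ginv g (t + 1)"
      using dist_iff[OF l] less.prems by blast
    then obtain d u where du: "d \<in> dist_reps n r l" "u \<in> young n r l" "s t \<circ> g = u \<circ> d"
      using less.hyps[of "s t \<circ> g"] less.prems inum_step_down[OF less.prems t(2)] by (auto simp: G_comp)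
    have "g = s t \<circ> (s t \<circ> g)" by simp
    then have "g = (s t \<circ> u) \<circ> d" unfolding du(3) by (simp only: comp_assoc)
    then show ?thesis using du young_comp[OF l s_young[OF l t(1)] du(2)] by blast
  qed
qed

lemma young_inum_0: assumes l: "l \<in> \<Lambda>" and w: "w \<in> young n r l" "inum r w = 0" shows "w = id"
  using inum_zero[OF young_G[OF w(1)] w(2)] rho_young[OF l] w(1) by fastforce

text \<open>Each of two distinguished elements of a coset is longer than the other by the length of the factor
  between them.\<close>

lemma dist_rep_unique:
  assumes l: "l \<in> \<Lambda>" and d: "d \<in> dist_reps n r l" "w \<circ> d \<in> dist_reps n r l" and w: "w \<in> young n r l"
  shows "w = id"
proof -
  have "ginv w \<circ> (w \<circ> d) = d" using young_G[OF w] by (simp add: comp_assoc[symmetric])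
  then have "inum r d = inum r (ginv w) + inum r (w \<circ> d)"
    using dist_add[OF d(2) young_inv[OF l w]] by simp
  also have "inum r (w \<circ> d) = inum r w + inum r d" by (rule dist_add[OF d(1) w])
  finally have "inum r w = 0" by simp
  then show ?thesis using young_inum_0[OF l w] by simp
qed

end

section \<open>Matrices of double cosets\<close>

lemma fibre_sizes_ex:
  assumes "finite S" "finite D" "card D = (\<Sum>c\<in>S. t c)"
  shows "\<exists>f. f ` D \<subseteq> S \<and> (\<forall>c\<in>S. card {x \<in> D. f x = c} = t c)"
  using assms
proof (induction S arbitrary: D rule: finite_induct)
  case (insert a S)
  then have "t a \<le> card D" by simp
  then obtain E where E: "E \<subseteq> D" "card E = t a" by (rule obtain_subset_with_card_n)
  have fE: "finite E" using E insert.prems finite_subset by blast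
  have "card (D - E) = (\<Sum>c\<in>S. t c)"
    using insert E fE by (simp add: card_Diff_subset)
  then obtain f where f: "f ` (D - E) \<subseteq> S" "\<forall>c\<in>S. card {x \<in> D - E. f x = c} = t c"
    using insert.IH[of "D - E"] insert.prems by auto
  define g where "g = (\<lambda>x. if x \<in> E then a else f x)"
  have "{x \<in> D. g x = a} = E"
    using f E insert.hyps by (auto simp: g_def)
  moreover have "{x \<in> D. g x = c} = {x \<in> D - E. f x = c}" if "c \<in> S" for c
    using that insert.hyps by (auto simp: g_def)
  moreover have "g ` D \<subseteq> insert a S" using f by (auto simp: g_def)
  ultimately show ?case using E f by (intro exI[of _ g]) auto
qed auto

lemma card_eq_sum_fibres:
  assumes "finite D"
  shows "card D = (\<Sum>j\<in>f ` D. card {x \<in> D. f x = j})"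
  using sum.image_gen[OF assms, of "\<lambda>_. 1 :: nat" f] by simp

lemma card_fibres_le:
  fixes c c' :: "'a \<Rightarrow> int"
  assumes D: "finite D" and e: "\<And>k. card {y \<in> D. c y = k} = card {y \<in> D. c' y = k}"
  shows "card {y \<in> D. c y \<le> j} = card {y \<in> D. c' y \<le> j}"
proof -
  let ?T = "{k \<in> c ` D \<union> c' ` D. k \<le> j}"
  have *: "card {y \<in> D. f y \<le> j} = (\<Sum>k\<in>?T. card {y \<in> D. f y = k})" if "f ` D \<subseteq> c ` D \<union> c' ` D"
    for f :: "'a \<Rightarrow> int"
  proof -
    have "(\<Sum>k\<in>?T. sum (\<lambda>_. 1) {y \<in> {y \<in> D. f y \<le> j}. f y = k}) = sum (\<lambda>_. 1 :: nat) {y \<in> D. f y \<le> j}"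
      using D that by (intro sum.group) auto
    moreover have "{y \<in> {y \<in> D. f y \<le> j}. f y = k} = {y \<in> D. f y = k}" if "k \<in> ?T" for k
      using that by auto
    ultimately show ?thesis by simp
  qed
  show ?thesis using *[of c] *[of c'] e by simp
qed

text \<open>An increasing colouring of an interval is determined by the sizes of its colour classes, because the
  integers of colour at most \<open>j\<close> form an initial segment. This is the set-theoretic core of that fact.\<close>

lemma down_closed_eq:
  fixes A B D :: "int set"
  assumes "finite D" "A \<subseteq> D" "B \<subseteq> D" "card A = card B"
    and A: "\<And>x y. x \<in> D \<Longrightarrow> y \<in> A \<Longrightarrow> x < y \<Longrightarrow> x \<in> A"
    and B: "\<And>x y. x \<in> D \<Longrightarrow> y \<in> B \<Longrightarrow> x < y \<Longrightarrow> x \<in> B"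
  shows "A = B"
proof -
  have fin: "finite A" "finite B" using assms finite_subset by blast+
  have "A \<subseteq> B"
  proof (rule ccontr)
    assume "\<not> A \<subseteq> B"
    then obtain x where x: "x \<in> A" "x \<notin> B" by blast
    have "B \<subset> A"
    proof
      show "B \<subseteq> A"
      proof
        fix y assume y: "y \<in> B"
        then have "y < x" using B[of x y] x assms by (metis linorder_neqE_linordered_idom subset_eq)
        then show "y \<in> A" using A[of y x] x y assms by blast
      qed
    qed (use x in auto)
    then show False using psubset_card_mono[OF fin(1) \<open>B \<subset> A\<close>] assms(4) by linarith
  qed
  then show ?thesis using card_subset_eq[OF fin(2)] assms by simp
qed

lemma M_aff_period: "A \<in> M_aff n \<Longrightarrow> A (i + k * int n) (j + k * int n) = A i j"
proof -
  assume A: "A \<in> M_aff n"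
  have "A (i + (0 + k * 1) * int n) (j + (0 + k * 1) * int n) = A (i + 0 * int n) (j + 0 * int n) + k * 0"
  proof (rule quasi_periodic[of "\<lambda>k. A (i + k * int n) (j + k * int n)" 1 0 0 k])
    fix k
    have "A (i + k * int n) (j + k * int n) = A (i + k * int n + int n) (j + k * int n + int n)"
      using A by (simp add: M_aff_def)
    then show "A (i + (k + 1) * int n) (j + (k + 1) * int n) = A (i + k * int n) (j + k * int n) + 0"
      by (simp add: algebra_simps)
  qed
  then show ?thesis by simp
qed

text \<open>Both sides add up the entries modulo shifts along the diagonal, with a normalized row index on the
  left and a normalized column index on the right.\<close>

lemma sum_ro_eq_sum_co:
  assumes A: "A \<in> M_aff n" and n: "1 \<le> n"
  shows "(\<Sum>i = 1..int n. ro A i) = (\<Sum>j = 1..int n. co A j)"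
proof -
  have rng: "1 \<le> j - (j - 1) div int n * int n \<and> j - (j - 1) div int n * int n \<le> int n" for j
  proof -
    have "0 < int n" using n by simp
    from pos_mod_bound[OF this, of "j - 1"] pos_mod_sign[OF this, of "j - 1"]
    show ?thesis using minus_mult_div_eq_mod[of "j - 1" "int n"]
      unfolding mult.commute[of _ "int n"] by linarith
  qed
  have per: "A (i - k * int n) (j - k * int n) = A i j" for i j k
    using M_aff_period[OF A, of i "- k" j] by simp
  have dv: "(i - k * int n - 1) div int n = - k" if "1 \<le> i" "i \<le> int n" for i k
  proof -
    have "i - k * int n - 1 = (i - 1) + (- k) * int n" by simp
    then have "(i - k * int n - 1) div int n = (i - 1) div int n + (- k)"
      using n by (simp only:) (subst div_mult_self1, simp_all)
    then show ?thesis using that by (simp add: div_pos_pos_trivial)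
  qed
  have "(\<Sum>i = 1..int n. ro A i) = (\<Sum>(i, j)\<in>Sigma {1..int n} (\<lambda>i. {j. A i j \<noteq> 0}). A i j)"
    using A unfolding ro_def by (subst sum.Sigma) (auto simp: M_aff_def)
  also have "\<dots> = (\<Sum>(j, i)\<in>Sigma {1..int n} (\<lambda>j. {i. A i j \<noteq> 0}). A i j)"
    by (rule sum.reindex_bij_witness[where
        j = "\<lambda>(i, j). (j - (j - 1) div int n * int n, i - (j - 1) div int n * int n)" and
        i = "\<lambda>(j, i). (i - (i - 1) div int n * int n, j - (i - 1) div int n * int n)"])
      (auto simp: per rng dv)
  also have "\<dots> = (\<Sum>j = 1..int n. co A j)"
    using A unfolding co_def by (subst sum.Sigma) (auto simp: M_aff_def)
  finally show ?thesis .
qed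

context affine_blocks
begin

abbreviation mt :: "zseq \<Rightarrow> (int \<Rightarrow> int) \<Rightarrow> zseq \<Rightarrow> zmat" where
  "mt l g m \<equiv> mat_of_triple n r l g m"

text \<open>The matrix counts integers by their colours in two colourings, the one by blocks of \<open>l\<close> and the
  \<open>g\<close>-translate of the one by blocks of \<open>m\<close>.\<close>

lemma mt_eq:
  assumes l: "l \<in> \<Lambda>" and m: "m \<in> \<Lambda>" and g: "g \<in> G"
  shows "mt l g m i j = int (card {x. blk l x = i \<and> blk m (ginv g x) = j})"
proof -
  have "R_set n r l i \<inter> g ` R_set n r m j = {x. blk l x = i \<and> blk m (ginv g x) = j}"
    using g by (auto simp: blk_set[OF l, symmetric] blk_set[OF m, symmetric] intro: image_eqI[of _ g "ginv g _"])
  then show ?thesis by (simp add: mat_of_triple_def)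
qed

lemma blk_ginv_shift: "m \<in> \<Lambda> \<Longrightarrow> g \<in> G \<Longrightarrow> blk m (ginv g (x + k * int r)) = blk m (ginv g x) + k * int n"
  by (simp add: G_period G_inv blk_shift_mult)

text \<open>Two periodic colourings of the integers with equally many integers of each colour differ by
  an element of the group.\<close>

lemma transport:
  fixes F F' :: "int \<Rightarrow> int \<times> int"
  assumes F: "\<And>x. F (x + int r) = (fst (F x) + int n, snd (F x) + int n)"
    and F': "\<And>x. F' (x + int r) = (fst (F' x) + int n, snd (F' x) + int n)"
    and fin: "\<And>c. finite {x. F x = c}" "\<And>c. finite {x. F' x = c}"
    and card: "\<And>c. card {x. F x = c} = card {x. F' x = c}"
  shows "\<exists>u\<in>G. \<forall>x. F' (u x) = F x"
proof -
  define sh where "sh = (\<lambda>k (c :: int \<times> int). (fst c + k * int n, snd c + k * int n))"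
  have shF: "F (x + k * int r) = sh k (F x)" for x k
    using quasi_periodic[of "\<lambda>x. fst (F x)" "int r" "int n" x k]
      quasi_periodic[of "\<lambda>x. snd (F x)" "int r" "int n" x k] F
    by (simp add: sh_def prod_eq_iff)
  have shF': "F' (x + k * int r) = sh k (F' x)" for x k
    using quasi_periodic[of "\<lambda>x. fst (F' x)" "int r" "int n" x k]
      quasi_periodic[of "\<lambda>x. snd (F' x)" "int r" "int n" x k] F'
    by (simp add: sh_def prod_eq_iff)
  have sh_sh: "sh a (sh b c) = sh (a + b) c" "sh 0 c = c" for a b c
    by (simp_all add: sh_def algebra_simps)
  have "\<exists>b. bij_betw b {x. F x = c} {x. F' x = c}" for c
    using fin card by (intro finite_same_card_bij) auto
  then obtain b where b: "\<And>c. bij_betw (b c) {x. F x = c} {x. F' x = c}" by metis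
  \<comment> \<open>The number of the period in which the first colour lies: colours move by \<open>(n, n)\<close> when integers move
    by \<open>r\<close>, so it suffices to choose bijections between the classes of colours of period \<open>0\<close>.\<close>
  define ht where "ht = (\<lambda>c :: int \<times> int. (fst c - 1) div int n)"
  have ht: "ht (sh k c) = ht c + k" for k c
    using n1 by (simp add: ht_def sh_def diff_add_eq[symmetric])
  define u where "u = (\<lambda>x. b (sh (- ht (F x)) (F x)) (x - ht (F x) * int r) + ht (F x) * int r)"
  have Fm: "F (x - ht (F x) * int r) = sh (- ht (F x)) (F x)" for x
    using shF[of x "- ht (F x)"] by simp
  have Fu: "F' (u x) = F x" for x
  proof -
    have "F' (b (sh (- ht (F x)) (F x)) (x - ht (F x) * int r)) = sh (- ht (F x)) (F x)"
      using bij_betwE[OF b[of "sh (- ht (F x)) (F x)"]] Fm[of x] by blast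
    then show ?thesis by (simp add: u_def shF' sh_sh)
  qed
  have "inj u"
  proof (rule injI)
    fix x y assume e: "u x = u y"
    then have "F x = F y" using Fu by metis
    then have "b (sh (- ht (F x)) (F x)) (x - ht (F x) * int r) = b (sh (- ht (F x)) (F x)) (y - ht (F x) * int r)"
      using e by (simp add: u_def)
    moreover have "F (y - ht (F x) * int r) = sh (- ht (F x)) (F x)"
      using Fm[of y] \<open>F x = F y\<close> by simp
    ultimately have "x - ht (F x) * int r = y - ht (F x) * int r"
      using Fm[of x] bij_betw_imp_inj_on[OF b[of "sh (- ht (F x)) (F x)"]] by (simp add: inj_on_def)
    then show "x = y" by simp
  qed
  moreover have "surj u"
  proof (unfold surj_def, rule allI)
    fix y
    let ?k = "ht (F' y)" let ?c = "sh (- ht (F' y)) (F' y)"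
    have "F' (y - ?k * int r) = ?c" using shF'[of y "- ?k"] by simp
    then have "y - ?k * int r \<in> b ?c ` {x. F x = ?c}"
      using bij_betw_imp_surj_on[OF b[of ?c]] by simp
    then obtain x0 where x0: "F x0 = ?c" "b ?c x0 = y - ?k * int r" by auto
    define x where "x = x0 + ?k * int r"
    have Fx: "F x = F' y" by (simp add: x_def shF x0 sh_sh)
    then have "u x = y" by (simp add: u_def) (simp add: x_def x0)
    then show "\<exists>x. y = u x" by metis
  qed
  ultimately have "bij u" by (simp add: bij_def)
  moreover have "u (x + int r) = u x + int r" for x
  proof -
    have a: "F (x + int r) = sh 1 (F x)" using shF[of x 1] by simp
    show ?thesis unfolding u_def a ht sh_sh by (simp add: algebra_simps)
  qed
  ultimately have "u \<in> G" by (simp add: G_iff)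
  then show ?thesis using Fu by blast
qed

lemma transport_pair:
  assumes g: "g \<in> G" "g' \<in> G" and l: "l \<in> \<Lambda>" and m: "m \<in> \<Lambda>" and e: "mt l g m = mt l g' m"
  obtains u where "u \<in> young n r l" "\<And>x. blk m (ginv g (u x)) = blk m (ginv g' x)"
proof -
  let ?F = "\<lambda>x. (blk l x, blk m (ginv g' x))" let ?F' = "\<lambda>x. (blk l x, blk m (ginv g x))"
  have fin: "finite {x. (blk l x, f x) = c}" for f :: "int \<Rightarrow> int" and c
    by (rule finite_subset[OF _ finite_blk[OF l, of "fst c"]]) auto
  have "card {x. ?F x = c} = card {x. ?F' x = c}" for c
    using fun_cong[OF fun_cong[OF e, of "fst c"], of "snd c"] g
    by (cases c) (simp add: mt_eq l m)
  moreover have "blk m (ginv h (x + int r)) = blk m (ginv h x) + int n" if "h \<in> G" for h x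
    using blk_ginv_shift[OF m that, of x 1] by simp
  ultimately have "\<exists>u\<in>G. \<forall>x. ?F' (u x) = ?F x"
    using fin blk_shift[OF l] g by (intro transport) (simp_all only: fst_conv snd_conv)
  then obtain u where "u \<in> G" "\<forall>x. ?F' (u x) = ?F x" by (rule bexE)
  then show thesis using that[of u] by (simp add: young_iff[OF l])
qed

lemma mt_young:
  assumes l: "l \<in> \<Lambda>" and m: "m \<in> \<Lambda>" and g: "g \<in> G" and u: "u \<in> young n r l" and u': "u' \<in> young n r m"
  shows "mt l (u \<circ> g \<circ> u') m = mt l g m"
proof (intro ext)
  fix i j
  have G: "u \<in> G" "u' \<in> G" using u u' by (auto dest: young_G)
  have "{x. blk l x = i \<and> blk m (ginv (u \<circ> g \<circ> u') x) = j} = {x. blk l x = i \<and> blk m (ginv g (ginv u x)) = j}"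
    using young_blk[OF m young_inv[OF m u']] G g by (simp add: G_inv_of_comp G_comp)
  also have "\<dots> = u ` {x. blk l x = i \<and> blk m (ginv g x) = j}"
    using young_blk[OF l u] young_blk[OF l young_inv[OF l u]] G
    by (auto intro: image_eqI[of _ u "ginv u _"])
  finally show "mt l (u \<circ> g \<circ> u') m i j = mt l g m i j"
    using G g by (simp add: mt_eq l m G_comp card_image inj_on_def G_eq_iff)
qed

text \<open>Two elements with the same matrix define pairs of colourings with the same joint distribution. A group
  element that carries one pair to the other belongs to the Young subgroup on the left, and what is
  left over belongs to the one on the right.\<close>

lemma double_coset_eq:
  assumes l: "l \<in> \<Lambda>" and m: "m \<in> \<Lambda>" and d: "d \<in> G"
  shows "{u \<circ> d \<circ> u' |u u'. u \<in> young n r l \<and> u' \<in> young n r m} = {g \<in> G. mt l g m = mt l d m}"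
proof (intro equalityI subsetI)
  fix g assume "g \<in> {u \<circ> d \<circ> u' |u u'. u \<in> young n r l \<and> u' \<in> young n r m}"
  then show "g \<in> {g \<in> G. mt l g m = mt l d m}"
    using mt_young[OF l m d] d by (auto simp: G_comp young_G)
next
  fix g assume "g \<in> {g \<in> G. mt l g m = mt l d m}"
  then have g: "g \<in> G" and e: "mt l d m = mt l g m" by auto
  obtain u where u: "u \<in> young n r l" "\<And>x. blk m (ginv d (u x)) = blk m (ginv g x)"
    using transport_pair[OF d g l m e] by blast
  define u' where "u' = ginv d \<circ> u \<circ> g"
  have uG: "u \<in> G" using u by (simp add: young_G)
  have "u' \<in> young n r m" using u g d uG by (simp add: young_iff[OF m] u'_def G_comp G_inv)
  moreover have "g = ginv u \<circ> d \<circ> u'" using d uG by (auto simp: u'_def)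
  ultimately show "g \<in> {u \<circ> d \<circ> u' |u u'. u \<in> young n r l \<and> u' \<in> young n r m}"
    using young_inv[OF l u(1)] by blast
qed

lemma mt_row_finite:
  assumes l: "l \<in> \<Lambda>" and m: "m \<in> \<Lambda>" and g: "g \<in> G"
  shows "finite {j. mt l g m i j \<noteq> 0}" and "ro (mt l g m) i = l i"
proof -
  let ?D = "{x. blk l x = i}" let ?f = "\<lambda>x. blk m (ginv g x)"
  have D: "finite ?D" by (rule finite_blk[OF l])
  have e: "mt l g m i j = int (card {x \<in> ?D. ?f x = j})" for j
    by (simp add: mt_eq l m g)
  have s: "{j. mt l g m i j \<noteq> 0} = ?f ` ?D"
    unfolding e using D by auto
  show "finite {j. mt l g m i j \<noteq> 0}" unfolding s using D by simp
  have "ro (mt l g m) i = (\<Sum>j\<in>?f ` ?D. int (card {x \<in> ?D. ?f x = j}))"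
    unfolding ro_def s by (intro sum.cong refl e)
  also have "\<dots> = int (card ?D)" using card_eq_sum_fibres[OF D, of ?f] by simp
  finally show "ro (mt l g m) i = l i" by (simp add: card_blk[OF l])
qed

lemma mt_col_finite:
  assumes l: "l \<in> \<Lambda>" and m: "m \<in> \<Lambda>" and g: "g \<in> G"
  shows "finite {i. mt l g m i j \<noteq> 0}" and "co (mt l g m) j = m j"
proof -
  let ?D = "{x. blk m x = j}" let ?f = "\<lambda>x. blk l (g x)"
  have D: "finite ?D" by (rule finite_blk[OF m])
  have e: "mt l g m i j = int (card {x \<in> ?D. ?f x = i})" for i
  proof -
    have "{x. blk l x = i \<and> blk m (ginv g x) = j} = g ` {x \<in> ?D. ?f x = i}"
      using g by (auto intro: image_eqI[of _ g "ginv g _"])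
    then show ?thesis using g by (simp add: mt_eq l m card_image inj_on_def G_eq_iff)
  qed
  have s: "{i. mt l g m i j \<noteq> 0} = ?f ` ?D"
    unfolding e using D by auto
  show "finite {i. mt l g m i j \<noteq> 0}" unfolding s using D by simp
  have "co (mt l g m) j = (\<Sum>i\<in>?f ` ?D. int (card {x \<in> ?D. ?f x = i}))"
    unfolding co_def s by (intro sum.cong refl e)
  also have "\<dots> = int (card ?D)" using card_eq_sum_fibres[OF D, of ?f] by simp
  finally show "co (mt l g m) j = m j" by (simp add: card_blk[OF m])
qed

lemma mt_Theta:
  assumes l: "l \<in> \<Lambda>" and m: "m \<in> \<Lambda>" and g: "g \<in> G"
  shows "mt l g m \<in> Theta_aff_r n r"
proof -
  have "mt l g m i j = mt l g m (i + int n) (j + int n)" for i j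
  proof -
    have b: "blk l (x - int r) = blk l x - int n" "blk m (ginv g (x - int r)) = blk m (ginv g x) - int n" for x
      using blk_shift_mult[OF l, of x "-1"] blk_ginv_shift[OF m g, of x "-1"] by simp_all
    have "{x. blk l x = i + int n \<and> blk m (ginv g x) = j + int n} =
        (\<lambda>x. x + int r) ` {x. blk l x = i \<and> blk m (ginv g x) = j}"
      using blk_shift[OF l] blk_ginv_shift[OF m g, of _ 1]
      by (auto intro!: image_eqI[of _ "\<lambda>x. x + int r" "_ - int r"] simp: b)
    then show ?thesis by (simp add: mt_eq l m g card_image)
  qed
  then have "mt l g m \<in> Theta_aff n"
    using mt_row_finite[OF l m g] mt_col_finite[OF l m g]
    by (auto simp: Theta_aff_def M_aff_def mt_eq l m g)
  moreover have "sigma_mat n (mt l g m) = int r"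
    using mt_row_finite(2)[OF l m g] Lambda_sum[OF l] by (simp add: sigma_mat_def ro_def)
  ultimately show ?thesis by (simp add: Theta_aff_r_def)
qed

lemma Theta_M: "A \<in> Theta_aff_r n r \<Longrightarrow> A \<in> M_aff n"
  by (simp add: Theta_aff_r_def Theta_aff_def)

lemma Theta_nonneg: "A \<in> Theta_aff_r n r \<Longrightarrow> 0 \<le> A i j"
  by (simp add: Theta_aff_r_def Theta_aff_def)

lemma ro_Lambda: assumes A: "A \<in> Theta_aff_r n r" shows "ro A \<in> \<Lambda>"
proof -
  have "ro A (i + int n) = ro A i" for i
    unfolding ro_def
    by (rule sum.reindex_bij_witness[where i = "\<lambda>j. j + int n" and j = "\<lambda>j. j - int n"])
      (use M_aff_period[OF Theta_M[OF A], of "i" 1] M_aff_period[OF Theta_M[OF A], of "i + int n" "-1"] in auto)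
  moreover have "sigma_seq n (ro A) = int r"
    using A by (simp add: Theta_aff_r_def sigma_mat_def sigma_seq_def ro_def)
  ultimately show ?thesis using Theta_nonneg[OF A] by (simp add: Lambda_aff_def ro_def sum_nonneg)
qed

lemma co_Lambda: assumes A: "A \<in> Theta_aff_r n r" shows "co A \<in> \<Lambda>"
proof -
  have "co A (j + int n) = co A j" for j
    unfolding co_def
    by (rule sum.reindex_bij_witness[where i = "\<lambda>j. j + int n" and j = "\<lambda>j. j - int n"])
      (use M_aff_period[OF Theta_M[OF A], of _ 1 j] M_aff_period[OF Theta_M[OF A], of _ "-1" "j + int n"] in auto)
  moreover have "sigma_seq n (co A) = int r"
    using A sum_ro_eq_sum_co[OF Theta_M[OF A] n1] ro_Lambda[OF A]
    by (simp add: Lambda_aff_def sigma_seq_def)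
  ultimately show ?thesis using Theta_nonneg[OF A] by (simp add: Lambda_aff_def co_def sum_nonneg)
qed

text \<open>In a block of the first period the colours can be distributed as the row of the matrix prescribes;
  the other blocks follow by periodicity.\<close>

lemma colouring_ex:
  assumes A: "A \<in> Theta_aff_r n r"
  obtains c where "\<And>x. c (x + int r) = c x + int n"
    "\<And>i j. int (card {x. blk (ro A) x = i \<and> c x = j}) = A i j"
proof -
  let ?l = "ro A"
  have l: "?l \<in> \<Lambda>" by (rule ro_Lambda[OF A])
  have fin: "finite {j. A i j \<noteq> 0}" for i using Theta_M[OF A] by (simp add: M_aff_def)
  have "\<exists>f. \<forall>j. card {x \<in> {x. blk ?l x = i}. f x = j} = nat (A i j)" for i
  proof -
    have "int (card {x. blk ?l x = i}) = (\<Sum>j | A i j \<noteq> 0. A i j)"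
      using card_blk[OF l, of i] by (simp add: ro_def)
    also have "\<dots> = int (\<Sum>j | A i j \<noteq> 0. nat (A i j))"
      using Theta_nonneg[OF A] by simp
    finally have "card {x. blk ?l x = i} = (\<Sum>j | A i j \<noteq> 0. nat (A i j))" by linarith
    then obtain f where f: "f ` {x. blk ?l x = i} \<subseteq> {j. A i j \<noteq> 0}"
      "\<forall>j\<in>{j. A i j \<noteq> 0}. card {x \<in> {x. blk ?l x = i}. f x = j} = nat (A i j)"
      using fibre_sizes_ex[OF fin finite_blk[OF l]] by blast
    have "card {x \<in> {x. blk ?l x = i}. f x = j} = nat (A i j)" for j
    proof (cases "A i j = 0")
      case True
      then have "{x \<in> {x. blk ?l x = i}. f x = j} = {}" using f(1) by auto
      then have "card {x \<in> {x. blk ?l x = i}. f x = j} = 0" by (simp only: card.empty)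
      then show ?thesis using True by simp
    qed (use f(2) in auto)
    then show ?thesis by blast
  qed
  then obtain f where f: "\<And>i j. card {x \<in> {x. blk ?l x = i}. f i x = j} = nat (A i j)" by metis
  define ht where "ht = (\<lambda>x. (blk ?l x - 1) div int n)"
  define c where "c = (\<lambda>x. f (blk ?l x - ht x * int n) (x - ht x * int r) + ht x * int n)"
  have "ht (x + int r) = ht x + 1" for x
    using n1 by (simp add: ht_def blk_shift[OF l] diff_add_eq[symmetric])
  then have "c (x + int r) = c x + int n" for x
    by (simp add: c_def blk_shift[OF l] algebra_simps)
  moreover have "int (card {x. blk ?l x = i \<and> c x = j}) = A i j" for i j
  proof -
    let ?k = "(i - 1) div int n"
    have b: "blk ?l (x - ?k * int r) = blk ?l x - ?k * int n" for x
      using blk_shift_mult[OF l, of x "- ?k"] by simp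
    have "{x. blk ?l x = i \<and> c x = j} = (\<lambda>x. x + ?k * int r) `
        {x \<in> {x. blk ?l x = i - ?k * int n}. f (i - ?k * int n) x = j - ?k * int n}" (is "?L = _ ` ?R")
    proof (intro equalityI subsetI)
      fix x assume "x \<in> ?L"
      then show "x \<in> (\<lambda>x. x + ?k * int r) ` ?R"
        by (intro image_eqI[of _ "\<lambda>x. x + ?k * int r" "x - ?k * int r"]) (auto simp: b c_def ht_def)
    next
      fix x assume "x \<in> (\<lambda>x. x + ?k * int r) ` ?R"
      then obtain y where y: "x = y + ?k * int r" "y \<in> ?R" by blast
      then have "blk ?l x = i" by (simp add: blk_shift_mult[OF l])
      then show "x \<in> ?L" using y by (simp add: c_def ht_def)
    qed
    then have "card {x. blk ?l x = i \<and> c x = j} = nat (A (i - ?k * int n) (j - ?k * int n))"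
      using f by (simp add: card_image inj_on_def)
    then show ?thesis using M_aff_period[OF Theta_M[OF A], of i "- ?k" j] Theta_nonneg[OF A] by simp
  qed
  ultimately show thesis by (rule that)
qed

text \<open>Every periodic colouring with prescribed numbers of integers of each colour is a translate of
  the colouring by blocks; so colourings correspond to cosets of a Young subgroup.\<close>

lemma colouring_translate:
  assumes m: "m \<in> \<Lambda>" and c: "\<And>x. c (x + int r) = c x + int n"
    and fin: "\<And>j. finite {x. c x = j}" and card: "\<And>j. int (card {x. c x = j}) = m j"
  obtains g where "g \<in> G" "\<And>x. blk m (ginv g x) = c x"
proof -
  have "{x. (f x, f x) = ab} = (if fst ab = snd ab then {x. f x = fst ab} else {})"
    for f :: "int \<Rightarrow> int" and ab
    by (cases ab) auto
  moreover have "card {x. c x = j} = card {x. blk m x = j}" for j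
    using card[of j] card_blk[OF m, of j] by simp
  ultimately have "\<exists>u\<in>G. \<forall>x. (\<lambda>x. (blk m x, blk m x)) (u x) = (\<lambda>x. (c x, c x)) x"
    using fin finite_blk[OF m] c blk_shift[OF m]
    by (intro transport) simp_all
  then obtain u where "u \<in> G" "\<forall>x. (\<lambda>x. (blk m x, blk m x)) (u x) = (\<lambda>x. (c x, c x)) x"
    by (rule bexE)
  then show thesis using that[of "ginv u"] by (simp add: G_inv)
qed

lemma finite_column_colouring:
  assumes A: "A \<in> M_aff n" and fin: "\<And>i j. finite {x. b x = i \<and> c x = j}"
    and card: "\<And>i j. int (card {x. b x = i \<and> c x = j}) = A i j"
  shows "finite {x. c x = j}" and "int (card {x. c x = j}) = co A j"
proof -
  have finA: "finite {i. A i j \<noteq> 0}" using A by (simp add: M_aff_def)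
  have "b x \<in> {i. A i j \<noteq> 0}" if "c x = j" for x
  proof -
    have "{y. b y = b x \<and> c y = j} \<noteq> {}" using that by blast
    then have "card {y. b y = b x \<and> c y = j} \<noteq> 0"
      unfolding card_eq_0_iff using fin[of "b x" j] by blast
    then show ?thesis unfolding mem_Collect_eq card[of "b x" j, symmetric] of_nat_eq_0_iff .
  qed
  then have U: "{x. c x = j} = (\<Union>i\<in>{i. A i j \<noteq> 0}. {x. b x = i \<and> c x = j})" by auto
  show "finite {x. c x = j}" unfolding U using finA fin by blast
  have "card {x. c x = j} = (\<Sum>i | A i j \<noteq> 0. card {x. b x = i \<and> c x = j})"
    unfolding U using finA fin by (intro card_UN_disjoint) auto
  then show "int (card {x. c x = j}) = co A j" by (simp add: co_def card)
qed

lemma mt_ex: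
  assumes A: "A \<in> Theta_aff_r n r"
  obtains g where "g \<in> G" "mt (ro A) g (co A) = A"
proof -
  have l: "ro A \<in> \<Lambda>" and m: "co A \<in> \<Lambda>" using ro_Lambda co_Lambda A by auto
  obtain c where c: "\<And>x. c (x + int r) = c x + int n"
    "\<And>i j. int (card {x. blk (ro A) x = i \<and> c x = j}) = A i j"
    using colouring_ex[OF A] by blast
  have "finite {x. blk (ro A) x = i \<and> c x = j}" for i j
    by (rule finite_subset[OF _ finite_blk[OF l, of i]]) auto
  note f = finite_column_colouring[OF Theta_M[OF A] this c(2)]
  obtain g where "g \<in> G" "\<And>x. blk (co A) (ginv g x) = c x"
    using colouring_translate[OF m c(1) f] by blast
  then show thesis using that[of g] c(2) by (auto simp: mt_eq l m fun_eq_iff)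
qed

lemma dist_less:
  assumes l: "l \<in> \<Lambda>" and d: "d \<in> dist_reps n r l" and "x < y" "blk l x = blk l y"
  shows "ginv d x < ginv d y"
  by (rule increasing_on_block[OF l _ assms(3,4)]) (use d dist_iff[OF l] in blast)

lemma double_reps_iff:
  "d \<in> dist_double_reps n r l m \<longleftrightarrow> d \<in> dist_reps n r l \<and> ginv d \<in> dist_reps n r m"
  by (auto simp: dist_double_reps_def dist_G intro!: image_eqI[of d ginv "ginv d"])

text \<open>An element of minimal length in its double coset can be shortened from neither side.\<close>

lemma double_rep_ex:
  assumes l: "l \<in> \<Lambda>" and m: "m \<in> \<Lambda>" and g: "g \<in> G"
  shows "\<exists>d\<in>dist_double_reps n r l m. mt l d m = mt l g m"
proof -
  obtain d where d: "d \<in> G" "mt l d m = mt l g m"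
    and min: "\<And>d'. d' \<in> G \<Longrightarrow> mt l d' m = mt l g m \<Longrightarrow> inum r d \<le> inum r d'"
    using ex_has_least_nat[of "\<lambda>d. d \<in> G \<and> mt l d m = mt l g m" g "inum r"] g by blast
  have "ginv d t < ginv d (t + 1)" if "blk l t = blk l (t + 1)" for t
  proof (rule ccontr)
    assume a: "\<not> ginv d t < ginv d (t + 1)"
    have "mt l (s t \<circ> d) m = mt l g m"
      using mt_young[OF l m d(1) s_young[OF l that] young_id[OF m]] d by simp
    then show False using min[of "s t \<circ> d"] inum_step_down[OF d(1) a] d by (simp add: G_comp)
  qed
  moreover have "d t < d (t + 1)" if "blk m t = blk m (t + 1)" for t
  proof (rule ccontr)
    assume a: "\<not> d t < d (t + 1)"
    have "mt l (d \<circ> s t) m = mt l g m"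
      using mt_young[OF l m d(1) young_id[OF l] s_young[OF m that]] d by simp
    moreover have "inum r (ginv d) = Suc (inum r (s t \<circ> ginv d))"
      using a d by (intro inum_step_down) (simp_all add: G_inv)
    moreover have "inum r (s t \<circ> ginv d) = inum r (d \<circ> s t)"
      using inum_inv[OF G_comp[OF d(1) s_G], of t] d by (simp add: inv_comp_s)
    ultimately show False using min[of "d \<circ> s t"] d by (simp add: G_comp inum_inv)
  qed
  ultimately have "d \<in> dist_double_reps n r l m"
    using d by (simp add: double_reps_iff dist_iff l m G_inv)
  then show ?thesis using d by blast
qed

text \<open>Translating the blocks of \<open>m\<close> by a distinguished element gives a colouring that is increasing on each
  block of \<open>l\<close>. Such a colouring is determined by the matrix, and it determines the element up to the
  right Young subgroup, hence completely.\<close>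

lemma double_rep_unique:
  assumes l: "l \<in> \<Lambda>" and m: "m \<in> \<Lambda>"
    and d: "d \<in> dist_double_reps n r l m" and d': "d' \<in> dist_double_reps n r l m"
    and e: "mt l d m = mt l d' m"
  shows "d = d'"
proof -
  have G: "d \<in> G" "d' \<in> G" using d d' by (auto simp: double_reps_iff dist_G)
  have mono: "blk m (ginv f x) \<le> blk m (ginv f y)"
    if "x < y" "blk l x = blk l y" "f \<in> dist_double_reps n r l m" for x y f
    using dist_less[OF l, of f x y] that blk_mono[OF m] by (auto simp: double_reps_iff)
  have same: "blk m (ginv d x) = blk m (ginv d' x)" for x
  proof -
    let ?D = "{y. blk l y = blk l x}"
    have D: "finite ?D" by (rule finite_blk[OF l])
    have "card {y \<in> ?D. blk m (ginv d y) = k} = card {y \<in> ?D. blk m (ginv d' y) = k}" for k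
      using fun_cong[OF fun_cong[OF e, of "blk l x"], of k] by (simp add: mt_eq l m G)
    from card_fibres_le[OF D this]
    have "{y \<in> ?D. blk m (ginv d y) \<le> j} = {y \<in> ?D. blk m (ginv d' y) \<le> j}" for j
      by (intro down_closed_eq[OF D]) (auto dest: mono[OF _ _ d] mono[OF _ _ d'] order_trans)
    then have "blk m (ginv d x) \<le> j \<longleftrightarrow> blk m (ginv d' x) \<le> j" for j by blast
    then show ?thesis by (meson order_antisym order_refl)
  qed
  let ?w = "ginv d \<circ> d'"
  have w: "?w \<in> young n r m" using G same by (simp add: young_iff[OF m] G_comp G_inv)
  have "?w \<circ> ginv d' = ginv d" using G by (simp add: comp_assoc)
  then have "?w = id" using dist_rep_unique[OF m _ _ w, of "ginv d'"] d d' by (simp add: double_reps_iff)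
  then have "d \<circ> ?w = d" by simp
  then show ?thesis using G by (simp add: comp_assoc[symmetric])
qed

lemma e_basis_eq:
  assumes A: "A \<in> Theta_aff_r n r"
  obtains d where "d \<in> dist_double_reps n r (ro A) (co A)" "mt (ro A) d (co A) = A"
    "e_basis n r A = phi n r (ro A) d (co A)"
proof -
  have l: "ro A \<in> \<Lambda>" and m: "co A \<in> \<Lambda>" using ro_Lambda co_Lambda A by auto
  obtain g where g: "g \<in> G" "mt (ro A) g (co A) = A" using mt_ex[OF A] by blast
  obtain d where d: "d \<in> dist_double_reps n r (ro A) (co A)" "mt (ro A) d (co A) = A"
    using double_rep_ex[OF l m g(1)] g by auto
  have "(THE (l, d, m). l \<in> \<Lambda> \<and> m \<in> \<Lambda> \<and> d \<in> dist_double_reps n r l m \<and> A = mt l d m) = (ro A, d, co A)"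
  proof (rule the_equality)
    show "case (ro A, d, co A) of (l, d, m) \<Rightarrow> l \<in> \<Lambda> \<and> m \<in> \<Lambda> \<and> d \<in> dist_double_reps n r l m \<and> A = mt l d m"
      using l m d by simp
  next
    fix p assume "case p of (l, d, m) \<Rightarrow> l \<in> \<Lambda> \<and> m \<in> \<Lambda> \<and> d \<in> dist_double_reps n r l m \<and> A = mt l d m"
    then obtain l' d' m' where p: "p = (l', d', m')" "l' \<in> \<Lambda>" "m' \<in> \<Lambda>" "d' \<in> dist_double_reps n r l' m'" "A = mt l' d' m'"
      by (cases p) auto
    have "d' \<in> G" using p(4) double_reps_iff dist_G by blast
    then have e: "l' = ro A" "m' = co A"
      using mt_row_finite(2)[OF p(2,3)] mt_col_finite(2)[OF p(2,3)] by (auto simp: p(5))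
    have "mt (ro A) d (co A) = mt (ro A) d' (co A)"
      unfolding d(2) unfolding e[symmetric] by (rule p(5))
    moreover have "d' \<in> dist_double_reps n r (ro A) (co A)" using p(4) unfolding e .
    ultimately have "d = d'" by (intro double_rep_unique[OF l m d(1)])
    then show "p = (ro A, d, co A)" unfolding p(1) e by simp
  qed
  then have "e_basis n r A = phi n r (ro A) d (co A)" by (simp add: e_basis_def)
  then show thesis using that d by blast
qed

end

section \<open>The right ideals generated by the Young symmetrizers\<close>

context affine_blocks
begin

abbreviation X :: "zseq \<Rightarrow> hecke" where
  "X l \<equiv> x_elt n r l"

lemma lk_sum_T: "finite A \<Longrightarrow> lk (\<Sum>w\<in>A. T w) g = (if g \<in> A then 1 else 0)"
  by (simp add: lookup_sum lk_T sum.delta)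

lemma lk_X: "l \<in> \<Lambda> \<Longrightarrow> lk (X l) g = (if g \<in> young n r l then 1 else 0)"
  by (simp add: x_elt_def lk_sum_T finite_young)

lemma X_K: "X l \<in> K"
  unfolding x_elt_def by (intro K_sum T_K) (rule young_G)

lemma q_neq_0: "q \<noteq> 0"
proof
  assume "q = 0"
  then have "eps q = 0" by simp
  then show False by simp
qed

lemma s_comp_young_iff:
  assumes l: "l \<in> \<Lambda>" and t: "blk l t = blk l (t + 1)"
  shows "s t \<circ> w \<in> young n r l \<longleftrightarrow> w \<in> young n r l"
  using young_comp[OF l s_young[OF l t]] s_comp_s(2) by metis

lemma T_s_X:
  assumes l: "l \<in> \<Lambda>" and t: "blk l t = blk l (t + 1)"
  shows "T (s t) \<star> X l = hscale q (X l)"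
proof (rule poly_mapping_eqI)
  fix w
  show "lk (T (s t) \<star> X l) w = lk (hscale q (X l)) w"
    using s_comp_young_iff[OF l t, of w] by (simp add: star_T_s X_K lk_Lop lk_X[OF l])
qed

definition left_inv :: "zseq \<Rightarrow> hecke \<Rightarrow> bool" where
  "left_inv l y \<longleftrightarrow> y \<in> K \<and> (\<forall>w\<in>young n r l. \<forall>g\<in>G. lk y (w \<circ> g) = lk y g)"

definition right_inv :: "zseq \<Rightarrow> hecke \<Rightarrow> bool" where
  "right_inv l y \<longleftrightarrow> y \<in> K \<and> (\<forall>w\<in>young n r l. \<forall>g\<in>G. lk y (g \<circ> w) = lk y g)"

text \<open>Comparing the coefficients of both sides of \<open>T s X h = q X h\<close> shows that those of \<open>X h\<close> at \<open>g\<close> and at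
  \<open>s g\<close> agree.\<close>

lemma left_inv_X_star:
  assumes l: "l \<in> \<Lambda>" and h: "h \<in> K"
  shows "left_inv l (X l \<star> h)"
proof -
  let ?y = "X l \<star> h"
  have y: "?y \<in> K" using X_K h by (rule star_closed)
  have step: "lk ?y (s t \<circ> g) = lk ?y g" if t: "blk l t = blk l (t + 1)" for t g
  proof -
    have "Lop r t ?y = T (s t) \<star> X l \<star> h"
      using star_assoc[OF T_K[OF s_G] X_K h, of t] star_T_s[OF y, of t] by simp
    also have "\<dots> = hscale q ?y" using star_hscale(1)[OF X_K h] by (simp add: T_s_X[OF l t])
    finally have "lk (Lop r t ?y) g = q * lk ?y g" by simp
    then show ?thesis using q_neq_0 by (simp add: lk_Lop algebra_simps split: if_splits)
  qed
  have "lk ?y (w \<circ> g) = lk ?y g" if "w \<in> young n r l" for w g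
    using l that
  proof (induction rule: young_induct)
    case id
    show "lk ?y (id \<circ> g) = lk ?y g" by simp
  next
    case (step t w)
    have "lk ?y (w \<circ> g) = lk ?y g" by (rule step(4))
    then show "lk ?y (s t \<circ> w \<circ> g) = lk ?y g"
      using \<open>\<And>t g. blk l t = blk l (t + 1) \<Longrightarrow> lk ?y (s t \<circ> g) = lk ?y g\<close>[OF step(2)]
      by (simp add: comp_assoc)
  qed
  then show ?thesis using y by (simp add: left_inv_def)
qed

lemma lk_sum_translates_left:
  assumes l: "l \<in> \<Lambda>" and d: "d \<in> G"
  shows "lk (\<Sum>w\<in>young n r l. T (w \<circ> d)) g = (if g \<circ> ginv d \<in> young n r l then 1 else 0)"
proof -
  have e: "w \<circ> d = g \<longleftrightarrow> w = g \<circ> ginv d" for w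
    using d by (auto simp: comp_assoc)
  have "lk (\<Sum>w\<in>young n r l. T (w \<circ> d)) g = (\<Sum>w\<in>young n r l. if w = g \<circ> ginv d then 1 else 0)"
    by (simp add: lookup_sum lk_T eq_commute[of g] e)
  then show ?thesis by (simp add: finite_young[OF l])
qed

lemma lk_sum_translates_right:
  assumes l: "l \<in> \<Lambda>" and d: "d \<in> G"
  shows "lk (\<Sum>w\<in>young n r l. T (d \<circ> w)) g = (if ginv d \<circ> g \<in> young n r l then 1 else 0)"
proof -
  have e: "d \<circ> w = g \<longleftrightarrow> w = ginv d \<circ> g" for w
    using d by (auto simp: comp_assoc[symmetric])
  have "lk (\<Sum>w\<in>young n r l. T (d \<circ> w)) g = (\<Sum>w\<in>young n r l. if w = ginv d \<circ> g then 1 else 0)"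
    by (simp add: lookup_sum lk_T eq_commute[of g] e)
  then show ?thesis by (simp add: finite_young[OF l])
qed

lemma X_star_T:
  assumes l: "l \<in> \<Lambda>" and d: "d \<in> dist_reps n r l"
  shows "X l \<star> T d = (\<Sum>w\<in>young n r l. T (w \<circ> d))"
proof -
  have dG: "d \<in> G" by (rule dist_G[OF d])
  have "X l \<star> T d = (\<Sum>w\<in>young n r l. T w \<star> T d)"
    unfolding x_elt_def by (rule klin_sum[OF klin_star_left[OF T_K[OF dG]]]) (rule T_K[OF young_G])
  also have "\<dots> = (\<Sum>w\<in>young n r l. T (w \<circ> d))"
    using dist_add[OF d] by (intro sum.cong refl star_T_T dG) (auto dest: young_G)
  finally show ?thesis .
qed

lemma T_star_X:
  assumes l: "l \<in> \<Lambda>" and d: "d \<in> G" "ginv d \<in> dist_reps n r l"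
  shows "T d \<star> X l = (\<Sum>w\<in>young n r l. T (d \<circ> w))"
proof -
  have "T d \<star> X l = (\<Sum>w\<in>young n r l. T d \<star> T w)"
    unfolding x_elt_def by (rule klin_sum[OF klin_star_right[OF T_K[OF d(1)]]]) (rule T_K[OF young_G])
  also have "\<dots> = (\<Sum>w\<in>young n r l. T (d \<circ> w))"
  proof (intro sum.cong refl star_T_T d)
    fix w assume w: "w \<in> young n r l"
    then show wG: "w \<in> G" by (rule young_G)
    have "inum r (ginv w \<circ> ginv d) = inum r (ginv w) + inum r (ginv d)"
      by (rule dist_add[OF d(2) young_inv[OF l w]])
    moreover have "ginv w \<circ> ginv d = ginv (d \<circ> w)" using d wG by (simp add: G_inv_of_comp)
    ultimately show "inum r (d \<circ> w) = inum r d + inum r w"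
      using d wG by (simp add: inum_inv G_comp)
  qed
  finally show ?thesis .
qed

text \<open>The description by equations between coefficients makes the right ideal stable under division by
  \<open>v - 1\<close>. An element with constant coefficients on cosets is the symmetrizer times its restriction to
  the distinguished representatives.\<close>

lemma x_ideal_iff:
  assumes l: "l \<in> \<Lambda>"
  shows "y \<in> x_ideal n r l \<longleftrightarrow> left_inv l y"
proof
  assume "y \<in> x_ideal n r l"
  then show "left_inv l y" using left_inv_X_star[OF l] by (auto simp: x_ideal_def hecke_ops)
next
  assume "left_inv l y"
  then have y: "y \<in> K" and inv: "\<And>w g. w \<in> young n r l \<Longrightarrow> g \<in> G \<Longrightarrow> lk y (w \<circ> g) = lk y g"
    by (auto simp: left_inv_def)
  define D where "D = Poly_Mapping.keys y \<inter> dist_reps n r l"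
  have D: "finite D" "\<And>d. d \<in> D \<Longrightarrow> d \<in> dist_reps n r l" by (auto simp: D_def)
  have DG: "d \<in> G" if "d \<in> D" for d using D(2)[OF that] by (rule dist_G)
  define h where "h = (\<Sum>d\<in>D. hscale (lk y d) (T d))"
  have h: "h \<in> K" unfolding h_def using D by (intro K_sum K_hscale T_K) (auto dest: dist_G)
  have "X l \<star> h = (\<Sum>d\<in>D. X l \<star> hscale (lk y d) (T d))"
    unfolding h_def using D(2)
    by (intro klin_sum[OF klin_star_right[OF X_K]] K_hscale T_K) (auto dest: dist_G)
  also have "\<dots> = (\<Sum>d\<in>D. hscale (lk y d) (\<Sum>w\<in>young n r l. T (w \<circ> d)))"
    using D(2) DG by (intro sum.cong refl) (simp add: star_hscale X_K T_K X_star_T[OF l])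
  finally have e0: "X l \<star> h = (\<Sum>d\<in>D. hscale (lk y d) (\<Sum>w\<in>young n r l. T (w \<circ> d)))" .
  have e: "lk (X l \<star> h) g = (\<Sum>d\<in>D. if g \<circ> ginv d \<in> young n r l then lk y d else 0)" for g
    unfolding e0 lookup_sum[of _ D] lk_hscale
    by (intro sum.cong refl) (simp add: lk_sum_translates_left[OF l DG])
  have "X l \<star> h = y"
  proof (rule poly_mapping_eqI)
    fix g
    show "lk (X l \<star> h) g = lk y g"
    proof (cases "g \<in> G")
      case False
      then show ?thesis using y star_closed[OF X_K h] by (simp add: K_iff)
    next
      case g: True
      obtain d0 u where d0: "d0 \<in> dist_reps n r l" "u \<in> young n r l" "g = u \<circ> d0"
        using dist_rep_ex[OF l g] by blast
      have G: "d0 \<in> G" "u \<in> G" using d0 by (auto dest: dist_G young_G)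
      have "g \<circ> ginv d \<in> young n r l \<longleftrightarrow> d = d0" if "d \<in> D" for d
      proof
        have dG: "d \<in> G" using D(2)[OF that] by (rule dist_G)
        assume "g \<circ> ginv d \<in> young n r l"
        then have w: "ginv u \<circ> (g \<circ> ginv d) \<in> young n r l" by (rule young_comp[OF l young_inv[OF l d0(2)]])
        have "(ginv u \<circ> (g \<circ> ginv d)) \<circ> d = d0" using G dG by (auto simp: d0(3))
        then have "ginv u \<circ> (g \<circ> ginv d) = id"
          using dist_rep_unique[OF l D(2)[OF that] _ w] d0(1) by simp
        then show "d = d0" using \<open>_ \<circ> d = d0\<close> by simp
      qed (use d0 G in \<open>simp add: comp_assoc\<close>)
      then have "lk (X l \<star> h) g = (\<Sum>d\<in>D. if d = d0 then lk y d else 0)"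
        unfolding e by (intro sum.cong) auto
      also have "\<dots> = (if d0 \<in> D then lk y d0 else 0)" using D(1) by simp
      also have "\<dots> = lk y d0" using d0(1) by (simp add: D_def in_keys_iff)
      also have "\<dots> = lk y g" using inv[OF d0(2) G(1)] by (simp add: d0(3))
      finally show ?thesis .
    qed
  qed
  then show "y \<in> x_ideal n r l" using h by (auto simp: x_ideal_def hecke_ops)
qed

text \<open>An element whose coefficients are constant on right translates by the Young subgroup is a left
  multiple of the symmetrizer; the cofactor keeps the coefficients at the shortest representatives.\<close>

definition cofactor :: "zseq \<Rightarrow> hecke \<Rightarrow> hecke" where
  "cofactor l y = (\<Sum>d\<in>{d \<in> Poly_Mapping.keys y. ginv d \<in> dist_reps n r l}. hscale (lk y d) (T d))"

lemma cofactor_K: assumes "y \<in> K" shows "cofactor l y \<in> K"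
  unfolding cofactor_def using K_keys[OF assms] by (intro K_sum K_hscale T_K) auto

lemma lk_cofactor: "lk (cofactor l y) g = (if ginv g \<in> dist_reps n r l then lk y g else 0)"
proof -
  let ?D = "{d \<in> Poly_Mapping.keys y. ginv d \<in> dist_reps n r l}"
  have "lk (cofactor l y) g = (\<Sum>d\<in>?D. if d = g then lk y d else 0)"
    unfolding cofactor_def lookup_sum by (intro sum.cong) (auto simp: lk_T)
  also have "\<dots> = (if g \<in> ?D then lk y g else 0)" by simp
  finally show ?thesis by (auto simp: in_keys_iff)
qed

lemma cofactor_star_X:
  assumes l: "l \<in> \<Lambda>" and y: "right_inv l y"
  shows "cofactor l y \<star> X l = y"
proof -
  have yK: "y \<in> K" and inv: "\<And>w g. w \<in> young n r l \<Longrightarrow> g \<in> G \<Longrightarrow> lk y (g \<circ> w) = lk y g"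
    using y by (auto simp: right_inv_def)
  let ?D = "{d \<in> Poly_Mapping.keys y. ginv d \<in> dist_reps n r l}"
  have DG: "d \<in> G" if "d \<in> ?D" for d using that K_keys[OF yK] by auto
  have "cofactor l y \<star> X l = (\<Sum>d\<in>?D. hscale (lk y d) (T d) \<star> X l)"
    unfolding cofactor_def using DG by (intro klin_sum[OF klin_star_left[OF X_K]] K_hscale T_K)
  also have "\<dots> = (\<Sum>d\<in>?D. hscale (lk y d) (\<Sum>w\<in>young n r l. T (d \<circ> w)))"
    using DG by (intro sum.cong refl) (simp add: star_hscale X_K T_K T_star_X[OF l])
  finally have e0: "cofactor l y \<star> X l = (\<Sum>d\<in>?D. hscale (lk y d) (\<Sum>w\<in>young n r l. T (d \<circ> w)))" .
  have e: "lk (cofactor l y \<star> X l) g = (\<Sum>d\<in>?D. if ginv d \<circ> g \<in> young n r l then lk y d else 0)" for g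
    unfolding e0 lookup_sum[of _ ?D] lk_hscale
    by (intro sum.cong refl) (simp add: lk_sum_translates_right[OF l DG])
  show ?thesis
  proof (rule poly_mapping_eqI)
    fix g
    show "lk (cofactor l y \<star> X l) g = lk y g"
    proof (cases "g \<in> G")
      case False
      then show ?thesis using yK star_closed[OF cofactor_K[OF yK] X_K] by (simp add: K_iff)
    next
      case g: True
      obtain d' u where d': "d' \<in> dist_reps n r l" "u \<in> young n r l" "ginv g = u \<circ> d'"
        using dist_rep_ex[OF l G_inv[OF g]] by blast
      define d0 where "d0 = ginv d'"
      have G: "d' \<in> G" "u \<in> G" "d0 \<in> G" using d' by (auto dest: dist_G young_G simp: d0_def G_inv)
      have inv_d0: "ginv d0 = d'" using G by (simp add: d0_def)
      have "g = ginv (ginv g)" using g by simp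
      then have gd: "g = d0 \<circ> ginv u" unfolding d'(3) using G by (simp add: G_inv_of_comp d0_def)
      have "ginv d \<circ> g \<in> young n r l \<longleftrightarrow> d = d0" if "d \<in> ?D" for d
      proof
        assume "ginv d \<circ> g \<in> young n r l"
        then have w: "(ginv d \<circ> g) \<circ> u \<in> young n r l" by (rule young_comp[OF l _ d'(2)])
        have e: "((ginv d \<circ> g) \<circ> u) \<circ> d' = ginv d" using G by (auto simp: gd d0_def)
        then have "(ginv d \<circ> g) \<circ> u = id"
          using dist_rep_unique[OF l d'(1) _ w] that by simp
        then have "d' = ginv d" using e by simp
        then show "d = d0" using DG[OF that] by (simp add: d0_def)
      next
        assume "d = d0"
        then show "ginv d \<circ> g \<in> young n r l"
          using young_inv[OF l d'(2)] G by (simp add: gd comp_assoc[symmetric])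
      qed
      then have "lk (cofactor l y \<star> X l) g = (\<Sum>d\<in>?D. if d = d0 then lk y d else 0)"
        unfolding e by (intro sum.cong) auto
      also have "\<dots> = (if d0 \<in> ?D then lk y d0 else 0)" by simp
      also have "\<dots> = lk y d0" using d'(1) by (simp add: in_keys_iff inv_d0)
      also have "\<dots> = lk y g" using inv[OF young_inv[OF l d'(2)] G(3)] by (simp add: gd)
      finally show ?thesis .
    qed
  qed
qed

abbreviation dcs :: "zseq \<Rightarrow> (int \<Rightarrow> int) \<Rightarrow> zseq \<Rightarrow> hecke" where
  "dcs l d m \<equiv> double_coset_sum n r l d m"

lemma lk_dcs:
  assumes l: "l \<in> \<Lambda>" and m: "m \<in> \<Lambda>" and d: "d \<in> G"
  shows "lk (dcs l d m) g = (if g \<in> G \<and> mt l g m = mt l d m then 1 else 0)"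
proof -
  let ?A = "{u \<circ> d \<circ> u' |u u'. u \<in> young n r l \<and> u' \<in> young n r m}"
  have "?A = (\<lambda>(u, u'). u \<circ> d \<circ> u') ` (young n r l \<times> young n r m)" by auto
  then have "finite ?A" by (simp only: finite_imageI finite_cartesian_product finite_young l m)
  then show ?thesis unfolding double_coset_sum_def lk_sum_T[OF \<open>finite ?A\<close>]
    by (simp only: double_coset_eq[OF l m d] mem_Collect_eq)
qed

lemma dcs_inv:
  assumes l: "l \<in> \<Lambda>" and m: "m \<in> \<Lambda>" and d: "d \<in> G"
  shows "left_inv l (dcs l d m)" and "right_inv m (dcs l d m)"
proof -
  have k: "dcs l d m \<in> K" by (simp add: K_iff lk_dcs l m d)
  have "mt l (w \<circ> g) m = mt l g m" if "w \<in> young n r l" "g \<in> G" for w g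
    using mt_young[OF l m that(2,1) young_id[OF m]] by simp
  then show "left_inv l (dcs l d m)"
    using k by (simp add: left_inv_def lk_dcs l m d young_G G_comp)
  have "mt l (g \<circ> w) m = mt l g m" if "w \<in> young n r m" "g \<in> G" for w g
    using mt_young[OF l m that(2) young_id[OF l] that(1)] by simp
  then show "right_inv m (dcs l d m)"
    using k by (simp add: right_inv_def lk_dcs l m d young_G G_comp)
qed

section \<open>The affine Schur algebra\<close>

abbreviation "TS \<equiv> tensor_space n r"
abbreviation "S \<equiv> schur_alg n r"

lemma left_inv_0: "left_inv l 0" by (simp add: left_inv_def)

lemma left_inv_add: "left_inv l x \<Longrightarrow> left_inv l y \<Longrightarrow> left_inv l (x + y)"
  by (simp add: left_inv_def K_add lookup_add)

lemma left_inv_hscale: "left_inv l x \<Longrightarrow> left_inv l (hscale c x)"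
  by (simp add: left_inv_def K_hscale)

lemma left_inv_star: assumes l: "l \<in> \<Lambda>" and x: "left_inv l x" and h: "h \<in> K" shows "left_inv l (x \<star> h)"
proof -
  obtain h' where "x = X l \<star> h'" "h' \<in> K"
    using x x_ideal_iff[OF l, of x] by (auto simp: x_ideal_def hecke_ops)
  then show ?thesis using left_inv_X_star[OF l star_closed[OF _ h]] h by (simp add: star_assoc X_K)
qed

lemma TS_iff: "f \<in> TS \<longleftrightarrow> (\<forall>l\<in>\<Lambda>. left_inv l (f l)) \<and> (\<forall>l. l \<notin> \<Lambda> \<longrightarrow> f l = 0)"
  using x_ideal_iff by (auto simp: tensor_space_def)

lemma TS_K: "f \<in> TS \<Longrightarrow> f l \<in> K"
  by (cases "l \<in> \<Lambda>") (auto simp: TS_iff left_inv_def)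

lemma star_0 [simp]: "h \<in> K \<Longrightarrow> 0 \<star> h = 0" "h \<in> K \<Longrightarrow> h \<star> 0 = 0"
  using klin_0[OF klin_star_left, of h] klin_0[OF klin_star_right, of h] by auto

lemma TS_zero: "(\<lambda>l. 0) \<in> TS" by (simp add: TS_iff left_inv_0)

lemma TS_add: "f \<in> TS \<Longrightarrow> g \<in> TS \<Longrightarrow> tensor_add f g \<in> TS"
  by (simp add: TS_iff tensor_add_def left_inv_add)

lemma TS_scale: "f \<in> TS \<Longrightarrow> (\<lambda>l. hscale c (f l)) \<in> TS"
  by (simp add: TS_iff left_inv_hscale)

lemma TS_act: "f \<in> TS \<Longrightarrow> h \<in> K \<Longrightarrow> right_act r f h \<in> TS"
  by (simp add: TS_iff right_act_def left_inv_star)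

lemma TS_inj: "l \<in> \<Lambda> \<Longrightarrow> left_inv l x \<Longrightarrow> inj_comp l x \<in> TS"
  by (auto simp: TS_iff inj_comp_def left_inv_0)

lemma left_inv_X: "l \<in> \<Lambda> \<Longrightarrow> left_inv l (X l)"
  using left_inv_X_star[of l "T id"] by (simp add: T_K X_K)

lemma act_scale: "f \<in> TS \<Longrightarrow> right_act r f (hscale c (T id)) = (\<lambda>l. hscale c (f l))"
  by (auto simp: right_act_def star_hscale T_K TS_K)

lemma act_inj: "h \<in> K \<Longrightarrow> right_act r (inj_comp l x) h = inj_comp l (x \<star> h)"
  by (auto simp: right_act_def inj_comp_def)

lemma finite_Lambda: "finite \<Lambda>"
proof -
  have "inj_on (\<lambda>l. restrict l {1..int n}) \<Lambda>"
  proof (rule inj_onI, rule ext)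
    fix l m x assume l: "l \<in> \<Lambda>" and m: "m \<in> \<Lambda>" and e: "restrict l {1..int n} = restrict m {1..int n}"
    define y where "y = (x - 1) mod int n + 1"
    have "0 < int n" using n1 by simp
    from pos_mod_bound[OF this, of "x - 1"] pos_mod_sign[OF this, of "x - 1"]
    have "y \<in> {1..int n}" by (simp add: y_def)
    then have "l y = m y" using e by (metis restrict_apply')
    moreover have "x = y + (x - 1) div int n * int n"
      by (simp add: y_def minus_mult_div_eq_mod[symmetric] algebra_simps)
    ultimately show "l x = m x" using Lambda_period_mult[OF l] Lambda_period_mult[OF m] by metis
  qed
  moreover have "(\<lambda>l. restrict l {1..int n}) ` \<Lambda> \<subseteq> {1..int n} \<rightarrow>\<^sub>E {0..int r}"
  proof
    fix f assume "f \<in> (\<lambda>l. restrict l {1..int n}) ` \<Lambda>"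
    then obtain l where l: "l \<in> \<Lambda>" "f = restrict l {1..int n}" by blast
    have "l i \<le> int r" if "i \<in> {1..int n}" for i
      unfolding Lambda_sum[OF l(1), symmetric] using that Lambda_nonneg[OF l(1)] by (intro member_le_sum) auto
    then show "f \<in> {1..int n} \<rightarrow>\<^sub>E {0..int r}" using l Lambda_nonneg[OF l(1)] by auto
  qed
  ultimately show ?thesis using finite_PiE[of "{1..int n}" "\<lambda>_. {0..int r}"]
    by (meson finite_atLeastAtMost_int finite_imageD finite_subset)
qed

lemma TS_induct [consumes 1, case_names zero comp add]:
  assumes "f \<in> TS"
    and zero: "P (\<lambda>l. 0)"
    and comp: "\<And>k h. k \<in> \<Lambda> \<Longrightarrow> h \<in> K \<Longrightarrow> P (inj_comp k (X k \<star> h))"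
    and add: "\<And>f g. f \<in> TS \<Longrightarrow> g \<in> TS \<Longrightarrow> P f \<Longrightarrow> P g \<Longrightarrow> P (tensor_add f g)"
  shows "P f"
proof -
  have "\<forall>f\<in>TS. (\<forall>l. l \<notin> A \<longrightarrow> f l = 0) \<longrightarrow> P f" if "finite A" "A \<subseteq> \<Lambda>" for A
    using that
  proof (induction A rule: finite_induct)
    case empty
    have "f = (\<lambda>l. 0)" if "\<forall>l. l \<notin> {} \<longrightarrow> f l = 0" for f :: tensor
      using that by auto
    then show ?case using zero by metis
  next
    case (insert k A)
    show ?case
    proof (intro ballI impI)
      fix f assume f: "f \<in> TS" and supp: "\<forall>l. l \<notin> insert k A \<longrightarrow> f l = 0"
      have k: "k \<in> \<Lambda>" using insert by simp
      obtain h where h: "f k = X k \<star> h" "h \<in> K"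
        using f x_ideal_iff[OF k, of "f k"] k by (auto simp: x_ideal_def hecke_ops TS_iff)
      let ?g = "f(k := 0)"
      have g: "?g \<in> TS" using f by (auto simp: TS_iff left_inv_0)
      have "P ?g" using insert g supp by auto
      moreover have i: "inj_comp k (f k) \<in> TS" using f k by (intro TS_inj) (auto simp: TS_iff)
      moreover have "P (inj_comp k (f k))" unfolding h using k h by (intro comp)
      ultimately have "P (tensor_add (inj_comp k (f k)) ?g)" using g by (intro add)
      moreover have "tensor_add (inj_comp k (f k)) ?g = f"
        by (auto simp: tensor_add_def inj_comp_def)
      ultimately show "P f" by simp
    qed
  qed
  from this[OF finite_Lambda order_refl] show ?thesis using assms(1) by (auto simp: TS_iff)
qed

lemma S_iff: "p \<in> carrier S \<longleftrightarrow> p \<in> TS \<rightarrow>\<^sub>E TS \<and>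
    (\<forall>f\<in>TS. \<forall>g\<in>TS. p (tensor_add f g) = tensor_add (p f) (p g)) \<and>
    (\<forall>f\<in>TS. \<forall>h\<in>K. p (right_act r f h) = right_act r (p f) h)"
  by (simp add: schur_alg_def hecke_ops)

lemma S_ops:
  "p \<otimes>\<^bsub>S\<^esub> p' = compose TS p p'" "\<one>\<^bsub>S\<^esub> = (\<lambda>f\<in>TS. f)" "\<zero>\<^bsub>S\<^esub> = (\<lambda>f\<in>TS. (\<lambda>l. 0))"
  "p \<oplus>\<^bsub>S\<^esub> p' = (\<lambda>f\<in>TS. tensor_add (p f) (p' f))"
  by (simp_all add: schur_alg_def)

lemma S_TS: "p \<in> carrier S \<Longrightarrow> f \<in> TS \<Longrightarrow> p f \<in> TS"
  by (auto simp: S_iff)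

lemma S_add: "p \<in> carrier S \<Longrightarrow> f \<in> TS \<Longrightarrow> g \<in> TS \<Longrightarrow> p (tensor_add f g) = tensor_add (p f) (p g)"
  by (auto simp: S_iff)

lemma S_act: "p \<in> carrier S \<Longrightarrow> f \<in> TS \<Longrightarrow> h \<in> K \<Longrightarrow> p (right_act r f h) = right_act r (p f) h"
  by (auto simp: S_iff)

lemma S_scale: "p \<in> carrier S \<Longrightarrow> f \<in> TS \<Longrightarrow> p (\<lambda>l. hscale c (f l)) = (\<lambda>l. hscale c (p f l))"
  using S_act[of p f "hscale c (T id)"] by (simp add: K_hscale T_K act_scale S_TS)

lemma S_zero: assumes p: "p \<in> carrier S" shows "p (\<lambda>l. 0) = (\<lambda>l. 0)"
  using S_scale[OF p TS_zero, of 0] by simp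

lemma S_ext: "p \<in> carrier S \<Longrightarrow> p' \<in> carrier S \<Longrightarrow> (\<And>f. f \<in> TS \<Longrightarrow> p f = p' f) \<Longrightarrow> p = p'"
  by (rule PiE_ext[of _ TS "\<lambda>_. TS"]) (simp_all add: S_iff)

text \<open>The tensor space is generated by the symmetrizers as a right module.\<close>

lemma S_eqI:
  assumes p: "p \<in> carrier S" and p': "p' \<in> carrier S"
    and e: "\<And>k. k \<in> \<Lambda> \<Longrightarrow> p (inj_comp k (X k)) = p' (inj_comp k (X k))"
  shows "p = p'"
proof (rule S_ext[OF p p'])
  fix f assume "f \<in> TS"
  then show "p f = p' f"
  proof (induction rule: TS_induct)
    case zero
    then show ?case using p p' by (simp add: S_zero)
  next
    case (comp k h)
    have "inj_comp k (X k) \<in> TS" using comp by (simp add: TS_inj left_inv_X)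
    then show ?case using e[OF comp(1)] comp p p' S_act[of _ "inj_comp k (X k)" h] by (simp add: act_inj)
  next
    case (add f g)
    then show ?case using p p' by (simp add: S_add)
  qed
qed

lemma S_I:
  assumes "\<And>f. f \<in> TS \<Longrightarrow> F f \<in> TS"
    and "\<And>f g. f \<in> TS \<Longrightarrow> g \<in> TS \<Longrightarrow> F (tensor_add f g) = tensor_add (F f) (F g)"
    and "\<And>f h. f \<in> TS \<Longrightarrow> h \<in> K \<Longrightarrow> F (right_act r f h) = right_act r (F f) h"
  shows "(\<lambda>f\<in>TS. F f) \<in> carrier S"
  using assms by (auto simp: S_iff TS_add TS_act)

lemma tensor_add_apply: "tensor_add f g l = f l + g l" by (simp add: tensor_add_def)

lemma S_plus_closed: "p \<in> carrier S \<Longrightarrow> p' \<in> carrier S \<Longrightarrow> p \<oplus>\<^bsub>S\<^esub> p' \<in> carrier S"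
  unfolding S_ops
  by (rule S_I; simp add: S_TS TS_add S_add S_act TS_act)
    (auto simp: tensor_add_def right_act_def fun_eq_iff star_add_left TS_K S_TS algebra_simps)

lemma schur_scale_closed: "p \<in> carrier S \<Longrightarrow> schur_scale n r c p \<in> carrier S"
  unfolding schur_scale_def
  by (rule S_I; simp add: S_TS TS_scale S_add S_act TS_act)
    (auto simp: tensor_add_def right_act_def fun_eq_iff hscale_add star_hscale TS_K S_TS)

lemma schur_ring: "ring S"
proof (rule ringI)
  show "abelian_group S"
  proof (rule abelian_groupI)
    fix x y assume "x \<in> carrier S" "y \<in> carrier S"
    then show "x \<oplus>\<^bsub>S\<^esub> y \<in> carrier S" by (rule S_plus_closed)
  next
    show "\<zero>\<^bsub>S\<^esub> \<in> carrier S"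
      unfolding S_ops by (rule S_I) (auto simp: TS_zero tensor_add_def right_act_def)
  next
    fix x y z assume "x \<in> carrier S" "y \<in> carrier S" "z \<in> carrier S"
    then show "x \<oplus>\<^bsub>S\<^esub> y \<oplus>\<^bsub>S\<^esub> z = x \<oplus>\<^bsub>S\<^esub> (y \<oplus>\<^bsub>S\<^esub> z)"
      unfolding S_ops by (auto simp: tensor_add_def fun_eq_iff algebra_simps)
  next
    fix x y assume "x \<in> carrier S" "y \<in> carrier S"
    then show "x \<oplus>\<^bsub>S\<^esub> y = y \<oplus>\<^bsub>S\<^esub> x"
      unfolding S_ops by (auto simp: tensor_add_def fun_eq_iff algebra_simps)
  next
    fix x assume x: "x \<in> carrier S"
    then have "x \<in> extensional TS" by (simp add: S_iff PiE_iff)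
    then show "\<zero>\<^bsub>S\<^esub> \<oplus>\<^bsub>S\<^esub> x = x"
      unfolding S_ops by (auto simp: tensor_add_def fun_eq_iff extensional_def)
    have "schur_scale n r (- 1) x \<oplus>\<^bsub>S\<^esub> x = \<zero>\<^bsub>S\<^esub>"
      unfolding S_ops schur_scale_def by (auto simp: tensor_add_def fun_eq_iff hscale_uminus)
    then show "\<exists>y\<in>carrier S. y \<oplus>\<^bsub>S\<^esub> x = \<zero>\<^bsub>S\<^esub>" using schur_scale_closed[OF x] by blast
  qed
  show "monoid S"
  proof (rule monoidI)
    fix x y assume xy: "x \<in> carrier S" "y \<in> carrier S"
    then show "x \<otimes>\<^bsub>S\<^esub> y \<in> carrier S"
      unfolding S_ops compose_def by (intro S_I) (auto simp: S_TS S_add S_act)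
  next
    show "\<one>\<^bsub>S\<^esub> \<in> carrier S" unfolding S_ops by (rule S_I) auto
  next
    fix x y z assume "x \<in> carrier S" "y \<in> carrier S" "z \<in> carrier S"
    then show "x \<otimes>\<^bsub>S\<^esub> y \<otimes>\<^bsub>S\<^esub> z = x \<otimes>\<^bsub>S\<^esub> (y \<otimes>\<^bsub>S\<^esub> z)"
      unfolding S_ops by (auto simp: compose_def fun_eq_iff S_TS)
  next
    fix x assume x: "x \<in> carrier S"
    then have "x \<in> extensional TS" by (simp add: S_iff PiE_iff)
    then show "\<one>\<^bsub>S\<^esub> \<otimes>\<^bsub>S\<^esub> x = x" "x \<otimes>\<^bsub>S\<^esub> \<one>\<^bsub>S\<^esub> = x"
      unfolding S_ops using x by (auto simp: compose_def fun_eq_iff S_TS extensional_def)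
  qed
  fix x y z assume "x \<in> carrier S" "y \<in> carrier S" "z \<in> carrier S"
  then show "(x \<oplus>\<^bsub>S\<^esub> y) \<otimes>\<^bsub>S\<^esub> z = x \<otimes>\<^bsub>S\<^esub> z \<oplus>\<^bsub>S\<^esub> y \<otimes>\<^bsub>S\<^esub> z"
    "z \<otimes>\<^bsub>S\<^esub> (x \<oplus>\<^bsub>S\<^esub> y) = z \<otimes>\<^bsub>S\<^esub> x \<oplus>\<^bsub>S\<^esub> z \<otimes>\<^bsub>S\<^esub> y"
    unfolding S_ops by (auto simp: compose_def fun_eq_iff S_TS S_add)
qed

text \<open>The double coset sum is a left multiple of the symmetrizer \<open>X m\<close>, so left multiplication by the
  cofactor sends \<open>X m h\<close> to the double coset sum times \<open>h\<close>. This shows that the defining condition is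
  consistent, and linearity is immediate.\<close>

lemma phi_props:
  assumes l: "l \<in> \<Lambda>" and m: "m \<in> \<Lambda>" and d: "d \<in> G"
  shows "phi n r l d m \<in> carrier S"
    and "f \<in> TS \<Longrightarrow> phi n r l d m f = inj_comp l (cofactor m (dcs l d m) \<star> f m)"
proof -
  let ?D = "dcs l d m" let ?h = "cofactor m (dcs l d m)"
  have D: "left_inv l ?D" "right_inv m ?D" using dcs_inv[OF l m d] by auto
  have h: "?h \<in> K" using D by (intro cofactor_K) (simp add: left_inv_def)
  have hX: "?h \<star> X m = ?D" by (rule cofactor_star_X[OF m D(2)])
  let ?F = "\<lambda>f. inj_comp l (?h \<star> f m)" let ?p = "\<lambda>f\<in>TS. ?F f"
  have hx: "?h \<star> (X m \<star> h') = ?D \<star> h'" if "h' \<in> K" for h'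
    using star_assoc[OF h X_K[of m] that] by (simp add: hX)
  have F_TS: "?F f \<in> TS" if f: "f \<in> TS" for f
  proof -
    obtain h' where h': "f m = X m \<star> h'" "h' \<in> K"
      using f x_ideal_iff[OF m, of "f m"] m by (auto simp: x_ideal_def hecke_ops TS_iff)
    show ?thesis unfolding h'(1) hx[OF h'(2)] by (intro TS_inj l left_inv_star D h')
  qed
  have p: "?p \<in> carrier S"
  proof (rule S_I[OF F_TS])
    fix f g assume "f \<in> TS" "g \<in> TS"
    then show "?F (tensor_add f g) = tensor_add (?F f) (?F g)"
      using h by (auto simp: tensor_add_def inj_comp_def fun_eq_iff star_add_right TS_K)
  next
    fix f h' assume "f \<in> TS" "h' \<in> K"
    then show "?F (right_act r f h') = right_act r (?F f) h'"
      using h by (simp add: act_inj star_assoc TS_K) (simp add: right_act_def)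
  qed
  have val: "?p (inj_comp k (X k \<star> h')) = inj_comp l (if m = k then ?D \<star> h' else 0)"
    if "k \<in> \<Lambda>" "h' \<in> K" for k h'
    using TS_inj[OF that(1) left_inv_X_star[OF that]] hx[OF that(2)] h by (auto simp: inj_comp_def)
  have "phi n r l d m = ?p"
    unfolding phi_def hecke_ops
  proof (rule the_equality)
    show "?p \<in> carrier S \<and> (\<forall>k\<in>\<Lambda>. \<forall>h\<in>K. ?p (inj_comp k (X k \<star> h)) =
        inj_comp l (if m = k then ?D \<star> h else 0))" using p val by blast
  next
    fix p' assume p': "p' \<in> carrier S \<and> (\<forall>k\<in>\<Lambda>. \<forall>h\<in>K. p' (inj_comp k (X k \<star> h)) =
        inj_comp l (if m = k then ?D \<star> h else 0))"
    show "p' = ?p"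
    proof (rule S_eqI)
      fix k assume k: "k \<in> \<Lambda>"
      have i: "T id \<in> K" by (simp add: T_K)
      show "p' (inj_comp k (X k)) = ?p (inj_comp k (X k))"
        using p' k i val[OF k i] star_id(2)[OF X_K, of k] by metis
    qed (use p p' in auto)
  qed
  then show "phi n r l d m \<in> carrier S" "f \<in> TS \<Longrightarrow> phi n r l d m f = ?F f" using p by simp_all
qed

end

section \<open>The Schur algebra at \<open>v = 1\<close>\<close>

context affine_blocks
begin

abbreviation "\<delta> \<equiv> v_pow 1 - 1 :: laurent"
abbreviation "I \<equiv> v1_ideal n r"

text \<open>The coefficients, at \<open>v = 1\<close>, of the images of the symmetrizers. They embed the specialized Schur
  algebra into integer-valued functions.\<close>

definition chi :: "(tensor \<Rightarrow> tensor) \<Rightarrow> zseq \<Rightarrow> zseq \<Rightarrow> (int \<Rightarrow> int) \<Rightarrow> int" where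
  "chi p l m g = eps (lk (p (inj_comp m (X m)) l) g)"

lemma TS_X: "m \<in> \<Lambda> \<Longrightarrow> inj_comp m (X m) \<in> TS"
  by (simp add: TS_inj left_inv_X)

lemma right_act_apply: "right_act r f h l = f l \<star> h" by (simp add: right_act_def)

lemma chi_add: "m \<in> \<Lambda> \<Longrightarrow> chi (p \<oplus>\<^bsub>S\<^esub> p') l m g = chi p l m g + chi p' l m g"
  by (simp add: chi_def S_ops TS_X tensor_add_def lookup_add eps_add)

lemma chi_zero: "m \<in> \<Lambda> \<Longrightarrow> chi \<zero>\<^bsub>S\<^esub> l m g = 0"
  by (simp add: chi_def S_ops TS_X)

lemma chi_scale: "m \<in> \<Lambda> \<Longrightarrow> chi (schur_scale n r c p) l m g = eps c * chi p l m g"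
  by (simp add: chi_def schur_scale_def TS_X eps_mult)

interpretation schur: ring S by (rule schur_ring)

lemma chi_uminus:
  assumes p: "p \<in> carrier S" and m: "m \<in> \<Lambda>"
  shows "chi (\<ominus>\<^bsub>S\<^esub> p) l m g = - chi p l m g"
  using chi_add[OF m, of "\<ominus>\<^bsub>S\<^esub> p" p l g] p m by (simp add: schur.l_neg chi_zero)

lemma hscale_delta_inj: "hscale \<delta> x = hscale \<delta> y \<Longrightarrow> x = y"
proof (rule poly_mapping_eqI)
  fix w assume "hscale \<delta> x = hscale \<delta> y"
  then have "\<delta> * lk x w = \<delta> * lk y w" by (metis lk_hscale)
  then show "lk x w = lk y w" using v_minus_1_neq_0 by simp
qed

lemma hscale_delta_K: "hscale \<delta> x \<in> K \<Longrightarrow> x \<in> K"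
  using v_minus_1_neq_0 by (simp add: K_iff)

lemma hscale_delta_left_inv: "left_inv l (hscale \<delta> x) \<Longrightarrow> left_inv l x"
  using v_minus_1_neq_0 hscale_delta_K by (auto simp: left_inv_def)

lemma divisible_coeffs:
  assumes "\<And>w. \<delta> dvd lk y w"
  shows "\<exists>x. y = hscale \<delta> x"
proof -
  have "\<forall>w. \<exists>c. lk y w = \<delta> * c" using assms unfolding dvd_def by blast
  then have "\<exists>c. \<forall>w. lk y w = \<delta> * c w" by (rule choice)
  then obtain c where c': "\<forall>w. lk y w = \<delta> * c w" by (rule exE)
  have c: "lk y w = \<delta> * c w" for w using c' by (rule spec)
  have "y = (\<Sum>w\<in>Poly_Mapping.keys y. hscale (lk y w) (T w))" by (rule expand_T)
  also have "\<dots> = hscale \<delta> (\<Sum>w\<in>Poly_Mapping.keys y. hscale (c w) (T w))"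
    by (simp add: hscale_sum hscale_hscale c[symmetric])
  finally show ?thesis by blast
qed

text \<open>If all these coefficients vanish, the values of \<open>p\<close> are divisible by \<open>v - 1\<close>. The quotients lie in the
  right ideals again, as these are given by equations between coefficients, and form an endomorphism.\<close>

lemma v1_ideal_iff:
  assumes p: "p \<in> carrier S"
  shows "p \<in> I \<longleftrightarrow> (\<forall>l g. \<forall>m\<in>\<Lambda>. chi p l m g = 0)"
proof
  assume "p \<in> I"
  then obtain p' where "p = schur_scale n r \<delta> p'" by (auto simp: v1_ideal_def)
  then show "\<forall>l g. \<forall>m\<in>\<Lambda>. chi p l m g = 0" by (simp add: chi_scale eps_diff)
next
  assume z: "\<forall>l g. \<forall>m\<in>\<Lambda>. chi p l m g = 0"
  have div: "\<exists>x. p f l = hscale \<delta> x" if "f \<in> TS" for f l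
    using that
  proof (induction arbitrary: l rule: TS_induct)
    case zero
    have "(0 :: hecke) = hscale \<delta> 0" by simp
    then show ?case unfolding S_zero[OF p] by blast
  next
    case (comp k h)
    have "\<delta> dvd lk (p (inj_comp k (X k)) l) w" for w
      using z comp(1) by (simp add: chi_def eps_eq_0_iff)
    then obtain x where x: "p (inj_comp k (X k)) l = hscale \<delta> x" using divisible_coeffs by blast
    have xK: "x \<in> K" using TS_K[OF S_TS[OF p TS_X[OF comp(1)]], of l] x hscale_delta_K by simp
    have "p (inj_comp k (X k \<star> h)) l = p (inj_comp k (X k)) l \<star> h"
      using S_act[OF p TS_X[OF comp(1)] comp(2)] comp(2) by (simp add: act_inj) (simp add: right_act_def)
    then have "p (inj_comp k (X k \<star> h)) l = hscale \<delta> (x \<star> h)"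
      unfolding x using star_hscale(1)[OF xK comp(2)] by simp
    then show ?case by blast
  next
    case (add f g)
    obtain x y where "p f l = hscale \<delta> x" "p g l = hscale \<delta> y" using add(3,4) by metis
    then have "p (tensor_add f g) l = hscale \<delta> (x + y)"
      using add(1,2) by (simp only: S_add[OF p]) (simp add: tensor_add_def hscale_add)
    then show ?case by blast
  qed
  define F where "F = (\<lambda>f l. SOME x. p f l = hscale \<delta> x)"
  have F: "p f l = hscale \<delta> (F f l)" if "f \<in> TS" for f l
    unfolding F_def using someI_ex[OF div[OF that]] .
  have F_eq: "F f l = x" if "f \<in> TS" "p f l = hscale \<delta> x" for f l x
    using F[OF that(1), of l] that(2) hscale_delta_inj by simp
  have F_TS: "F f \<in> TS" if f: "f \<in> TS" for f
    unfolding TS_iff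
  proof (intro conjI ballI allI impI)
    fix l assume "l \<in> \<Lambda>"
    then have "left_inv l (p f l)" using S_TS[OF p f] by (simp add: TS_iff)
    then show "left_inv l (F f l)" unfolding F[OF f] by (rule hscale_delta_left_inv)
  next
    fix l assume "l \<notin> \<Lambda>"
    then have "p f l = hscale \<delta> 0" using S_TS[OF p f] by (simp add: TS_iff)
    then show "F f l = 0" by (rule F_eq[OF f])
  qed
  have "(\<lambda>f\<in>TS. F f) \<in> carrier S"
  proof (rule S_I[OF F_TS])
    fix f g assume f: "f \<in> TS" and g: "g \<in> TS"
    show "F (tensor_add f g) = tensor_add (F f) (F g)"
    proof (rule ext, rule F_eq[OF TS_add[OF f g]])
      fix l
      show "p (tensor_add f g) l = hscale \<delta> (tensor_add (F f) (F g) l)"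
        unfolding S_add[OF p f g] tensor_add_apply hscale_add F[OF f, of l] F[OF g, of l] ..
    qed
  next
    fix f h assume f: "f \<in> TS" and h: "h \<in> K"
    show "F (right_act r f h) = right_act r (F f) h"
    proof (rule ext, rule F_eq[OF TS_act[OF f h]])
      fix l
      show "p (right_act r f h) l = hscale \<delta> (right_act r (F f) h l)"
        unfolding S_act[OF p f h] right_act_apply F[OF f, of l]
        by (rule star_hscale(1)[OF TS_K[OF F_TS[OF f]] h])
    qed
  qed
  moreover have "p = schur_scale n r \<delta> (\<lambda>f\<in>TS. F f)"
    by (rule S_ext[OF p schur_scale_closed[OF calculation]]) (auto simp: schur_scale_def F[symmetric])
  ultimately show "p \<in> I" by (auto simp: v1_ideal_def)
qed

lemma v1_ideal_S: "p \<in> I \<Longrightarrow> p \<in> carrier S"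
  by (auto simp: v1_ideal_def schur_scale_closed)

lemma v1_ideal: "ideal I S"
proof (rule idealI[OF schur_ring])
  show "subgroup I (add_monoid S)"
  proof (rule group.subgroupI[OF schur.add.is_group])
    show "I \<subseteq> carrier (add_monoid S)" using v1_ideal_S by auto
    have "\<zero>\<^bsub>S\<^esub> \<in> I" using chi_zero by (simp add: v1_ideal_iff)
    then show "I \<noteq> {}" by blast
  next
    fix a assume a: "a \<in> I"
    then have "\<ominus>\<^bsub>S\<^esub> a \<in> I"
      using v1_ideal_S[OF a] by (simp add: v1_ideal_iff chi_uminus)
    then show "inv\<^bsub>add_monoid S\<^esub> a \<in> I" by (simp add: a_inv_def)
  next
    fix a b assume a: "a \<in> I" and b: "b \<in> I"
    then show "a \<otimes>\<^bsub>add_monoid S\<^esub> b \<in> I"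
      using v1_ideal_S[OF a] v1_ideal_S[OF b] by (simp add: v1_ideal_iff chi_add)
  qed
next
  fix a x assume a: "a \<in> I" and x: "x \<in> carrier S"
  then obtain p where p: "p \<in> carrier S" "a = schur_scale n r \<delta> p" by (auto simp: v1_ideal_def)
  have "x \<otimes>\<^bsub>S\<^esub> a = schur_scale n r \<delta> (x \<otimes>\<^bsub>S\<^esub> p)"
    unfolding p(2) S_ops schur_scale_def using p x
    by (auto simp: compose_def fun_eq_iff S_scale S_TS)
  then show "x \<otimes>\<^bsub>S\<^esub> a \<in> I" using p x by (auto simp: v1_ideal_def)
  have "a \<otimes>\<^bsub>S\<^esub> x = schur_scale n r \<delta> (p \<otimes>\<^bsub>S\<^esub> x)"
    unfolding p(2) S_ops schur_scale_def using p x
    by (auto simp: compose_def fun_eq_iff S_TS)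
  then show "a \<otimes>\<^bsub>S\<^esub> x \<in> I" using p x by (auto simp: v1_ideal_def)
qed

abbreviation "Q \<equiv> schur_alg_Z n r"

abbreviation cs :: "(tensor \<Rightarrow> tensor) \<Rightarrow> (tensor \<Rightarrow> tensor) set" where
  "cs p \<equiv> I +>\<^bsub>S\<^esub> p"

lemma Q_ring: "ring Q"
  unfolding schur_alg_Z_def by (rule ideal.quotient_is_ring[OF v1_ideal])

interpretation quot: ring Q by (rule Q_ring)

lemma cs_hom: "cs \<in> ring_hom S Q"
  unfolding schur_alg_Z_def by (rule ideal.rcos_ring_hom[OF v1_ideal])

lemma cs_closed: "p \<in> carrier S \<Longrightarrow> cs p \<in> carrier Q"
  using ring_hom_closed[OF cs_hom] .

lemma cs_zero: "cs \<zero>\<^bsub>S\<^esub> = \<zero>\<^bsub>Q\<^esub>"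
  using ring_hom_zero[OF cs_hom schur_ring Q_ring] .

lemma cs_add: "p \<in> carrier S \<Longrightarrow> p' \<in> carrier S \<Longrightarrow> cs (p \<oplus>\<^bsub>S\<^esub> p') = cs p \<oplus>\<^bsub>Q\<^esub> cs p'"
  using ring_hom_add[OF cs_hom] .

lemma cs_mult: "p \<in> carrier S \<Longrightarrow> p' \<in> carrier S \<Longrightarrow> cs (p \<otimes>\<^bsub>S\<^esub> p') = cs p \<otimes>\<^bsub>Q\<^esub> cs p'"
  using ring_hom_mult[OF cs_hom] .

lemma cs_uminus: assumes p: "p \<in> carrier S" shows "cs (\<ominus>\<^bsub>S\<^esub> p) = \<ominus>\<^bsub>Q\<^esub> cs p"
proof -
  have "cs (\<ominus>\<^bsub>S\<^esub> p) \<oplus>\<^bsub>Q\<^esub> cs p = \<zero>\<^bsub>Q\<^esub>"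
    using p cs_add[of "\<ominus>\<^bsub>S\<^esub> p" p] by (simp add: schur.l_neg cs_zero)
  then show ?thesis using p by (intro quot.minus_equality[symmetric]) (simp_all add: cs_closed)
qed

lemma cs_eq_iff:
  assumes p: "p \<in> carrier S" and p': "p' \<in> carrier S"
  shows "cs p = cs p' \<longleftrightarrow> (\<forall>l g. \<forall>m\<in>\<Lambda>. chi p l m g = chi p' l m g)"
proof -
  have sub: "abelian_subgroup I S"
    by (rule abelian_subgroupI3[OF ideal.axioms(1)[OF v1_ideal] schur.is_abelian_group])
  have mem: "p \<in> cs p' \<longleftrightarrow> p \<ominus>\<^bsub>S\<^esub> p' \<in> I"
    by (rule abelian_subgroup.a_rcos_module_minus[OF sub schur_ring p' p])
  have "cs p = cs p' \<longleftrightarrow> p \<ominus>\<^bsub>S\<^esub> p' \<in> I"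
  proof
    assume "cs p = cs p'"
    then show "p \<ominus>\<^bsub>S\<^esub> p' \<in> I" using abelian_subgroup.a_rcos_self[OF sub p] mem by simp
  next
    assume "p \<ominus>\<^bsub>S\<^esub> p' \<in> I"
    then have "p \<in> cs p'" using mem by simp
    then show "cs p = cs p'"
      using schur.a_repr_independence[OF _ p' additive_subgroup.a_subgroup[OF ideal.axioms(1)[OF v1_ideal]]]
      by simp
  qed
  also have "\<dots> \<longleftrightarrow> (\<forall>l g. \<forall>m\<in>\<Lambda>. chi p l m g = chi p' l m g)"
    using p p' by (simp add: v1_ideal_iff a_minus_def chi_add chi_uminus)
  finally show ?thesis .
qed

lemma cs_add_pow:
  assumes p: "p \<in> carrier S"
  shows "\<exists>p'\<in>carrier S. [k] \<cdot>\<^bsub>Q\<^esub> cs p = cs p' \<and> (\<forall>l g. \<forall>m\<in>\<Lambda>. chi p' l m g = (k :: int) * chi p l m g)"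
proof -
  have nat: "\<exists>p'\<in>carrier S. [j] \<cdot>\<^bsub>Q\<^esub> cs p = cs p' \<and> (\<forall>l g. \<forall>m\<in>\<Lambda>. chi p' l m g = int j * chi p l m g)"
    for j :: nat
  proof (induction j)
    case 0
    show ?case by (rule bexI[of _ "\<zero>\<^bsub>S\<^esub>"]) (simp_all add: cs_zero chi_zero)
  next
    case (Suc j)
    then obtain p' where "p' \<in> carrier S" "[j] \<cdot>\<^bsub>Q\<^esub> cs p = cs p'"
      "\<forall>l g. \<forall>m\<in>\<Lambda>. chi p' l m g = int j * chi p l m g" by blast
    then show ?case using p
      by (intro bexI[of _ "p' \<oplus>\<^bsub>S\<^esub> p"]) (simp_all add: cs_add chi_add algebra_simps)
  qed
  show ?thesis
  proof (cases "0 \<le> k")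
    case True
    then show ?thesis using nat[of "nat k"] by (simp add: add_pow_int_ge)
  next
    case False
    then obtain p' where "p' \<in> carrier S" "[nat (- k)] \<cdot>\<^bsub>Q\<^esub> cs p = cs p'"
      "\<forall>l g. \<forall>m\<in>\<Lambda>. chi p' l m g = int (nat (- k)) * chi p l m g" using nat[of "nat (- k)"] by blast
    then show ?thesis using False
      by (intro bexI[of _ "\<ominus>\<^bsub>S\<^esub> p'"]) (simp_all add: add_pow_int_lt cs_uminus chi_uminus)
  qed
qed

lemma cs_combination:
  assumes "finite J" and b: "\<And>i. i \<in> J \<Longrightarrow> b i \<in> carrier S"
  shows "\<exists>p\<in>carrier S. (\<Oplus>\<^bsub>Q\<^esub>i\<in>J. [k i] \<cdot>\<^bsub>Q\<^esub> cs (b i)) = cs p \<and>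
    (\<forall>l g. \<forall>m\<in>\<Lambda>. chi p l m g = (\<Sum>i\<in>J. (k i :: int) * chi (b i) l m g))"
  using assms
proof (induction J rule: finite_induct)
  case empty
  show ?case by (rule bexI[of _ "\<zero>\<^bsub>S\<^esub>"]) (simp_all add: cs_zero chi_zero)
next
  case (insert a J)
  obtain p where p: "p \<in> carrier S" "(\<Oplus>\<^bsub>Q\<^esub>i\<in>J. [k i] \<cdot>\<^bsub>Q\<^esub> cs (b i)) = cs p"
    "\<forall>l g. \<forall>m\<in>\<Lambda>. chi p l m g = (\<Sum>i\<in>J. k i * chi (b i) l m g)"
    using insert by auto
  obtain p' where p': "p' \<in> carrier S" "[k a] \<cdot>\<^bsub>Q\<^esub> cs (b a) = cs p'"
    "\<forall>l g. \<forall>m\<in>\<Lambda>. chi p' l m g = k a * chi (b a) l m g"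
    using cs_add_pow[of "b a" "k a"] insert.prems by auto
  have cl: "[k i] \<cdot>\<^bsub>Q\<^esub> cs (b i) \<in> carrier Q" if "i \<in> insert a J" for i
    using cs_add_pow[of "b i" "k i"] insert.prems[OF that] cs_closed by metis
  have "(\<Oplus>\<^bsub>Q\<^esub>i\<in>insert a J. [k i] \<cdot>\<^bsub>Q\<^esub> cs (b i)) = cs p' \<oplus>\<^bsub>Q\<^esub> cs p"
    unfolding p(2)[symmetric] p'(2)[symmetric] using insert.hyps cl by (intro quot.finsum_insert) auto
  then show ?case using p p' insert.hyps
    by (intro bexI[of _ "p' \<oplus>\<^bsub>S\<^esub> p"]) (simp_all add: cs_add chi_add)
qed

lemma e_basis_S: assumes A: "A \<in> Theta_aff_r n r" shows "e_basis n r A \<in> carrier S"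
proof (rule e_basis_eq[OF A])
  fix d assume "d \<in> dist_double_reps n r (ro A) (co A)" "e_basis n r A = phi n r (ro A) d (co A)"
  then show ?thesis using phi_props(1)[OF ro_Lambda[OF A] co_Lambda[OF A]] by (auto simp: double_reps_iff dist_iff ro_Lambda[OF A])
qed

text \<open>The power of \<open>v\<close> in the definition of the bracket specializes to \<open>1\<close>.\<close>

lemma bracket1_eq: "A \<in> Theta_aff_r n r \<Longrightarrow> bracket1 n r A = cs (e_basis n r A)"
  using e_basis_S[of A] schur_scale_closed[OF e_basis_S, of A "v_pow (- d_exp n A)"]
  by (simp add: bracket1_def bracket_def cs_eq_iff chi_scale)

text \<open>The basis element of a matrix acts, at \<open>v = 1\<close>, through the indicator function of the double
  coset that the matrix describes.\<close>

lemma chi_e_basis: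
  assumes A: "A \<in> Theta_aff_r n r" and m: "m \<in> \<Lambda>"
  shows "chi (e_basis n r A) l m g = (if l = ro A \<and> m = co A \<and> g \<in> G \<and> mt l g m = A then 1 else 0)"
proof -
  have l0: "ro A \<in> \<Lambda>" and m0: "co A \<in> \<Lambda>" using ro_Lambda co_Lambda A by auto
  obtain d where d: "d \<in> dist_double_reps n r (ro A) (co A)" "mt (ro A) d (co A) = A"
    "e_basis n r A = phi n r (ro A) d (co A)" using e_basis_eq[OF A] by blast
  have dG: "d \<in> G" using d(1) double_reps_iff dist_G by blast
  have D: "right_inv (co A) (dcs (ro A) d (co A))" by (rule dcs_inv(2)[OF l0 m0 dG])
  have cK: "cofactor (co A) (dcs (ro A) d (co A)) \<in> K"
    using D by (intro cofactor_K) (simp add: right_inv_def)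
  have "e_basis n r A (inj_comp m (X m)) = inj_comp (ro A) (if m = co A then dcs (ro A) d (co A) else 0)"
    unfolding d(3) phi_props(2)[OF l0 m0 dG TS_X[OF m]]
    using cofactor_star_X[OF m0 D] cK by (cases "m = co A") (auto simp: inj_comp_def)
  then show ?thesis by (simp add: chi_def inj_comp_def lk_dcs l0 m0 dG d(2))
qed

section \<open>Structure constants count periodic colourings\<close>

text \<open>The joint distributions with two given colourings \<open>F\<close> and \<open>F'\<close> are prescribed.\<close>

definition colourings :: "(int \<Rightarrow> int) \<Rightarrow> (int \<Rightarrow> int) \<Rightarrow> zmat \<Rightarrow> zmat \<Rightarrow> (int \<Rightarrow> int) set" where
  "colourings F F' B A = {f. (\<forall>x. f (x + int r) = f x + int n) \<and>
     (\<forall>i c. int (card {x. F x = i \<and> f x = c}) = B i c) \<and>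
     (\<forall>c j. int (card {x. f x = c \<and> F' x = j}) = A c j)}"

text \<open>Cosets of the middle Young subgroup correspond to colourings; the representatives \<open>b\<close> that occur in
  the cofactor are the ones with distinguished inverse, one for each coset.\<close>

lemma colourings_bij:
  assumes A: "A \<in> Theta_aff_r n r" and B: "B \<in> Theta_aff_r n r" and co: "co B = ro A"
    and g: "g \<in> G"
  shows "bij_betw (\<lambda>b x. blk (ro A) (ginv b x))
    {b \<in> G. ginv b \<in> dist_reps n r (ro A) \<and> mt (ro B) b (ro A) = B \<and> mt (ro A) (ginv b \<circ> g) (co A) = A}
    (colourings (blk (ro B)) (\<lambda>x. blk (co A) (ginv g x)) B A)"
proof -
  let ?k = "ro A" let ?l = "ro B" let ?m = "co A"
  have k: "?k \<in> \<Lambda>" and l: "?l \<in> \<Lambda>" and m: "?m \<in> \<Lambda>" using ro_Lambda co_Lambda A B by auto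
  have mtB: "mt ?l b ?k = B \<longleftrightarrow> (\<forall>i c. int (card {x. blk ?l x = i \<and> blk ?k (ginv b x) = c}) = B i c)"
    if b: "b \<in> G" for b
    by (simp add: fun_eq_iff mt_eq l k b)
  have mtA: "mt ?k (ginv b \<circ> g) ?m = A \<longleftrightarrow>
      (\<forall>c j. int (card {x. blk ?k (ginv b x) = c \<and> blk ?m (ginv g x) = j}) = A c j)"
    if b: "b \<in> G" for b
  proof -
    have "{x. blk ?k (ginv b x) = c \<and> blk ?m (ginv g x) = j} =
        b ` {x. blk ?k x = c \<and> blk ?m (ginv (ginv b \<circ> g) x) = j}" for c j
      using b g by (auto simp: G_inv_of_comp G_inv intro: image_eqI[of _ b "ginv b _"])
    then show ?thesis using b g
      by (simp add: fun_eq_iff mt_eq k m G_comp G_inv card_image inj_on_def G_eq_iff)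
  qed
  show ?thesis
  proof (rule bij_betw_imageI)
    show "inj_on (\<lambda>b x. blk ?k (ginv b x))
      {b \<in> G. ginv b \<in> dist_reps n r ?k \<and> mt ?l b ?k = B \<and> mt ?k (ginv b \<circ> g) ?m = A}"
    proof (rule inj_onI)
      fix b b' assume b: "b \<in> {b \<in> G. ginv b \<in> dist_reps n r ?k \<and> mt ?l b ?k = B \<and> mt ?k (ginv b \<circ> g) ?m = A}"
        and b': "b' \<in> {b \<in> G. ginv b \<in> dist_reps n r ?k \<and> mt ?l b ?k = B \<and> mt ?k (ginv b \<circ> g) ?m = A}"
        and e: "(\<lambda>x. blk ?k (ginv b x)) = (\<lambda>x. blk ?k (ginv b' x))"
      have G: "b \<in> G" "b' \<in> G" using b b' by auto
      let ?w = "ginv b \<circ> b'"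
      have "blk ?k (ginv b (b' x)) = blk ?k x" for x using fun_cong[OF e, of "b' x"] G by simp
      then have w: "?w \<in> young n r ?k" using G by (simp add: young_iff[OF k] G_comp G_inv)
      have "?w \<circ> ginv b' = ginv b" using G by (simp add: comp_assoc)
      then have "?w = id" using dist_rep_unique[OF k _ _ w, of "ginv b'"] b b' by simp
      then have "b \<circ> ?w = b" by simp
      then show "b = b'" using G by (simp add: comp_assoc[symmetric])
    qed
    show "(\<lambda>b x. blk ?k (ginv b x)) `
        {b \<in> G. ginv b \<in> dist_reps n r ?k \<and> mt ?l b ?k = B \<and> mt ?k (ginv b \<circ> g) ?m = A} =
      colourings (blk ?l) (\<lambda>x. blk ?m (ginv g x)) B A"
    proof (intro equalityI subsetI)
      fix f assume "f \<in> (\<lambda>b x. blk ?k (ginv b x)) `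
        {b \<in> G. ginv b \<in> dist_reps n r ?k \<and> mt ?l b ?k = B \<and> mt ?k (ginv b \<circ> g) ?m = A}"
      then obtain b where "b \<in> G" "mt ?l b ?k = B" "mt ?k (ginv b \<circ> g) ?m = A" "f = (\<lambda>x. blk ?k (ginv b x))"
        by auto
      then show "f \<in> colourings (blk ?l) (\<lambda>x. blk ?m (ginv g x)) B A"
        using blk_ginv_shift[OF k, of b _ 1] mtB mtA by (simp add: colourings_def)
    next
      fix f assume "f \<in> colourings (blk ?l) (\<lambda>x. blk ?m (ginv g x)) B A"
      then have f: "\<And>x. f (x + int r) = f x + int n"
        "\<And>i c. int (card {x. blk ?l x = i \<and> f x = c}) = B i c"
        "\<And>c j. int (card {x. f x = c \<and> blk ?m (ginv g x) = j}) = A c j"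
        by (auto simp: colourings_def)
      have "finite {x. blk ?l x = i \<and> f x = c}" for i c
        by (rule finite_subset[OF _ finite_blk[OF l, of i]]) auto
      note fc = finite_column_colouring[OF Theta_M[OF B] this f(2)]
      obtain h where h: "h \<in> G" "\<And>x. blk ?k (ginv h x) = f x"
        using colouring_translate[OF k f(1) fc(1)] fc(2) co by metis
      obtain d u where du: "d \<in> dist_reps n r ?k" "u \<in> young n r ?k" "ginv h = u \<circ> d"
        using dist_rep_ex[OF k G_inv[OF h(1)]] by blast
      have dG: "d \<in> G" using du(1) by (rule dist_G)
      have fd: "f = (\<lambda>x. blk ?k (ginv (ginv d) x))"
        using h(2) du(3) young_blk[OF k du(2)] dG by auto
      have "ginv d \<in> {b \<in> G. ginv b \<in> dist_reps n r ?k \<and> mt ?l b ?k = B \<and> mt ?k (ginv b \<circ> g) ?m = A}"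
        using dG du(1) f(2,3) mtB[OF G_inv[OF dG]] mtA[OF G_inv[OF dG]] unfolding fd by (simp add: G_inv)
      then show "f \<in> (\<lambda>b x. blk ?k (ginv b x)) `
        {b \<in> G. ginv b \<in> dist_reps n r ?k \<and> mt ?l b ?k = B \<and> mt ?k (ginv b \<circ> g) ?m = A}"
        using fd by blast
    qed
  qed
qed

text \<open>The product is a convolution over the group in which the first factor is replaced by its cofactor,
  that is, by a sum over coset representatives.\<close>

lemma chi_product:
  assumes A: "A \<in> Theta_aff_r n r" and B: "B \<in> Theta_aff_r n r" and co: "co B = ro A" and m: "m \<in> \<Lambda>"
  shows "chi (e_basis n r B \<otimes>\<^bsub>S\<^esub> e_basis n r A) l m g =
    (if l = ro B \<and> m = co A \<and> g \<in> G
     then int (card (colourings (blk l) (\<lambda>x. blk m (ginv g x)) B A)) else 0)"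
proof -
  let ?k = "ro A" let ?l = "ro B" let ?m = "co A"
  have k: "?k \<in> \<Lambda>" and l: "?l \<in> \<Lambda>" and m0: "?m \<in> \<Lambda>" using ro_Lambda co_Lambda A B by auto
  obtain d where d: "d \<in> dist_double_reps n r ?k ?m" "mt ?k d ?m = A" "e_basis n r A = phi n r ?k d ?m"
    using e_basis_eq[OF A] by blast
  obtain d' where d': "d' \<in> dist_double_reps n r ?l ?k" "mt ?l d' ?k = B" "e_basis n r B = phi n r ?l d' ?k"
    using e_basis_eq[OF B] unfolding co by blast
  have dG: "d \<in> G" "d' \<in> G" using d(1) d'(1) double_reps_iff dist_G by blast+
  let ?DA = "dcs ?k d ?m" let ?DB = "dcs ?l d' ?k"
  let ?cA = "cofactor ?m ?DA" let ?cB = "cofactor ?k ?DB"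
  have D: "right_inv ?m ?DA" "right_inv ?k ?DB" using dcs_inv(2)[OF k m0 dG(1)] dcs_inv(2)[OF l k dG(2)] by auto
  then have K: "?DA \<in> K" "?DB \<in> K" by (auto simp: right_inv_def)
  then have cK: "?cA \<in> K" "?cB \<in> K" using cofactor_K by auto
  have eA: "e_basis n r A (inj_comp m (X m)) = inj_comp ?k (if m = ?m then ?DA else 0)"
    unfolding d(3) phi_props(2)[OF k m0 dG(1) TS_X[OF m]]
    using cofactor_star_X[OF m0 D(1)] cK by (cases "m = co A") (auto simp: inj_comp_def)
  have "inj_comp ?k (if m = ?m then ?DA else 0) \<in> TS"
    using S_TS[OF e_basis_S[OF A] TS_X[OF m]] by (simp add: eA)
  from phi_props(2)[OF l k dG(2) this]
  have "(e_basis n r B \<otimes>\<^bsub>S\<^esub> e_basis n r A) (inj_comp m (X m)) = inj_comp ?l (?cB \<star> (if m = ?m then ?DA else 0))"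
    unfolding S_ops compose_eq[OF TS_X[OF m]] eA d'(3) by (simp add: inj_comp_def)
  then have 1: "chi (e_basis n r B \<otimes>\<^bsub>S\<^esub> e_basis n r A) l m g =
      (if l = ?l \<and> m = ?m then eps (lk (?cB \<star> ?DA) g) else 0)"
    using cK by (simp add: chi_def inj_comp_def)
  have "eps (lk (?cB \<star> ?DA) g) = int (card (colourings (blk ?l) (\<lambda>x. blk ?m (ginv g x)) B A))" if g: "g \<in> G"
  proof -
    let ?P = "{b \<in> G. ginv b \<in> dist_reps n r ?k \<and> mt ?l b ?k = B \<and> mt ?k (ginv b \<circ> g) ?m = A}"
    have cB: "lk ?cB b = (if b \<in> G \<and> ginv b \<in> dist_reps n r ?k \<and> mt ?l b ?k = B then 1 else 0)" for b
      by (auto simp: lk_cofactor lk_dcs l k dG d'(2))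
    have "eps (lk (?cB \<star> ?DA) g) = (\<Sum>b\<in>Poly_Mapping.keys ?cB. eps (lk ?cB b) * eps (lk ?DA (ginv b \<circ> g)))"
      by (rule eps_star[OF cK(2) K(1)])
    also have "\<dots> = (\<Sum>b\<in>Poly_Mapping.keys ?cB. if b \<in> ?P then 1 else 0)"
      using g by (intro sum.cong) (auto simp: cB lk_dcs k m0 dG d(2) G_comp G_inv)
    also have "\<dots> = int (card (Poly_Mapping.keys ?cB \<inter> ?P))"
      by (subst sum.inter_restrict[symmetric]) simp_all
    also have "Poly_Mapping.keys ?cB \<inter> ?P = ?P" by (auto simp: in_keys_iff cB)
    also have "card ?P = card (colourings (blk ?l) (\<lambda>x. blk ?m (ginv g x)) B A)"
      by (rule bij_betw_same_card[OF colourings_bij[OF A B co g]])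
    finally show ?thesis .
  qed
  moreover have "eps (lk (?cB \<star> ?DA) g) = 0" if "g \<notin> G"
    using that star_closed[OF cK(2) K(1)] by (simp add: K_iff)
  ultimately show ?thesis using 1 by auto
qed

end

section \<open>Functions with prescribed fibre sizes\<close>

definition funs :: "int set \<Rightarrow> (int \<Rightarrow> int) \<Rightarrow> (int \<Rightarrow> int) set" where
  "funs D t = {f \<in> D \<rightarrow>\<^sub>E UNIV. \<forall>c. int (card {x \<in> D. f x = c}) = t c}"

text \<open>A multinomial coefficient, as the cardinality of the set that it counts.\<close>

definition cnt :: "nat \<Rightarrow> (int \<Rightarrow> int) \<Rightarrow> nat" where
  "cnt k t = card (funs {0..<int k} t)"

lemma finite_funs: assumes D: "finite D" shows "finite (funs D t)"
proof (cases "funs D t = {}")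
  case False
  have img: "f ` D = {c. t c \<noteq> 0}" if "f \<in> funs D t" for f
  proof -
    have e: "t c = int (card {x \<in> D. f x = c})" for c using that by (simp add: funs_def)
    show ?thesis unfolding e using D by auto
  qed
  obtain f where "f \<in> funs D t" using False by blast
  then have "finite {c. t c \<noteq> 0}" using img[of f] D by (metis finite_imageI)
  moreover have "funs D t \<subseteq> D \<rightarrow>\<^sub>E {c. t c \<noteq> 0}"
  proof
    fix f assume f: "f \<in> funs D t"
    then have "f \<in> D \<rightarrow>\<^sub>E UNIV" by (simp add: funs_def)
    then show "f \<in> D \<rightarrow>\<^sub>E {c. t c \<noteq> 0}" using img[OF f] by (auto simp: PiE_iff)
  qed
  ultimately show ?thesis using finite_PiE[OF D, of "\<lambda>_. {c. t c \<noteq> 0}"] finite_subset by blast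
qed simp

lemma card_funs_le:
  assumes h: "bij_betw h D' D" and D': "finite D'"
  shows "card (funs D t) \<le> card (funs D' t)"
proof (rule card_inj_on_le[OF _ _ finite_funs[OF D']])
  have hD: "h ` D' = D" and inj: "inj_on h D'" using h by (auto simp: bij_betw_def)
  show "inj_on (\<lambda>f. restrict (f \<circ> h) D') (funs D t)"
  proof (rule inj_onI)
    fix f f' assume f: "f \<in> funs D t" and f': "f' \<in> funs D t"
      and e: "restrict (f \<circ> h) D' = restrict (f' \<circ> h) D'"
    have fP: "f \<in> D \<rightarrow>\<^sub>E UNIV" "f' \<in> D \<rightarrow>\<^sub>E UNIV" using f f' by (auto simp: funs_def)
    show "f = f'"
    proof (rule PiE_ext[OF fP])
      fix y assume "y \<in> D"
      then obtain x where x: "x \<in> D'" "y = h x" using hD by blast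
      then show "f y = f' y" using fun_cong[OF e, of x] by simp
    qed
  qed
  show "(\<lambda>f. restrict (f \<circ> h) D') ` funs D t \<subseteq> funs D' t"
  proof
    fix f' assume "f' \<in> (\<lambda>f. restrict (f \<circ> h) D') ` funs D t"
    then obtain f where f: "f \<in> funs D t" "f' = restrict (f \<circ> h) D'" by blast
    have "card {x \<in> D'. f' x = c} = card {y \<in> D. f y = c}" for c
    proof -
      have "{y \<in> D. f y = c} = h ` {x \<in> D'. f' x = c}" using hD by (auto simp: f(2))
      moreover have "inj_on h {x \<in> D'. f' x = c}" using inj by (rule inj_on_subset) auto
      ultimately show ?thesis by (simp add: card_image)
    qed
    then show "f' \<in> funs D' t" using f by (simp add: funs_def)
  qed
qed

lemma card_funs:
  assumes D: "finite D"
  shows "card (funs D t) = cnt (card D) t"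
proof -
  obtain h where h: "bij_betw h {0..<int (card D)} D"
    using finite_same_card_bij[of "{0..<int (card D)}" D] D by auto
  show ?thesis unfolding cnt_def
    using card_funs_le[OF h] card_funs_le[OF bij_betw_inv_into[OF h] D] by (simp add: order_antisym)
qed

text \<open>Splitting off the fibre over one colour: choose the complement of that fibre, and colour it
  with the remaining colours.\<close>

lemma card_funs_split:
  assumes D: "finite D" and t0: "0 \<le> t a" "t a \<le> int (card D)"
  shows "card (funs D t) = (card D choose nat (int (card D) - t a)) * cnt (nat (int (card D) - t a)) (t(a := 0))"
proof -
  let ?s = "nat (int (card D) - t a)" let ?t = "t(a := 0)"
  let ?E = "{E. E \<subseteq> D \<and> card E = ?s}"
  let ?F = "\<lambda>f. ({x \<in> D. f x \<noteq> a}, restrict f {x \<in> D. f x \<noteq> a})"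
  let ?H = "\<lambda>(E, f). \<lambda>x\<in>D. if x \<in> E then f x else a"
  have "bij_betw ?F (funs D t) (Sigma ?E (\<lambda>E. funs E ?t))"
  proof (rule bij_betw_byWitness[where f' = ?H])
    show "\<forall>f\<in>funs D t. ?H (?F f) = f"
      by (auto simp: funs_def fun_eq_iff PiE_iff extensional_def)
    have noa: "f x \<noteq> a" if "E \<subseteq> D" "f \<in> funs E ?t" "x \<in> E" for E f x
    proof
      assume "f x = a"
      then have "x \<in> {x \<in> E. f x = a}" using that by simp
      moreover have "\<forall>c. int (card {x \<in> E. f x = c}) = ?t c" using that(2) by (simp add: funs_def)
      then have "int (card {x \<in> E. f x = a}) = ?t a" by (rule spec)
      then have "card {x \<in> E. f x = a} = 0" by simp
      moreover have "finite {x \<in> E. f x = a}" using that(1) D finite_subset by fastforce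
      ultimately show False by auto
    qed
    show "\<forall>p\<in>Sigma ?E (\<lambda>E. funs E ?t). ?F (?H p) = p"
    proof
      fix p assume "p \<in> Sigma ?E (\<lambda>E. funs E ?t)"
      then obtain E f where p: "p = (E, f)" "E \<subseteq> D" "f \<in> funs E ?t" by auto
      have e: "{x \<in> D. ?H p x \<noteq> a} = E" using noa[OF p(2,3)] p(2) by (auto simp: p(1))
      have "restrict (?H p) E = f"
        using p(2,3) by (auto simp: p(1) fun_eq_iff funs_def PiE_iff extensional_def)
      then show "?F (?H p) = p" using e by (simp add: p(1))
    qed
    show "?F ` funs D t \<subseteq> Sigma ?E (\<lambda>E. funs E ?t)"
    proof
      fix p assume "p \<in> ?F ` funs D t"
      then obtain f where f: "f \<in> funs D t" "p = ?F f" by blast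
      let ?Ea = "{x \<in> D. f x \<noteq> a}"
      have "?Ea = D - {x \<in> D. f x = a}" by auto
      then have "card ?Ea = card D - card {x \<in> D. f x = a}"
        using D by (simp add: card_Diff_subset)
      moreover have "int (card {x \<in> D. f x = a}) = t a" using f(1) by (simp add: funs_def)
      ultimately have "card ?Ea = ?s" by linarith
      moreover have "int (card {x \<in> ?Ea. restrict f ?Ea x = c}) = ?t c" for c
      proof (cases "c = a")
        case True
        then have "{x \<in> ?Ea. restrict f ?Ea x = c} = {}" by auto
        then have "card {x \<in> ?Ea. restrict f ?Ea x = c} = 0" by (simp only: card.empty)
        then show ?thesis using True by simp
      next
        case False
        then have "{x \<in> ?Ea. restrict f ?Ea x = c} = {x \<in> D. f x = c}" by auto
        then show ?thesis using False f(1) by (simp add: funs_def)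
      qed
      ultimately show "p \<in> Sigma ?E (\<lambda>E. funs E ?t)" by (auto simp: f(2) funs_def)
    qed
    show "?H ` Sigma ?E (\<lambda>E. funs E ?t) \<subseteq> funs D t"
    proof
      fix g assume "g \<in> ?H ` Sigma ?E (\<lambda>E. funs E ?t)"
      then obtain E f where p: "E \<subseteq> D" "card E = ?s" "f \<in> funs E ?t"
        "g = (\<lambda>x\<in>D. if x \<in> E then f x else a)" by auto
      have fE: "finite E" using p(1) D finite_subset by blast
      have "int (card {x \<in> D. g x = c}) = t c" for c
      proof (cases "c = a")
        case True
        have "{x \<in> D. g x = a} = D - E" using noa[OF p(1,3)] by (auto simp: p(4))
        then have "card {x \<in> D. g x = a} = card D - ?s" using p(1,2) fE by (simp add: card_Diff_subset)
        then show ?thesis using True t0 by simp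
      next
        case False
        then have "{x \<in> D. g x = c} = {x \<in> E. f x = c}" using p(1) by (auto simp: p(4))
        then show ?thesis using False p(3) by (simp add: funs_def)
      qed
      then show "g \<in> funs D t" by (simp add: funs_def p(4))
    qed
  qed
  then have "card (funs D t) = card (Sigma ?E (\<lambda>E. funs E ?t))" by (rule bij_betw_same_card)
  also have "\<dots> = (\<Sum>E\<in>?E. card (funs E ?t))"
    using D by (intro card_SigmaI) (auto intro: finite_funs finite_subset)
  also have "\<dots> = (\<Sum>E\<in>?E. cnt ?s ?t)"
    using D by (intro sum.cong refl) (auto simp: card_funs finite_subset)
  also have "\<dots> = (card D choose ?s) * cnt ?s ?t" using D by (simp add: n_subsets)
  finally show ?thesis .
qed

section \<open>Three-dimensional arrays\<close>

type_synonym array = "int \<Rightarrow> int \<Rightarrow> int \<Rightarrow> int"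

lemma ro_Sum_any: "ro A i = Sum_any (A i)"
  by (simp add: ro_def Sum_any.expand_set)

lemma co_Sum_any: "co A j = Sum_any (\<lambda>i. A i j)"
  by (simp add: co_def Sum_any.expand_set)

lemma Sum_any_nonneg_pos:
  fixes g :: "int \<Rightarrow> int"
  assumes fin: "finite {x. g x \<noteq> 0}" and nn: "\<And>x. 0 \<le> g x"
  shows "g x \<le> Sum_any g"
proof (cases "g x = 0")
  case True
  then show ?thesis using nn by (simp add: Sum_any.expand_set sum_nonneg)
next
  case False
  then show ?thesis unfolding Sum_any.expand_set using fin nn by (intro member_le_sum) auto
qed

text \<open>An array records how the integers with colour \<open>i\<close> in one colouring and \<open>j\<close> in another are
  distributed over the colours \<open>c\<close> of a third one. Negative entries are allowed where all three
  indices agree, since the diagonal is going to be shifted.\<close>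

definition arrays :: "nat \<Rightarrow> zmat \<Rightarrow> zmat \<Rightarrow> array set" where
  "arrays n B A = {t. (\<forall>i c j. t (i + int n) (c + int n) (j + int n) = t i c j) \<and>
     (\<forall>i c j. i \<noteq> c \<or> c \<noteq> j \<longrightarrow> 0 \<le> t i c j) \<and>
     (\<forall>i c. finite {j. t i c j \<noteq> 0} \<and> Sum_any (t i c) = B i c) \<and>
     (\<forall>c j. finite {i. t i c j \<noteq> 0} \<and> Sum_any (\<lambda>i. t i c j) = A c j)}"

text \<open>Summing over the middle index forgets the third colouring and leaves the joint distribution of the
  other two.\<close>

definition middle :: "array \<Rightarrow> zmat" where
  "middle t = (\<lambda>i j. Sum_any (\<lambda>c. t i c j))"

lemma arrays_period: "t \<in> arrays n B A \<Longrightarrow> t (i + k * int n) (c + k * int n) (j + k * int n) = t i c j"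
proof -
  assume t: "t \<in> arrays n B A"
  have "t (i + (0 + k * 1) * int n) (c + (0 + k * 1) * int n) (j + (0 + k * 1) * int n) =
      t (i + 0 * int n) (c + 0 * int n) (j + 0 * int n) + k * 0"
  proof (rule quasi_periodic[of "\<lambda>k. t (i + k * int n) (c + k * int n) (j + k * int n)" 1 0 0 k])
    fix k
    have "t (i + k * int n + int n) (c + k * int n + int n) (j + k * int n + int n) =
        t (i + k * int n) (c + k * int n) (j + k * int n)"
      using t by (simp add: arrays_def)
    then show "t (i + (k + 1) * int n) (c + (k + 1) * int n) (j + (k + 1) * int n) =
        t (i + k * int n) (c + k * int n) (j + k * int n) + 0"
      by (simp add: algebra_simps)
  qed
  then show ?thesis by simp
qed

lemma arraysD:
  assumes "t \<in> arrays n B A"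
  shows "i \<noteq> c \<or> c \<noteq> j \<Longrightarrow> 0 \<le> t i c j"
    and "finite {j. t i c j \<noteq> 0}" "Sum_any (t i c) = B i c"
    and "finite {i. t i c j \<noteq> 0}" "Sum_any (\<lambda>i. t i c j) = A c j"
  using assms by (auto simp: arrays_def)

lemma arrays_le:
  assumes t: "t \<in> arrays n B A"
  shows "i \<noteq> c \<Longrightarrow> t i c j \<le> B i c" and "c \<noteq> j \<Longrightarrow> t i c j \<le> A c j"
  using Sum_any_nonneg_pos[OF arraysD(2)[OF t], of i c j] Sum_any_nonneg_pos[OF arraysD(4)[OF t], of c j i]
    arraysD(1,3,5)[OF t] by auto

lemma arrays_support:
  assumes t: "t \<in> arrays n B A" and "t i c j \<noteq> 0"
  shows "i = c \<or> B i c \<noteq> 0" and "c = j \<or> A c j \<noteq> 0"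
  using arrays_le[OF t, of i c j] arrays_le[OF t, of c j i] arraysD(1)[OF t, of i c j] assms(2) by force+

lemma arrays_finite_row:
  assumes t: "t \<in> arrays n B A" and B: "B \<in> M_aff n" and A: "A \<in> M_aff n"
  shows "finite {(c, j). t i c j \<noteq> 0}"
proof (rule finite_subset)
  show "{(c, j). t i c j \<noteq> 0} \<subseteq> Sigma (insert i {c. B i c \<noteq> 0}) (\<lambda>c. insert c {j. A c j \<noteq> 0})"
    by (auto dest: arrays_support[OF t])
  show "finite (Sigma (insert i {c. B i c \<noteq> 0}) (\<lambda>c. insert c {j. A c j \<noteq> 0}))"
    using A B by (auto simp: M_aff_def)
qed

lemma arrays_finite_col:
  assumes t: "t \<in> arrays n B A" and B: "B \<in> M_aff n" and A: "A \<in> M_aff n"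
  shows "finite {(c, i). t i c j \<noteq> 0}"
proof (rule finite_subset)
  show "{(c, i). t i c j \<noteq> 0} \<subseteq> Sigma (insert j {c. A c j \<noteq> 0}) (\<lambda>c. insert c {i. B i c \<noteq> 0})"
    by (auto dest: arrays_support[OF t])
  show "finite (Sigma (insert j {c. A c j \<noteq> 0}) (\<lambda>c. insert c {i. B i c \<noteq> 0}))"
    using A B by (auto simp: M_aff_def)
qed

lemma arrays_finite_mid:
  assumes t: "t \<in> arrays n B A" and B: "B \<in> M_aff n" and A: "A \<in> M_aff n"
  shows "finite {c. t i c j \<noteq> 0}"
proof (rule finite_subset)
  show "{c. t i c j \<noteq> 0} \<subseteq> fst ` {(c, j). t i c j \<noteq> 0}" by force
qed (rule finite_imageI[OF arrays_finite_row[OF assms]])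

lemma Sum_any_swap_finite:
  fixes h :: "int \<Rightarrow> int \<Rightarrow> int"
  assumes "finite {(c, j). h c j \<noteq> 0}"
  shows "Sum_any (\<lambda>j. Sum_any (\<lambda>c. h c j)) = Sum_any (\<lambda>c. Sum_any (h c))"
proof (rule Sum_any.swap[of "snd ` {(c, j). h c j \<noteq> 0} \<times> fst ` {(c, j). h c j \<noteq> 0}"])
  show "finite (snd ` {(c, j). h c j \<noteq> 0} \<times> fst ` {(c, j). h c j \<noteq> 0})" using assms by simp
qed force

lemma ro_middle:
  assumes t: "t \<in> arrays n B A" and B: "B \<in> M_aff n" and A: "A \<in> M_aff n"
  shows "ro (middle t) = ro B"
proof
  fix i
  have "ro (middle t) i = Sum_any (\<lambda>c. Sum_any (t i c))"
    unfolding ro_Sum_any middle_def by (rule Sum_any_swap_finite[OF arrays_finite_row[OF assms]])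
  then show "ro (middle t) i = ro B i" by (simp add: ro_Sum_any arraysD(3)[OF t])
qed

lemma co_middle:
  assumes t: "t \<in> arrays n B A" and B: "B \<in> M_aff n" and A: "A \<in> M_aff n"
  shows "co (middle t) = co A"
proof
  fix j
  have "co (middle t) j = Sum_any (\<lambda>c. Sum_any (\<lambda>i. t i c j))"
    unfolding co_Sum_any middle_def by (rule Sum_any_swap_finite[OF arrays_finite_col[OF assms]])
  then show "co (middle t) j = co A j" by (simp add: co_Sum_any arraysD(5)[OF t])
qed

lemma middle_Theta_tilde:
  assumes t: "t \<in> arrays n B A" and B: "B \<in> M_aff n" and A: "A \<in> M_aff n"
  shows "middle t \<in> Theta_tilde n"
proof -
  have p: "middle t i j = middle t (i + int n) (j + int n)" for i j
  proof -
    have "Sum_any (\<lambda>c. t (i + int n) c (j + int n)) = Sum_any ((\<lambda>c. t (i + int n) c (j + int n)) \<circ> (\<lambda>c. c + int n))"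
      by (rule Sum_any.reindex_cong[of "\<lambda>c. c + int n"]) (auto intro: injI surjI[of _ "\<lambda>c. c - int n"] bijI)
    then show ?thesis using t by (simp add: middle_def arrays_def comp_def)
  qed
  have f1: "finite {j. middle t i j \<noteq> 0}" for i
  proof (rule finite_subset)
    show "{j. middle t i j \<noteq> 0} \<subseteq> snd ` {(c, j). t i c j \<noteq> 0}"
      unfolding middle_def by (force elim!: Sum_any.not_neutral_obtains_not_neutral)
  qed (rule finite_imageI[OF arrays_finite_row[OF assms]])
  have f2: "finite {i. middle t i j \<noteq> 0}" for j
  proof (rule finite_subset)
    show "{i. middle t i j \<noteq> 0} \<subseteq> snd ` {(c, i). t i c j \<noteq> 0}"
      unfolding middle_def by (force elim!: Sum_any.not_neutral_obtains_not_neutral)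
  qed (rule finite_imageI[OF arrays_finite_col[OF assms]])
  have "0 \<le> middle t i j" if "i \<noteq> j" for i j
    unfolding middle_def Sum_any.expand_set using arraysD(1)[OF t] that by (intro sum_nonneg) auto
  then show ?thesis using p f1 f2 by (simp add: Theta_tilde_def M_aff_def)
qed

lemma period_representative:
  assumes "1 \<le> (n :: nat)"
  obtains k where "1 \<le> i - k * int n" "i - k * int n \<le> int n"
proof
  have "0 < int n" using assms by simp
  from pos_mod_bound[OF this, of "i - 1"] pos_mod_sign[OF this, of "i - 1"]
  show "1 \<le> i - (i - 1) div int n * int n" "i - (i - 1) div int n * int n \<le> int n"
    using minus_mult_div_eq_mod[of "i - 1" "int n"] unfolding mult.commute[of _ "int n"] by linarith+
qed

text \<open>Entries with indices that are not all equal are bounded by the entries of \<open>B\<close> or \<open>A\<close> and vanish outside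
  finitely many positions in each period. The entry \<open>t i i i\<close> is then determined by the sum over the
  last index.\<close>

lemma finite_arrays:
  assumes n: "1 \<le> n" and B: "B \<in> M_aff n" and A: "A \<in> M_aff n"
  shows "finite (arrays n B A)"
proof -
  define D where "D = Sigma {1..int n} (\<lambda>i. Sigma (insert i {c. B i c \<noteq> 0}) (\<lambda>c. insert c {j. A c j \<noteq> 0}))"
  define D' where "D' = {(i, c, j) \<in> D. i \<noteq> c \<or> c \<noteq> j}"
  have "finite D" unfolding D_def using A B by (intro finite_SigmaI) (auto simp: M_aff_def)
  then have D': "finite D'" unfolding D'_def by (rule rev_finite_subset) auto
  let ?R = "\<lambda>t. restrict (\<lambda>(i, c, j). t i c j) D'"
  have "inj_on ?R (arrays n B A)"
  proof (rule inj_onI)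
    fix t u assume t: "t \<in> arrays n B A" and u: "u \<in> arrays n B A" and e: "?R t = ?R u"
    have off: "t i c j = u i c j" if ne: "i \<noteq> c \<or> c \<noteq> j" for i c j
    proof -
      obtain k where k: "1 \<le> i - k * int n" "i - k * int n \<le> int n"
        using period_representative[OF n] by blast
      let ?i = "i - k * int n" let ?c = "c - k * int n" let ?j = "j - k * int n"
      have "t ?i ?c ?j = u ?i ?c ?j"
      proof (cases "(?i, ?c, ?j) \<in> D'")
        case True
        then show ?thesis using fun_cong[OF e, of "(?i, ?c, ?j)"] by simp
      next
        case False
        then have "(?i, ?c, ?j) \<notin> D" using ne by (auto simp: D'_def)
        then have "\<not> ((?i = ?c \<or> B ?i ?c \<noteq> 0) \<and> (?c = ?j \<or> A ?c ?j \<noteq> 0))"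
          using k by (auto simp: D_def)
        then have "t ?i ?c ?j = 0" "u ?i ?c ?j = 0"
          using arrays_support[OF t] arrays_support[OF u] by blast+
        then show ?thesis by simp
      qed
      then show ?thesis
        using arrays_period[OF t, of i "- k" c j] arrays_period[OF u, of i "- k" c j] by simp
    qed
    have "t i i i = u i i i" for i
    proof -
      have f: "finite {j. t i i j \<noteq> 0}" "finite {j. u i i j \<noteq> 0}" using arraysD(2) t u by blast+
      let ?W = "insert i ({j. t i i j \<noteq> 0} \<union> {j. u i i j \<noteq> 0})"
      have "Sum_any (t i i) = sum (t i i) ?W" "Sum_any (u i i) = sum (u i i) ?W"
        using f by (auto intro!: Sum_any.expand_superset)
      then have "sum (t i i) ?W = sum (u i i) ?W" using arraysD(3)[OF t, of i i] arraysD(3)[OF u, of i i] by simp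
      moreover have "sum (t i i) (?W - {i}) = sum (u i i) (?W - {i})"
        using off by (intro sum.cong) auto
      ultimately show ?thesis using f by (simp add: sum.remove[of ?W i])
    qed
    then show "t = u" using off by (intro ext) metis
  qed
  moreover have "?R ` arrays n B A \<subseteq> PiE D' (\<lambda>(i, c, j). {0..max (B i c) (A c j)})"
  proof
    fix f assume "f \<in> ?R ` arrays n B A"
    then obtain t where t: "t \<in> arrays n B A" "f = ?R t" by blast
    have "t i c j \<in> {0..max (B i c) (A c j)}" if "(i, c, j) \<in> D'" for i c j
      using that arraysD(1)[OF t(1), of i c j] arrays_le[OF t(1), of i c j] arrays_le[OF t(1), of c j i]
      by (auto simp: D'_def max_def)
    then show "f \<in> PiE D' (\<lambda>(i, c, j). {0..max (B i c) (A c j)})" by (auto simp: t(2))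
  qed
  moreover have "finite (PiE D' (\<lambda>(i, c, j). {0..max (B i c) (A c j)}))"
    using D' by (intro finite_PiE) auto
  ultimately show ?thesis by (meson finite_imageD finite_subset)
qed

definition shift_array :: "int \<Rightarrow> array \<Rightarrow> array" where
  "shift_array a t = (\<lambda>i c j. t i c j + (if i = c \<and> c = j then a else 0))"

lemma Sum_any_delta:
  fixes g :: "int \<Rightarrow> int"
  assumes "finite {x. g x \<noteq> 0}"
  shows "Sum_any (\<lambda>x. g x + (if x = k \<and> P then a else 0)) = Sum_any g + (if P then a else 0)"
    and "finite {x. g x + (if x = k \<and> P then a else 0) \<noteq> 0}"
proof -
  have f: "finite {x. (if x = k \<and> P then a else 0) \<noteq> 0}"
    by (rule finite_subset[of _ "{k}"]) auto
  have "Sum_any (\<lambda>x. if x = k \<and> P then a else 0) = (if P then a else 0)"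
    by (subst Sum_any.expand_superset[of "{k}"]) auto
  then show "Sum_any (\<lambda>x. g x + (if x = k \<and> P then a else 0)) = Sum_any g + (if P then a else 0)"
    using Sum_any.distrib[OF assms f] by simp
  show "finite {x. g x + (if x = k \<and> P then a else 0) \<noteq> 0}"
    by (rule finite_subset[of _ "insert k {x. g x \<noteq> 0}"]) (use assms in auto)
qed

lemma shift_array_arrays:
  assumes t: "t \<in> arrays n B A"
  shows "shift_array a t \<in> arrays n (shift_diag a B) (shift_diag a A)"
proof -
  have 1: "shift_array a t i c j = t i c j + (if j = c \<and> i = c then a else 0)" for i c j
    by (auto simp: shift_array_def)
  have 2: "shift_array a t i c j = t i c j + (if i = c \<and> c = j then a else 0)" for i c j
    by (simp add: shift_array_def)
  have "finite {j. shift_array a t i c j \<noteq> 0} \<and> Sum_any (shift_array a t i c) = shift_diag a B i c" for i c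
    unfolding 1 using Sum_any_delta[OF arraysD(2)[OF t], of i c c "i = c" a]
    by (simp add: arraysD(3)[OF t] shift_diag_def 1[abs_def])
  moreover have "finite {i. shift_array a t i c j \<noteq> 0} \<and>
      Sum_any (\<lambda>i. shift_array a t i c j) = shift_diag a A c j" for c j
    unfolding 2 using Sum_any_delta[OF arraysD(4)[OF t], of c j c "c = j" a]
    by (simp add: arraysD(5)[OF t] shift_diag_def)
  ultimately show ?thesis using t by (auto simp: arrays_def shift_array_def)
qed

lemma shift_array_inverse: "shift_array (- a) (shift_array a t) = t" "shift_diag (- a) (shift_diag a A) = A"
  by (auto simp: shift_array_def shift_diag_def fun_eq_iff)

text \<open>The constraints on \<open>B\<close> and \<open>A\<close> see the diagonal entries only through sums, so that a shift of the
  matrices is absorbed by a shift of the arrays.\<close>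

lemma arrays_shift: "arrays n (shift_diag a B) (shift_diag a A) = shift_array a ` arrays n B A"
proof (intro equalityI subsetI)
  fix t assume "t \<in> arrays n (shift_diag a B) (shift_diag a A)"
  then have "shift_array (- a) t \<in> arrays n B A"
    using shift_array_arrays[of t n "shift_diag a B" "shift_diag a A" "- a"] by (simp add: shift_array_inverse)
  moreover have "t = shift_array a (shift_array (- a) t)" using shift_array_inverse(1)[of "- a" t] by simp
  ultimately show "t \<in> shift_array a ` arrays n B A" by blast
qed (use shift_array_arrays in auto)

lemma middle_shift:
  assumes t: "t \<in> arrays n B A" and B: "B \<in> M_aff n" and A: "A \<in> M_aff n"
  shows "middle (shift_array a t) = shift_diag a (middle t)"
proof (intro ext)
  fix i j
  have "shift_array a t i c j = t i c j + (if c = i \<and> i = j then a else 0)" for c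
    by (auto simp: shift_array_def)
  then show "middle (shift_array a t) i j = shift_diag a (middle t) i j"
    using Sum_any_delta(1)[OF arrays_finite_mid[OF assms], of i j i "i = j" a]
    by (simp add: middle_def shift_diag_def)
qed

section \<open>Counting colourings\<close>

lemma fibre_Sum_any:
  assumes D: "finite D"
  shows "finite {y. int (card {x \<in> D. h x = y}) \<noteq> 0}"
    and "Sum_any (\<lambda>y. int (card {x \<in> D. h x = y})) = int (card D)"
proof -
  have s: "{y. int (card {x \<in> D. h x = y}) \<noteq> 0} = h ` D" using D by auto
  show "finite {y. int (card {x \<in> D. h x = y}) \<noteq> 0}" unfolding s using D by simp
  show "Sum_any (\<lambda>y. int (card {x \<in> D. h x = y})) = int (card D)"
    unfolding Sum_any.expand_set s using card_eq_sum_fibres[OF D, of h] by simp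
qed

definition distribution :: "(int \<Rightarrow> int) \<Rightarrow> (int \<Rightarrow> int) \<Rightarrow> (int \<Rightarrow> int) \<Rightarrow> array" where
  "distribution F F' f = (\<lambda>i c j. int (card {x. F x = i \<and> f x = c \<and> F' x = j}))"

context affine_blocks
begin

context
  fixes F F' :: "int \<Rightarrow> int"
  assumes F: "\<And>x. F (x + int r) = F x + int n" and F': "\<And>x. F' (x + int r) = F' x + int n"
    and finF: "\<And>i. finite {x. F x = i}" and finF': "\<And>j. finite {x. F' x = j}"
begin

abbreviation cell :: "int \<Rightarrow> int \<Rightarrow> int set" where
  "cell i j \<equiv> {x. F x = i \<and> F' x = j}"

lemma finite_cell: "finite (cell i j)"
  by (rule finite_subset[OF _ finF[of i]]) auto

lemma distribution_sums:
  shows "finite {j. distribution F F' f i c j \<noteq> 0}"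
    and "Sum_any (distribution F F' f i c) = int (card {x. F x = i \<and> f x = c})"
    and "finite {i. distribution F F' f i c j \<noteq> 0}"
    and "Sum_any (\<lambda>i. distribution F F' f i c j) = int (card {x. f x = c \<and> F' x = j})"
    and "finite {c. distribution F F' f i c j \<noteq> 0}"
    and "Sum_any (\<lambda>c. distribution F F' f i c j) = int (card (cell i j))"
proof -
  have 1: "finite {x. F x = i \<and> f x = c}" by (rule finite_subset[OF _ finF[of i]]) auto
  have 2: "finite {x. f x = c \<and> F' x = j}" by (rule finite_subset[OF _ finF'[of j]]) auto
  have e: "{x. F x = i \<and> f x = c \<and> F' x = j} = {x \<in> {x. F x = i \<and> f x = c}. F' x = j}"
    "{x. F x = i \<and> f x = c \<and> F' x = j} = {x \<in> {x. f x = c \<and> F' x = j}. F x = i}"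
    "{x. F x = i \<and> f x = c \<and> F' x = j} = {x \<in> cell i j. f x = c}" for i c j
    by auto
  show "finite {j. distribution F F' f i c j \<noteq> 0}"
    "Sum_any (distribution F F' f i c) = int (card {x. F x = i \<and> f x = c})"
    unfolding distribution_def e(1) using fibre_Sum_any[OF 1, of F'] by auto
  show "finite {i. distribution F F' f i c j \<noteq> 0}"
    "Sum_any (\<lambda>i. distribution F F' f i c j) = int (card {x. f x = c \<and> F' x = j})"
    unfolding distribution_def e(2) using fibre_Sum_any[OF 2, of F] by auto
  show "finite {c. distribution F F' f i c j \<noteq> 0}"
    "Sum_any (\<lambda>c. distribution F F' f i c j) = int (card (cell i j))"
    unfolding distribution_def e(3) using fibre_Sum_any[OF finite_cell, of i j f] by auto
qed

lemma distribution_period: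
  assumes f: "\<And>x. f (x + int r) = f x + int n"
  shows "distribution F F' f (i + k * int n) (c + k * int n) (j + k * int n) = distribution F F' f i c j"
proof -
  have s: "F (x + k * int r) = F x + k * int n" "F' (x + k * int r) = F' x + k * int n"
    "f (x + k * int r) = f x + k * int n" for x k
    using quasi_periodic[of F, OF F] quasi_periodic[of F', OF F'] quasi_periodic[of f, OF f] by auto
  have "{x. F x = i + k * int n \<and> f x = c + k * int n \<and> F' x = j + k * int n} =
      (\<lambda>x. x + k * int r) ` {x. F x = i \<and> f x = c \<and> F' x = j}" (is "?L = _ ` ?R")
  proof (intro equalityI subsetI)
    fix x assume x: "x \<in> ?L"
    have "x - k * int r \<in> ?R"
      using x s[of "x - k * int r" k] by simp
    then show "x \<in> (\<lambda>x. x + k * int r) ` ?R"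
      by (intro image_eqI[of _ "\<lambda>x. x + k * int r" "x - k * int r"]) simp_all
  qed (auto simp: s)
  then show ?thesis by (simp add: distribution_def card_image inj_on_def)
qed

lemma colourings_eq:
  "colourings F F' B A = {f. (\<forall>x. f (x + int r) = f x + int n) \<and> distribution F F' f \<in> arrays n B A}"
proof (intro equalityI subsetI)
  fix f assume "f \<in> colourings F F' B A"
  then have f: "\<And>x. f (x + int r) = f x + int n"
    "\<And>i c. int (card {x. F x = i \<and> f x = c}) = B i c" "\<And>c j. int (card {x. f x = c \<and> F' x = j}) = A c j"
    by (auto simp: colourings_def)
  have "distribution F F' f \<in> arrays n B A"
    using distribution_sums[of f] distribution_period[of f, OF f(1), of _ 1] f(2,3)
    by (simp add: arrays_def) (simp add: distribution_def)
  then show "f \<in> {f. (\<forall>x. f (x + int r) = f x + int n) \<and> distribution F F' f \<in> arrays n B A}" using f by blast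
next
  fix f assume "f \<in> {f. (\<forall>x. f (x + int r) = f x + int n) \<and> distribution F F' f \<in> arrays n B A}"
  then have f: "\<forall>x. f (x + int r) = f x + int n" and t: "distribution F F' f \<in> arrays n B A" by auto
  show "f \<in> colourings F F' B A"
    using f arraysD(3,5)[OF t] distribution_sums(2,4)[of f] by (simp add: colourings_def)
qed

text \<open>A periodic colouring with a given distribution is put together from independent colourings of
  the finitely many cells that meet a period.\<close>

lemma card_distribution:
  assumes J: "finite J" "J \<subseteq> {1..int n} \<times> UNIV"
    and cov: "\<And>i j. i \<in> {1..int n} \<Longrightarrow> cell i j \<noteq> {} \<Longrightarrow> (i, j) \<in> J"
    and t: "t \<in> arrays n B A" "\<And>i c j. 0 \<le> t i c j" and fint: "\<And>i j. finite {c. t i c j \<noteq> 0}"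
    and mid: "\<And>i j. middle t i j = int (card (cell i j))"
  defines "W \<equiv> {f. (\<forall>x. f (x + int r) = f x + int n) \<and> distribution F F' f = t}"
  shows "finite W" and "card W = (\<Prod>(i, j)\<in>J. cnt (card (cell i j)) (\<lambda>c. t i c j))"
proof -
  let ?V = "\<lambda>(i, j). funs (cell i j) (\<lambda>c. t i c j)"
  let ?H = "\<lambda>f. \<lambda>p\<in>J. restrict f (cell (fst p) (snd p))"
  \<comment> \<open>The number of the period in which \<open>F x\<close> lies; \<open>?L\<close> evaluates a family of cell colourings after moving
    back to the first period.\<close>
  let ?ht = "\<lambda>x. (F x - 1) div int n"
  let ?L = "\<lambda>\<Phi> x. \<Phi> (F (x - ?ht x * int r), F' (x - ?ht x * int r)) (x - ?ht x * int r) + ?ht x * int n"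
  have sF: "F (x + k * int r) = F x + k * int n" "F' (x + k * int r) = F' x + k * int n" for x k
    using quasi_periodic[of F, OF F] quasi_periodic[of F', OF F'] by auto
  have base: "F (x - ?ht x * int r) \<in> {1..int n}" for x
  proof -
    have "0 < int n" using n1 by simp
    from pos_mod_bound[OF this, of "F x - 1"] pos_mod_sign[OF this, of "F x - 1"]
    have "1 \<le> F x - ?ht x * int n \<and> F x - ?ht x * int n \<le> int n"
      using minus_mult_div_eq_mod[of "F x - 1" "int n"] unfolding mult.commute[of _ "int n"] by linarith
    then show ?thesis using sF(1)[of x "- ?ht x"] by simp
  qed
  have inJ: "(F (x - ?ht x * int r), F' (x - ?ht x * int r)) \<in> J" for x
    using base[of x] by (intro cov) auto
  have ht0: "?ht x = 0" if "F x \<in> {1..int n}" for x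
    using that by (simp add: div_pos_pos_trivial)
  have "bij_betw ?H W (PiE J ?V)"
  proof (rule bij_betw_byWitness[where f' = ?L])
    show "\<forall>f\<in>W. ?L (?H f) = f"
    proof (intro ballI ext)
      fix f x assume "f \<in> W"
      then have f: "\<And>x. f (x + int r) = f x + int n" by (auto simp: W_def)
      have "?L (?H f) x = f (x - ?ht x * int r) + ?ht x * int n" using inJ[of x] by simp
      then show "?L (?H f) x = f x" using quasi_periodic[of f, OF f, of x "- ?ht x"] by simp
    qed
    show "\<forall>\<Phi>\<in>PiE J ?V. ?H (?L \<Phi>) = \<Phi>"
    proof
      fix \<Phi> assume P: "\<Phi> \<in> PiE J ?V"
      show "?H (?L \<Phi>) = \<Phi>"
      proof (rule PiE_ext)
        show "?H (?L \<Phi>) \<in> PiE J (\<lambda>_. UNIV)" by simp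
        show "\<Phi> \<in> PiE J (\<lambda>_. UNIV)" using P by (auto simp: PiE_iff)
        fix p assume p: "p \<in> J"
        obtain i j where ij: "p = (i, j)" by (cases p)
        have i: "i \<in> {1..int n}" using J(2) p ij by auto
        have "\<Phi> p \<in> funs (cell i j) (\<lambda>c. t i c j)" using PiE_mem[OF P p] by (simp add: ij)
        then have "\<Phi> p \<in> cell i j \<rightarrow>\<^sub>E UNIV" by (simp add: funs_def)
        then show "?H (?L \<Phi>) p = \<Phi> p"
          using p i ht0 by (auto simp: ij fun_eq_iff PiE_iff extensional_def)
      qed
    qed
    show "?H ` W \<subseteq> PiE J ?V"
    proof
      fix \<Phi> assume "\<Phi> \<in> ?H ` W"
      then obtain f where f: "f \<in> W" "\<Phi> = ?H f" by blast
      have "restrict f (cell i j) \<in> funs (cell i j) (\<lambda>c. t i c j)" for i j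
      proof -
        have "t i c j = int (card {x \<in> cell i j. restrict f (cell i j) x = c})" for c
        proof -
          have "{x \<in> cell i j. restrict f (cell i j) x = c} = {x. F x = i \<and> f x = c \<and> F' x = j}" by auto
          then show ?thesis using f(1) by (auto simp: W_def distribution_def)
        qed
        then show ?thesis by (simp add: funs_def)
      qed
      then show "\<Phi> \<in> PiE J ?V" by (auto simp: f(2))
    qed
    show "?L ` PiE J ?V \<subseteq> W"
    proof
      fix f assume "f \<in> ?L ` PiE J ?V"
      then obtain \<Phi> where P: "\<Phi> \<in> PiE J ?V" and f: "f = ?L \<Phi>" by blast
      have per: "f (x + int r) = f x + int n" for x
      proof -
        have "?ht (x + int r) = ?ht x + 1" using n1 by (simp add: F diff_add_eq[symmetric])
        moreover from this have "x + int r - ?ht (x + int r) * int r = x - ?ht x * int r"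
          by (simp add: algebra_simps)
        ultimately show ?thesis unfolding f by (simp add: algebra_simps)
      qed
      have main: "distribution F F' f i c j = t i c j" if i: "i \<in> {1..int n}" for i c j
      proof (cases "(i, j) \<in> J")
        case True
        then have "\<Phi> (i, j) \<in> funs (cell i j) (\<lambda>c. t i c j)" using PiE_mem[OF P True] by simp
        then have "int (card {x \<in> cell i j. \<Phi> (i, j) x = c}) = t i c j" by (simp add: funs_def)
        moreover have "{x. F x = i \<and> f x = c \<and> F' x = j} = {x \<in> cell i j. \<Phi> (i, j) x = c}"
          using ht0 i by (auto simp: f)
        ultimately show ?thesis by (simp add: distribution_def)
      next
        case False
        then have em: "cell i j = {}" using cov[OF i] by blast
        then have "Sum_any (\<lambda>c. t i c j) = 0"
          using mid[of i j] unfolding em middle_def card.empty by simp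
        then have "t i c j = 0"
          using Sum_any_nonneg_pos[OF fint[of i j] t(2)[of i _ j], of c] t(2)[of i c j] by simp
        moreover have "{x. F x = i \<and> f x = c \<and> F' x = j} = {}" using em by auto
        then have "distribution F F' f i c j = 0" unfolding distribution_def by (simp only: card.empty of_nat_0)
        ultimately show ?thesis by simp
      qed
      have "distribution F F' f = t"
      proof (intro ext)
        fix i c j
        obtain k where k: "1 \<le> i - k * int n" "i - k * int n \<le> int n"
          using period_representative[OF n1] by blast
        then have "distribution F F' f (i - k * int n) (c - k * int n) (j - k * int n) =
            t (i - k * int n) (c - k * int n) (j - k * int n)" by (intro main) simp
        then show "distribution F F' f i c j = t i c j"
          using distribution_period[of f, OF per, of i "- k" c j] arrays_period[OF t(1), of i "- k" c j] by simp
      qed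
      then show "f \<in> W" using per by (simp add: W_def)
    qed
  qed
  moreover have "finite (PiE J ?V)" using J(1) by (intro finite_PiE) (auto intro: finite_funs finite_cell)
  ultimately show "finite W" using bij_betw_finite by blast
  have "card W = (\<Prod>p\<in>J. card (?V p))"
    using bij_betw_same_card[OF \<open>bij_betw ?H W (PiE J ?V)\<close>] card_PiE[OF J(1)] by simp
  also have "\<dots> = (\<Prod>(i, j)\<in>J. cnt (card (cell i j)) (\<lambda>c. t i c j))"
    by (intro prod.cong refl) (auto simp: card_funs[OF finite_cell])
  finally show "card W = (\<Prod>(i, j)\<in>J. cnt (card (cell i j)) (\<lambda>c. t i c j))" .
qed

lemma card_colourings:
  assumes B: "B \<in> M_aff n" and A: "A \<in> M_aff n"
    and J: "finite J" "J \<subseteq> {1..int n} \<times> UNIV"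
    and cov: "\<And>i j. i \<in> {1..int n} \<Longrightarrow> cell i j \<noteq> {} \<Longrightarrow> (i, j) \<in> J"
  shows "card (colourings F F' B A) =
    (\<Sum>t\<in>{t \<in> arrays n B A. (\<forall>i c j. 0 \<le> t i c j) \<and> middle t = (\<lambda>i j. int (card (cell i j)))}.
      \<Prod>(i, j)\<in>J. cnt (card (cell i j)) (\<lambda>c. t i c j))"
proof -
  let ?TT = "{t \<in> arrays n B A. (\<forall>i c j. 0 \<le> t i c j) \<and> middle t = (\<lambda>i j. int (card (cell i j)))}"
  let ?W = "\<lambda>t. {f. (\<forall>x. f (x + int r) = f x + int n) \<and> distribution F F' f = t}"
  have fin: "finite ?TT" using finite_arrays[OF n1 B A] by simp
  have "distribution F F' f \<in> ?TT" if "f \<in> colourings F F' B A" for f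
    using that distribution_sums(6)[of f]
    by (auto simp: colourings_eq middle_def fun_eq_iff) (simp add: distribution_def)
  then have "colourings F F' B A = (\<Union>t\<in>?TT. ?W t)" by (auto simp: colourings_eq)
  moreover have W: "finite (?W t)" "card (?W t) = (\<Prod>(i, j)\<in>J. cnt (card (cell i j)) (\<lambda>c. t i c j))"
    if "t \<in> ?TT" for t
    using that arrays_finite_mid[OF _ B A, of t]
    by (intro card_distribution[OF J cov, of t B A]; simp)+
  ultimately have "card (colourings F F' B A) = (\<Sum>t\<in>?TT. card (?W t))"
    using fin by (simp only:) (intro card_UN_disjoint, auto)
  then show ?thesis using W(2) by simp
qed

end

end

section \<open>The coefficient polynomials\<close>

lemma Z1_zero: "0 \<in> Z1"
  using Z1_add[OF Z1_one Z1_uminus[OF Z1_one]] by simp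

lemma Z1_of_nat: "of_nat k \<in> Z1"
  by (induction k) (auto intro: Z1_zero Z1_add Z1_one)

lemma Z1_sum: "(\<And>a. a \<in> A \<Longrightarrow> f a \<in> Z1) \<Longrightarrow> sum f A \<in> Z1"
  by (induction A rule: infinite_finite_induct) (auto intro: Z1_zero Z1_add)

lemma Z1_prod: "(\<And>a. a \<in> A \<Longrightarrow> f a \<in> Z1) \<Longrightarrow> prod f A \<in> Z1"
  by (induction A rule: infinite_finite_induct) (auto intro: Z1_one Z1_mult)

definition cells :: "nat \<Rightarrow> zmat \<Rightarrow> (int \<times> int) set" where
  "cells n X = {(i, j). 1 \<le> i \<and> i \<le> int n \<and> (i = j \<or> X i j \<noteq> 0)}"

text \<open>The number of colourings of a cell as a polynomial in the shift \<open>a\<close>. It is constant off the diagonal.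
  In a diagonal cell all integers except for a fixed number \<open>k\<close> have the colour of the cell; the
  exceptional ones are chosen and then coloured independently of \<open>a\<close>.\<close>

definition cell_poly :: "array \<Rightarrow> int \<Rightarrow> int \<Rightarrow> rat poly" where
  "cell_poly t i j =
    (if i = j then
       (let k = nat (middle t i i - t i i i)
        in of_nat (cnt k ((\<lambda>c. t i c i)(i := 0))) * binom_poly (middle t i i) k)
     else of_nat (cnt (nat (middle t i j)) (\<lambda>c. t i c j)))"

definition coeff_poly :: "nat \<Rightarrow> zmat \<Rightarrow> zmat \<Rightarrow> zmat \<Rightarrow> rat poly" where
  "coeff_poly n B A X = (\<Sum>t\<in>{t \<in> arrays n B A. middle t = X}. \<Prod>(i, j)\<in>cells n X. cell_poly t i j)"

lemma cell_poly_Z1: "cell_poly t i j \<in> Z1"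
proof (cases "i = j")
  case True
  show ?thesis unfolding cell_poly_def Let_def if_P[OF True] by (rule Z1_mult[OF Z1_of_nat Z1_binom])
next
  case False
  show ?thesis unfolding cell_poly_def Let_def if_not_P[OF False] by (rule Z1_of_nat)
qed

lemma coeff_poly_Z1: "coeff_poly n B A X \<in> Z1"
  unfolding coeff_poly_def case_prod_unfold by (intro Z1_sum Z1_prod cell_poly_Z1)

lemma finite_cells: assumes "X \<in> M_aff n" shows "finite (cells n X)"
proof (rule finite_subset)
  show "cells n X \<subseteq> Sigma {1..int n} (\<lambda>i. insert i {j. X i j \<noteq> 0})" by (auto simp: cells_def)
  show "finite (Sigma {1..int n} (\<lambda>i. insert i {j. X i j \<noteq> 0}))"
    using assms by (auto simp: M_aff_def)
qed

lemma poly_cell_poly: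
  assumes t: "t \<in> arrays n B A" and B: "B \<in> M_aff n" and A: "A \<in> M_aff n" and a: "0 \<le> t i i i + a"
  shows "poly (cell_poly t i j) (of_int a) =
    of_nat (cnt (nat (middle (shift_array a t) i j)) (\<lambda>c. shift_array a t i c j))"
proof (cases "i = j")
  case False
  then have "shift_array a t i c j = t i c j" for c by (auto simp: shift_array_def)
  then show ?thesis using False
    by (simp add: cell_poly_def middle_shift[OF t B A] shift_diag_def of_nat_poly)
next
  case True
  let ?u = "\<lambda>c. shift_array a t i c i" let ?m = "middle t i i"
  let ?k = "nat (?m + a)" let ?s = "nat (?m - t i i i)"
  have ui: "?u i = t i i i + a" by (simp add: shift_array_def)
  have un: "0 \<le> ?u c" for c
  proof (cases "c = i")
    case True
    then show ?thesis using a by (simp add: shift_array_def)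
  next
    case False
    then have "0 \<le> t i c i" by (intro arraysD(1)[OF t]) simp
    then show ?thesis using False by (simp add: shift_array_def)
  qed
  have fin: "finite {c. ?u c \<noteq> 0}"
  proof (rule finite_subset)
    show "{c. ?u c \<noteq> 0} \<subseteq> insert i {c. t i c i \<noteq> 0}"
    proof
      fix c assume "c \<in> {c. ?u c \<noteq> 0}"
      then show "c \<in> insert i {c. t i c i \<noteq> 0}" by (cases "c = i") (simp_all add: shift_array_def)
    qed
    show "finite (insert i {c. t i c i \<noteq> 0})" using arrays_finite_mid[OF t B A] by simp
  qed
  have mid: "middle (shift_array a t) i i = ?m + a"
    by (simp add: middle_shift[OF t B A] shift_diag_def)
  have le: "?u i \<le> ?m + a"
    using Sum_any_nonneg_pos[OF fin un, of i] mid by (simp add: middle_def)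
  have upd: "?u(i := 0) = (\<lambda>c. t i c i)(i := 0)" by (auto simp: shift_array_def)
  have k: "int ?k = ?m + a" using le un[of i] by simp
  have "cnt ?k ?u = card (funs {0..<int ?k} ?u)" by (simp add: cnt_def)
  also have "\<dots> = (?k choose ?s) * cnt ?s ((\<lambda>c. t i c i)(i := 0))"
  proof -
    have "nat (int (card {0..<int ?k}) - ?u i) = ?s" using k ui by simp
    then show ?thesis
      using card_funs_split[of "{0..<int ?k}" ?u i] un[of i] le k unfolding upd by simp
  qed
  finally have c: "cnt ?k ?u = (?k choose ?s) * cnt ?s ((\<lambda>c. t i c i)(i := 0))" .
  have "(of_nat ?k :: rat) = of_int (int ?k)" by (rule of_int_of_nat_eq[symmetric])
  then have "(of_int ?m + of_int a :: rat) = of_nat ?k" unfolding k of_int_add by (rule sym)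
  then have p: "poly (binom_poly ?m ?s) (of_int a) = of_nat (?k choose ?s)"
    unfolding poly_binom_poly binomial_gbinomial by (rule arg_cong[where f = "\<lambda>x. x gchoose _"])
  show ?thesis
    unfolding cell_poly_def Let_def True[symmetric] mid c simp_thms(6) if_True poly_mult p of_nat_mult
    by (simp add: of_nat_poly mult.commute)
qed

context affine_blocks
begin

lemma card_colourings_poly:
  assumes l: "l \<in> \<Lambda>" and m: "m \<in> \<Lambda>" and g: "g \<in> G"
    and B: "B \<in> M_aff n" and A: "A \<in> M_aff n"
    and a: "\<And>t i. t \<in> arrays n B A \<Longrightarrow> 0 \<le> t i i i + a"
  shows "of_nat (card (colourings (blk l) (\<lambda>x. blk m (ginv g x)) (shift_diag a B) (shift_diag a A))) =
    poly (coeff_poly n B A (shift_diag (- a) (mt l g m))) (of_int a)"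
proof -
  let ?X = "shift_diag (- a) (mt l g m)"
  let ?c = "\<lambda>i j. {x. blk l x = i \<and> blk m (ginv g x) = j}"
  have mt: "mt l g m = (\<lambda>i j. int (card (?c i j)))" by (simp add: fun_eq_iff mt_eq l m g)
  have shift_X: "shift_diag a ?X = mt l g m" using shift_array_inverse(2)[of "- a" "mt l g m"] by simp
  have M: "shift_diag b Y \<in> M_aff n" if "Y \<in> M_aff n" for b Y
  proof -
    have "finite {j. shift_diag b Y i j \<noteq> 0}" for i
      by (rule finite_subset[of _ "insert i {j. Y i j \<noteq> 0}"]) (use that in \<open>auto simp: M_aff_def shift_diag_def\<close>)
    moreover have "finite {i. shift_diag b Y i j \<noteq> 0}" for j
      by (rule finite_subset[of _ "insert j {i. Y i j \<noteq> 0}"]) (use that in \<open>auto simp: M_aff_def shift_diag_def\<close>)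
    ultimately show ?thesis using that by (auto simp: M_aff_def shift_diag_def)
  qed
  have XM: "?X \<in> M_aff n" by (rule M[OF Theta_M[OF mt_Theta[OF l m g]]])
  let ?J = "cells n ?X"
  let ?T = "{t \<in> arrays n B A. middle t = ?X}"
  let ?T' = "{t \<in> arrays n (shift_diag a B) (shift_diag a A). (\<forall>i c j. 0 \<le> t i c j) \<and>
    middle t = (\<lambda>i j. int (card (?c i j)))}"
  have card: "card (colourings (blk l) (\<lambda>x. blk m (ginv g x)) (shift_diag a B) (shift_diag a A)) =
      (\<Sum>t\<in>?T'. \<Prod>(i, j)\<in>?J. cnt (card (?c i j)) (\<lambda>c. t i c j))"
  proof (rule card_colourings)
    show "blk l (x + int r) = blk l x + int n" for x by (rule blk_shift[OF l])
    show "blk m (ginv g (x + int r)) = blk m (ginv g x) + int n" for x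
      using blk_ginv_shift[OF m g, of x 1] by simp
    show "finite {x. blk l x = i}" for i by (rule finite_blk[OF l])
    show "finite {x. blk m (ginv g x) = j}" for j
    proof -
      have "{x. blk m (ginv g x) = j} = g ` {x. blk m x = j}"
        using g by (auto intro: image_eqI[of _ g "ginv g _"])
      then show ?thesis using finite_blk[OF m] by simp
    qed
    show "shift_diag a B \<in> M_aff n" "shift_diag a A \<in> M_aff n" using M A B by auto
    show "finite ?J" by (rule finite_cells[OF XM])
    show "?J \<subseteq> {1..int n} \<times> UNIV" by (auto simp: cells_def)
    fix i j assume i: "i \<in> {1..int n}" and ne: "?c i j \<noteq> {}"
    have "finite (?c i j)" by (rule finite_subset[OF _ finite_blk[OF l, of i]]) auto
    then have "mt l g m i j \<noteq> 0" using ne by (simp add: mt card_eq_0_iff)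
    then show "(i, j) \<in> ?J" using i by (auto simp: cells_def shift_diag_def)
  qed
  have T': "?T' = shift_array a ` ?T"
  proof (intro equalityI subsetI)
    fix t' assume t': "t' \<in> ?T'"
    then obtain t where t: "t \<in> arrays n B A" "t' = shift_array a t" using arrays_shift by blast
    have "shift_diag a (middle t) = mt l g m" using t' middle_shift[OF t(1) B A] by (simp add: t(2) mt)
    then have "middle t = ?X" using shift_array_inverse(2)[of a "middle t"] by simp
    then show "t' \<in> shift_array a ` ?T" using t by blast
  next
    fix t' assume "t' \<in> shift_array a ` ?T"
    then obtain t where t: "t \<in> arrays n B A" "middle t = ?X" "t' = shift_array a t" by blast
    have "0 \<le> t' i c j" for i c j
      using a[OF t(1)] arraysD(1)[OF t(1), of i c j] by (auto simp: t(3) shift_array_def)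
    moreover have "middle t' = (\<lambda>i j. int (card (?c i j)))"
      unfolding t(3) middle_shift[OF t(1) B A] t(2) shift_X by (rule mt)
    ultimately show "t' \<in> ?T'" using shift_array_arrays[OF t(1)] by (simp add: t(3))
  qed
  have inj: "inj_on (shift_array a) ?T"
    by (rule inj_on_inverseI[of _ "shift_array (- a)"]) (rule shift_array_inverse)
  have "of_nat (\<Prod>(i, j)\<in>?J. cnt (card (?c i j)) (\<lambda>c. shift_array a t i c j)) =
      poly (\<Prod>(i, j)\<in>?J. cell_poly t i j) (of_int a)" if t: "t \<in> ?T" for t
  proof -
    have "of_nat (cnt (card (?c i j)) (\<lambda>c. shift_array a t i c j)) = poly (cell_poly t i j) (of_int a)" for i j
    proof -
      have "middle (shift_array a t) = mt l g m"
        using t middle_shift[OF _ B A, of t a] shift_X by simp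
      then have "nat (middle (shift_array a t) i j) = card (?c i j)" by (simp add: mt)
      then show ?thesis using poly_cell_poly[of t n B A i a j] A B a[of t i] t by simp
    qed
    then show ?thesis by (simp add: poly_prod of_nat_prod case_prod_unfold)
  qed
  then show ?thesis
    unfolding card T' coeff_poly_def by (simp add: sum.reindex[OF inj] poly_sum of_nat_sum)
qed

end

section \<open>Stabilization\<close>

lemma periodic_bounded:
  fixes f :: "int \<Rightarrow> int"
  assumes n: "1 \<le> (n :: nat)" and f: "\<And>i. f (i + int n) = f i"
  obtains N where "0 \<le> N" "\<And>i. \<bar>f i\<bar> \<le> N"
proof
  define N where "N = Max ((\<lambda>i. \<bar>f i\<bar>) ` {1..int n})"
  have le: "\<bar>f i\<bar> \<le> N" for i
  proof -
    obtain k where k: "1 \<le> i - k * int n" "i - k * int n \<le> int n"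
      using period_representative[OF n] by blast
    have "f (i - k * int n) = f i" using quasi_periodic[of f "int n" 0 i "- k"] f by simp
    moreover have "\<bar>f (i - k * int n)\<bar> \<le> N" unfolding N_def using k by (intro Max_ge) auto
    ultimately show ?thesis by simp
  qed
  then show "\<bar>f i\<bar> \<le> Max ((\<lambda>i. \<bar>f i\<bar>) ` {1..int n})" for i by (simp add: N_def)
  show "0 \<le> Max ((\<lambda>i. \<bar>f i\<bar>) ` {1..int n})" using order_trans[OF abs_ge_zero le] by (simp add: N_def)
qed

lemma finite_family_bounded:
  fixes f :: "'a \<Rightarrow> int \<Rightarrow> int"
  assumes n: "1 \<le> (n :: nat)" and X: "finite X" and f: "\<And>x i. x \<in> X \<Longrightarrow> f x (i + int n) = f x i"
  shows "\<exists>N\<ge>0. \<forall>x\<in>X. \<forall>i. \<bar>f x i\<bar> \<le> N"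
  using X f
proof (induction X rule: finite_induct)
  case empty
  show ?case by auto
next
  case (insert y X)
  then obtain N where N: "0 \<le> N" "\<forall>x\<in>X. \<forall>i. \<bar>f x i\<bar> \<le> N" by auto
  obtain N' where N': "0 \<le> N'" "\<And>i. \<bar>f y i\<bar> \<le> N'"
    using periodic_bounded[OF n, of "f y"] insert.prems by blast
  show ?case
    using N N' by (intro exI[of _ "max N N'"]) (auto simp: le_max_iff_disj)
qed

lemma Theta_tilde_M: "A \<in> Theta_tilde n \<Longrightarrow> A \<in> M_aff n"
  by (simp add: Theta_tilde_def)

lemma M_aff_diag_period: "A \<in> M_aff n \<Longrightarrow> A (i + int n) (i + int n) = A i i"
  by (simp add: M_aff_def)

lemma sigma_mat_ro: "sigma_mat n A = (\<Sum>i = 1..int n. ro A i)"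
  by (simp add: sigma_mat_def ro_def)

lemma ro_shift_diag: assumes "A \<in> M_aff n" shows "ro (shift_diag a A) i = ro A i + a"
proof -
  have "finite {j. A i j \<noteq> 0}" using assms by (simp add: M_aff_def)
  from Sum_any_delta(1)[OF this, of i True a]
  show ?thesis by (simp add: ro_Sum_any shift_diag_def eq_commute[of i])
qed

lemma co_shift_diag: assumes "A \<in> M_aff n" shows "co (shift_diag a A) j = co A j + a"
proof -
  have "finite {i. A i j \<noteq> 0}" using assms by (simp add: M_aff_def)
  from Sum_any_delta(1)[OF this, of j True a]
  show ?thesis by (simp add: co_Sum_any shift_diag_def)
qed

lemma shift_diag_Theta:
  assumes A: "A \<in> Theta_tilde n" and a: "\<And>i. 0 \<le> A i i + a" and r: "int r = a * int n + sigma_mat n A"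
  shows "shift_diag a A \<in> Theta_aff_r n r"
proof -
  have M: "A \<in> M_aff n" by (rule Theta_tilde_M[OF A])
  have "finite {j. shift_diag a A i j \<noteq> 0}" for i
    by (rule finite_subset[of _ "insert i {j. A i j \<noteq> 0}"]) (use M in \<open>auto simp: M_aff_def shift_diag_def\<close>)
  moreover have "finite {i. shift_diag a A i j \<noteq> 0}" for j
    by (rule finite_subset[of _ "insert j {i. A i j \<noteq> 0}"]) (use M in \<open>auto simp: M_aff_def shift_diag_def\<close>)
  moreover have "0 \<le> shift_diag a A i j" for i j
    using a A by (auto simp: shift_diag_def Theta_tilde_def)
  ultimately have "shift_diag a A \<in> Theta_aff n"
    using M by (auto simp: Theta_aff_def M_aff_def shift_diag_def)
  moreover have "sigma_mat n (shift_diag a A) = int r"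
    by (simp add: sigma_mat_ro ro_shift_diag[OF M] sum.distrib r)
  ultimately show ?thesis by (simp add: Theta_aff_r_def)
qed

lemma shift_diag_eq_iff: "shift_diag a X = Y \<longleftrightarrow> X = shift_diag (- a) Y"
  using shift_array_inverse(2)[of a X] shift_array_inverse(2)[of "- a" Y] by auto

lemma floor_Z1:
  assumes "P \<in> Z1"
  shows "of_int \<lfloor>poly P (of_int a)\<rfloor> = poly P (of_int a)"
  using Z1_integer_valued[OF assms, of a] by (auto elim!: Ints_cases)

context affine_blocks
begin

lemma bracket1_combination:
  fixes k :: "nat \<Rightarrow> int"
  assumes Z: "\<And>i. i < N \<Longrightarrow> Z i \<in> Theta_aff_r n r"
  shows "\<exists>p\<in>carrier S. (\<Oplus>\<^bsub>Q\<^esub>i\<in>{..<N}. [k i] \<cdot>\<^bsub>Q\<^esub> bracket1 n r (Z i)) = cs p \<and>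
    (\<forall>l g. \<forall>m\<in>\<Lambda>. chi p l m g =
      (\<Sum>i<N. k i * (if l = ro (Z i) \<and> m = co (Z i) \<and> g \<in> G \<and> mt l g m = Z i then 1 else 0)))"
proof -
  interpret quot: ring Q by (rule Q_ring)
  obtain p where p: "p \<in> carrier S"
    "(\<Oplus>\<^bsub>Q\<^esub>i\<in>{..<N}. [k i] \<cdot>\<^bsub>Q\<^esub> cs (e_basis n r (Z i))) = cs p"
    "\<forall>l g. \<forall>m\<in>\<Lambda>. chi p l m g = (\<Sum>i<N. k i * chi (e_basis n r (Z i)) l m g)"
    using cs_combination[of "{..<N}" "\<lambda>i. e_basis n r (Z i)" k] e_basis_S[OF Z] by auto
  have "[k i] \<cdot>\<^bsub>Q\<^esub> cs (e_basis n r (Z i)) \<in> carrier Q" if "i < N" for i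
    using cs_add_pow[OF e_basis_S[OF Z[OF that]], of "k i"] cs_closed by auto
  then have "(\<Oplus>\<^bsub>Q\<^esub>i\<in>{..<N}. [k i] \<cdot>\<^bsub>Q\<^esub> bracket1 n r (Z i)) = cs p"
    unfolding p(2)[symmetric] by (intro quot.finsum_cong') (auto simp: bracket1_eq Z)
  moreover have "\<forall>l g. \<forall>m\<in>\<Lambda>. chi p l m g =
      (\<Sum>i<N. k i * (if l = ro (Z i) \<and> m = co (Z i) \<and> g \<in> G \<and> mt l g m = Z i then 1 else 0))"
    using p(3) chi_e_basis[OF Z] by (auto intro!: sum.cong)
  ultimately show ?thesis using p(1) by blast
qed

end

definition expands_at :: "nat \<Rightarrow> zmat \<Rightarrow> zmat \<Rightarrow> (zmat \<times> rat poly) list \<Rightarrow> int \<Rightarrow> bool" where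
  "expands_at n B A L a \<longleftrightarrow> (let r = nat (a * int n + sigma_mat n A); S = schur_alg_Z n r in
     bracket1 n r (shift_diag a B) \<otimes>\<^bsub>S\<^esub> bracket1 n r (shift_diag a A) =
     (\<Oplus>\<^bsub>S\<^esub>i\<in>{..<length L}. [\<lfloor>poly (snd (L ! i)) (of_int a)\<rfloor>] \<cdot>\<^bsub>S\<^esub>
        bracket1 n r (shift_diag a (fst (L ! i)))))"

lemma stable_expansion_iff:
  "stable_expansion n B A L \<longleftrightarrow> distinct (map fst L) \<and>
     (\<forall>(X, P)\<in>set L. X \<in> Theta_tilde n \<and> sigma_mat n X = sigma_mat n A \<and> P \<in> Z1 \<and> P \<noteq> 0) \<and>
     (\<exists>a0\<ge>0. 0 \<le> a0 * int n + sigma_mat n A \<and> (\<forall>a\<ge>a0. expands_at n B A L a))"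
  unfolding stable_expansion_def expands_at_def by blast

lemma sum_nth_distinct:
  assumes "distinct xs"
  shows "(\<Sum>i<length xs. h (xs ! i)) = (\<Sum>x\<in>set xs. h x)"
  by (rule sum.reindex_bij_betw[OF bij_betw_nth[OF assms refl refl]])

text \<open>For large \<open>a\<close> all shifted matrices and arrays have nonnegative diagonals, so the coefficient of every
  \<open>[X]\<^sub>1\<close> is the value of the polynomial attached to \<open>X\<close>. Only the finitely many \<open>X\<close> that are middle sums
  of arrays contribute.\<close>

lemma stable_expansion_ex:
  assumes n: "1 \<le> n" and A: "A \<in> Theta_tilde n" and B: "B \<in> Theta_tilde n" and co: "co B = ro A"
  shows "\<exists>XPs. stable_expansion n B A XPs"
proof -
  have AM: "A \<in> M_aff n" and BM: "B \<in> M_aff n" using A B Theta_tilde_M by auto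
  let ?P = "coeff_poly n B A"
  let ?Ar = "arrays n B A"
  have finAr: "finite ?Ar" by (rule finite_arrays[OF n BM AM])
  have mid: "middle t \<in> Theta_tilde n" "ro (middle t) = ro B" "co (middle t) = co A" if "t \<in> ?Ar" for t
    using middle_Theta_tilde[OF that BM AM] ro_middle[OF that BM AM] co_middle[OF that BM AM] by auto
  have sB: "sigma_mat n B = sigma_mat n A"
    using sum_ro_eq_sum_co[OF BM n] by (simp add: sigma_mat_ro co)
  have smid: "sigma_mat n (middle t) = sigma_mat n A" if "t \<in> ?Ar" for t
    using mid(2)[OF that] sB by (simp add: sigma_mat_ro)
  have "finite {X \<in> middle ` ?Ar. ?P X \<noteq> 0}"
    by (rule finite_subset[OF _ finite_imageI[OF finAr]]) (rule Collect_restrict)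
  from finite_distinct_list[OF this]
  obtain xs where xs: "distinct xs" "set xs = {X \<in> middle ` ?Ar. ?P X \<noteq> 0}"
    by (elim exE conjE)
  define XPs where "XPs = map (\<lambda>X. (X, ?P X)) xs"
  have len: "length XPs = length xs" by (simp add: XPs_def)
  have fst: "map fst XPs = xs" by (simp add: XPs_def comp_def)
  have "\<exists>N\<ge>0. \<forall>X\<in>{A, B} \<union> middle ` ?Ar. \<forall>i. \<bar>X i i\<bar> \<le> N"
  proof (rule finite_family_bounded[OF n])
    show "finite ({A, B} \<union> middle ` ?Ar)" using finAr by simp
    fix X i assume "X \<in> {A, B} \<union> middle ` ?Ar"
    then have "X \<in> M_aff n" using AM BM mid(1) Theta_tilde_M by blast
    then show "X (i + int n) (i + int n) = X i i" by (rule M_aff_diag_period)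
  qed
  then obtain N1 where N1: "0 \<le> N1" "\<forall>X\<in>{A, B} \<union> middle ` ?Ar. \<forall>i. \<bar>X i i\<bar> \<le> N1" by blast
  have "\<exists>N\<ge>0. \<forall>t\<in>?Ar. \<forall>i. \<bar>t i i i\<bar> \<le> N"
    by (rule finite_family_bounded[OF n finAr]) (simp add: arrays_def)
  then obtain N2 where N2: "0 \<le> N2" "\<forall>t\<in>?Ar. \<forall>i. \<bar>t i i i\<bar> \<le> N2" by blast
  \<comment> \<open>The summand \<open>2\<close> makes the degree at least two, as required for the group theory.\<close>
  define a0 where "a0 = N1 + N2 + \<bar>sigma_mat n A\<bar> + 2"
  have deg: "2 \<le> a * int n + sigma_mat n A" if "a0 \<le> a" for a
  proof -
    have "a * 1 \<le> a * int n" using that n N1 N2 by (intro mult_left_mono) (auto simp: a0_def)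
    then show ?thesis using that N1 N2 by (simp add: a0_def)
  qed
  have "expands_at n B A XPs a" if a: "a0 \<le> a" for a
  proof -
    define r where "r = nat (a * int n + sigma_mat n A)"
    have r: "int r = a * int n + sigma_mat n A" using deg[OF a] by (simp add: r_def)
    interpret affine_blocks r n using deg[OF a] n by unfold_locales (simp_all add: r_def)
    have diag: "0 \<le> X i i + a" if "X \<in> {A, B} \<union> middle ` ?Ar" for X i
    proof -
      have "\<bar>X i i\<bar> \<le> N1" using N1(2) that by blast
      then show ?thesis using a N2(1) by (simp add: a0_def)
    qed
    have diag_t: "0 \<le> t i i i + a" if "t \<in> ?Ar" for t i
    proof -
      have "\<bar>t i i i\<bar> \<le> N2" using N2(2) that by blast
      then show ?thesis using a N1(1) by (simp add: a0_def)
    qed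
    let ?A = "shift_diag a A" let ?B = "shift_diag a B"
    have A': "?A \<in> Theta_aff_r n r" by (rule shift_diag_Theta[OF A _ r]) (rule diag, simp)
    have "int r = a * int n + sigma_mat n B" unfolding sB by (rule r)
    then have B': "?B \<in> Theta_aff_r n r" by (intro shift_diag_Theta[OF B]) (rule diag, simp)
    have co': "co ?B = ro ?A"
      using co by (simp add: fun_eq_iff co_shift_diag[OF BM] ro_shift_diag[OF AM])
    have roco: "ro (shift_diag a X) = ro ?B \<and> co (shift_diag a X) = co ?A \<and> shift_diag a X \<in> Theta_aff_r n r"
      if X: "X \<in> middle ` ?Ar" for X
    proof -
      obtain t where t: "t \<in> ?Ar" "X = middle t" using X by blast
      have "shift_diag a X \<in> Theta_aff_r n r"
      proof (rule shift_diag_Theta)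
        show "X \<in> Theta_tilde n" unfolding t(2) by (rule mid(1)[OF t(1)])
        show "int r = a * int n + sigma_mat n X" unfolding t(2) smid[OF t(1)] by (rule r)
        show "0 \<le> X i i + a" for i
        proof -
          have "X \<in> {A, B} \<union> middle ` ?Ar" using X by (rule UnI2)
          then show ?thesis by (rule diag[of X i])
        qed
      qed
      moreover have XM: "X \<in> M_aff n" unfolding t(2) by (rule Theta_tilde_M[OF mid(1)[OF t(1)]])
      moreover have "ro (shift_diag a X) = ro ?B"
        unfolding fun_eq_iff ro_shift_diag[OF XM] ro_shift_diag[OF BM] unfolding t(2) mid(2)[OF t(1)] by simp
      moreover have "co (shift_diag a X) = co ?A"
        unfolding fun_eq_iff co_shift_diag[OF XM] co_shift_diag[OF AM] unfolding t(2) mid(3)[OF t(1)] by simp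
      ultimately show ?thesis by blast
    qed
    let ?k = "\<lambda>X. \<lfloor>poly (?P X) (of_int a)\<rfloor>"
    have "shift_diag a (xs ! i) \<in> Theta_aff_r n r" if "i < length xs" for i
    proof -
      have "xs ! i \<in> middle ` ?Ar" using nth_mem[OF that] unfolding xs(2) by blast
      then show ?thesis using roco by blast
    qed
    from bracket1_combination[of "length xs" "\<lambda>i. shift_diag a (xs ! i)" "\<lambda>i. ?k (xs ! i)", OF this]
    obtain p where p: "p \<in> carrier S"
      "(\<Oplus>\<^bsub>Q\<^esub>i\<in>{..<length xs}. [?k (xs ! i)] \<cdot>\<^bsub>Q\<^esub> bracket1 n r (shift_diag a (xs ! i))) = cs p"
      "\<forall>l g. \<forall>m\<in>\<Lambda>. chi p l m g = (\<Sum>i<length xs. ?k (xs ! i) *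
        (if l = ro (shift_diag a (xs ! i)) \<and> m = co (shift_diag a (xs ! i)) \<and> g \<in> G \<and>
          mt l g m = shift_diag a (xs ! i) then 1 else 0))" by blast
    let ?e = "e_basis n r ?B \<otimes>\<^bsub>S\<^esub> e_basis n r ?A"
    have eS: "?e \<in> carrier S"
      using monoid.m_closed[OF ring.is_monoid[OF schur_ring] e_basis_S[OF B'] e_basis_S[OF A']] .
    have "chi ?e l m g = chi p l m g" if m: "m \<in> \<Lambda>" for l m g
    proof -
      define X where "X = shift_diag (- a) (mt l g m)"
      have "chi p l m g = (\<Sum>x\<in>set xs. ?k x *
        (if l = ro (shift_diag a x) \<and> m = co (shift_diag a x) \<and> g \<in> G \<and> mt l g m = shift_diag a x then 1 else 0))"
        unfolding p(3)[rule_format, OF m] by (rule sum_nth_distinct[OF xs(1)])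
      also have "\<dots> = (\<Sum>x\<in>set xs. if x = X then (if l = ro ?B \<and> m = co ?A \<and> g \<in> G then ?k x else 0) else 0)"
      proof (rule sum.cong[OF refl])
        fix x assume "x \<in> set xs"
        then have "x \<in> middle ` ?Ar" unfolding xs(2) by blast
        then have rc: "ro (shift_diag a x) = ro ?B" "co (shift_diag a x) = co ?A" using roco by auto
        have "mt l g m = shift_diag a x \<longleftrightarrow> x = X"
          unfolding X_def using shift_diag_eq_iff[of a x "mt l g m"] by auto
        then show "?k x * (if l = ro (shift_diag a x) \<and> m = co (shift_diag a x) \<and> g \<in> G \<and>
            mt l g m = shift_diag a x then 1 else 0) =
          (if x = X then (if l = ro ?B \<and> m = co ?A \<and> g \<in> G then ?k x else 0) else 0)"
          unfolding rc by simp
      qed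
      also have "\<dots> = (if X \<in> set xs then (if l = ro ?B \<and> m = co ?A \<and> g \<in> G then ?k X else 0) else 0)"
        by simp
      also have "\<dots> = (if l = ro ?B \<and> m = co ?A \<and> g \<in> G then ?k X else 0)"
      proof -
        have "?k X = 0" if "X \<notin> set xs"
        proof -
          have "?P X = 0"
          proof (cases "X \<in> middle ` ?Ar")
            case True
            then show ?thesis using that unfolding xs(2) by blast
          next
            case False
            then have "{t \<in> ?Ar. middle t = X} = {}" by blast
            then show ?thesis unfolding coeff_poly_def by (simp only: sum.empty)
          qed
          then show ?thesis by simp
        qed
        then show ?thesis by simp
      qed
      also have "\<dots> = chi ?e l m g"
      proof (cases "l = ro ?B \<and> m = co ?A \<and> g \<in> G")
        case True
        then have l: "l \<in> \<Lambda>" using ro_Lambda[OF B'] by simp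
        have "(of_nat (card (colourings (blk l) (\<lambda>x. blk m (ginv g x)) ?B ?A)) :: rat) = poly (?P X) (of_int a)"
          unfolding X_def using True by (intro card_colourings_poly l m BM AM diag_t) auto
        then have "?k X = int (card (colourings (blk l) (\<lambda>x. blk m (ginv g x)) ?B ?A))"
          by (metis floor_of_nat)
        then show ?thesis using True chi_product[OF A' B' co' m] by simp
      next
        case False
        then show ?thesis using chi_product[OF A' B' co' m] by auto
      qed
      finally show ?thesis by simp
    qed
    then have "cs ?e = cs p" using cs_eq_iff[OF eS p(1)] by blast
    then have "bracket1 n r ?B \<otimes>\<^bsub>Q\<^esub> bracket1 n r ?A =
        (\<Oplus>\<^bsub>Q\<^esub>i\<in>{..<length xs}. [?k (xs ! i)] \<cdot>\<^bsub>Q\<^esub> bracket1 n r (shift_diag a (xs ! i)))"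
      using cs_mult[OF e_basis_S[OF B'] e_basis_S[OF A']] p(2) by (simp add: bracket1_eq A' B')
    moreover have "(\<Oplus>\<^bsub>Q\<^esub>i\<in>{..<length xs}. [?k (xs ! i)] \<cdot>\<^bsub>Q\<^esub> bracket1 n r (shift_diag a (xs ! i))) =
      (\<Oplus>\<^bsub>Q\<^esub>i\<in>{..<length XPs}. [\<lfloor>poly (snd (XPs ! i)) (of_int a)\<rfloor>] \<cdot>\<^bsub>Q\<^esub>
         bracket1 n r (shift_diag a (fst (XPs ! i))))"
    proof -
      interpret quot: ring Q by (rule Q_ring)
      have c: "[\<lfloor>poly (snd (XPs ! i)) (of_int a)\<rfloor>] \<cdot>\<^bsub>Q\<^esub> bracket1 n r (shift_diag a (fst (XPs ! i))) \<in> carrier Q"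
        if "i < length xs" for i
      proof -
        have "xs ! i \<in> middle ` ?Ar" using nth_mem[OF that] unfolding xs(2) by blast
        then have "shift_diag a (xs ! i) \<in> Theta_aff_r n r" using roco by blast
        then show ?thesis using that
          by (simp add: XPs_def bracket1_eq cs_closed e_basis_S quot.add.int_pow_closed)
      qed
      show ?thesis unfolding len by (intro quot.finsum_cong') (use c in \<open>auto simp: XPs_def\<close>)
    qed
    ultimately show ?thesis by (simp add: expands_at_def Let_def r_def)
  qed
  moreover have "X \<in> Theta_tilde n \<and> sigma_mat n X = sigma_mat n A \<and> P \<in> Z1 \<and> P \<noteq> 0" if "(X, P) \<in> set XPs" for X P
  proof -
    have "X \<in> set xs" "P = ?P X" using that by (auto simp: XPs_def)
    then show ?thesis unfolding xs(2) using mid(1) smid coeff_poly_Z1 by auto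
  qed
  moreover have "0 \<le> a0" "0 \<le> a0 * int n + sigma_mat n A"
    using N1 N2 deg[of a0] by (simp_all add: a0_def)
  ultimately have "stable_expansion n B A XPs"
    unfolding stable_expansion_iff using xs(1) fst by auto
  then show ?thesis ..
qed

definition coeff_at :: "(zmat \<times> rat poly) list \<Rightarrow> zmat \<Rightarrow> rat poly" where
  "coeff_at L Z = (\<Sum>i<length L. if fst (L ! i) = Z then snd (L ! i) else 0)"

lemma coeff_at_mem:
  assumes d: "distinct (map fst L)" and m: "(Z, P) \<in> set L"
  shows "coeff_at L Z = P"
proof -
  obtain j where j: "j < length L" "L ! j = (Z, P)" using m by (metis in_set_conv_nth)
  have "fst (L ! i) = Z \<longleftrightarrow> i = j" if "i < length L" for i
    using nth_eq_iff_index_eq[OF d, of i j] that j by auto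
  then have "coeff_at L Z = (\<Sum>i<length L. if i = j then P else 0)"
    unfolding coeff_at_def using j by (intro sum.cong) auto
  then show ?thesis using j by simp
qed

lemma coeff_at_not_mem: "Z \<notin> fst ` set L \<Longrightarrow> coeff_at L Z = 0"
  unfolding coeff_at_def by (intro sum.neutral) force

text \<open>Evaluated on a group element with matrix \<open>Z + a I\<close>, the functions \<open>chi\<close> of the other basis elements
  vanish. So the coefficients of \<open>Z\<close> in two expansions of the same product have equal values at all
  large \<open>a\<close>.\<close>

lemma stable_expansion_coeffs:
  assumes n: "1 \<le> n" and X: "stable_expansion n B A XPs" and Y: "stable_expansion n B A YQs"
    and Z: "Z \<in> Theta_tilde n" "sigma_mat n Z = sigma_mat n A"
  shows "coeff_at XPs Z = coeff_at YQs Z"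
proof -
  define F where "F = insert Z (fst ` set XPs \<union> fst ` set YQs)"
  have props: "W \<in> Theta_tilde n \<and> sigma_mat n W = sigma_mat n A" if "W \<in> F" for W
    using that X Y Z by (auto simp: F_def stable_expansion_def)
  have "\<exists>N\<ge>0. \<forall>W\<in>F. \<forall>i. \<bar>W i i\<bar> \<le> N"
  proof (rule finite_family_bounded[OF n])
    show "finite F" by (simp add: F_def)
    fix W i assume "W \<in> F"
    then have "W \<in> M_aff n" using props Theta_tilde_M by blast
    then show "W (i + int n) (i + int n) = W i i" by (rule M_aff_diag_period)
  qed
  then obtain N where N: "0 \<le> N" "\<forall>W\<in>F. \<forall>i. \<bar>W i i\<bar> \<le> N" by blast
  obtain a1 where a1: "\<And>a. a1 \<le> a \<Longrightarrow> expands_at n B A XPs a"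
    using X unfolding stable_expansion_iff by blast
  obtain a2 where a2: "\<And>a. a2 \<le> a \<Longrightarrow> expands_at n B A YQs a"
    using Y unfolding stable_expansion_iff by blast
  define a0 where "a0 = max (max a1 a2) (N + \<bar>sigma_mat n A\<bar> + 2)"
  have "poly (coeff_at XPs Z) (of_int a) = poly (coeff_at YQs Z) (of_int a)" if a: "a0 \<le> a" for a
  proof -
    have aN: "N + \<bar>sigma_mat n A\<bar> + 2 \<le> a" and a12: "a1 \<le> a" "a2 \<le> a" using a by (auto simp: a0_def)
    have "a * 1 \<le> a * int n" using aN n N by (intro mult_left_mono) auto
    then have deg: "2 \<le> a * int n + sigma_mat n A" using aN N by simp
    define r where "r = nat (a * int n + sigma_mat n A)"
    have r: "int r = a * int n + sigma_mat n A" using deg by (simp add: r_def)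
    interpret affine_blocks r n using deg n by unfold_locales (simp_all add: r_def)
    have Th: "shift_diag a W \<in> Theta_aff_r n r" if "W \<in> F" for W
    proof (rule shift_diag_Theta)
      fix i
      have "\<bar>W i i\<bar> \<le> N" using N(2) that by blast
      then show "0 \<le> W i i + a" using aN by simp
    qed (use props[OF that] r in auto)
    obtain g where g: "g \<in> G" "mt (ro (shift_diag a Z)) g (co (shift_diag a Z)) = shift_diag a Z"
      using mt_ex[OF Th[of Z]] by (auto simp: F_def)
    let ?l = "ro (shift_diag a Z)" let ?m = "co (shift_diag a Z)"
    have m: "?m \<in> \<Lambda>" using co_Lambda[OF Th[of Z]] by (simp add: F_def)
    have ex: "\<exists>p\<in>carrier S. bracket1 n r (shift_diag a B) \<otimes>\<^bsub>Q\<^esub> bracket1 n r (shift_diag a A) = cs p \<and>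
        of_int (chi p ?l ?m g) = poly (coeff_at L Z) (of_int a)"
      if eq: "expands_at n B A L a" and L: "fst ` set L \<subseteq> F" "\<forall>(X, P)\<in>set L. P \<in> Z1" for L
    proof -
      have "shift_diag a (fst (L ! i)) \<in> Theta_aff_r n r" if "i < length L" for i
        using Th L(1) nth_mem[OF that] by blast
      from bracket1_combination[of "length L" "\<lambda>i. shift_diag a (fst (L ! i))"
          "\<lambda>i. \<lfloor>poly (snd (L ! i)) (of_int a)\<rfloor>", OF this]
      obtain p where p: "p \<in> carrier S"
        "(\<Oplus>\<^bsub>Q\<^esub>i\<in>{..<length L}. [\<lfloor>poly (snd (L ! i)) (of_int a)\<rfloor>] \<cdot>\<^bsub>Q\<^esub>
         bracket1 n r (shift_diag a (fst (L ! i)))) = cs p"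
        "\<forall>l g. \<forall>m\<in>\<Lambda>. chi p l m g = (\<Sum>i<length L. \<lfloor>poly (snd (L ! i)) (of_int a)\<rfloor> *
          (if l = ro (shift_diag a (fst (L ! i))) \<and> m = co (shift_diag a (fst (L ! i))) \<and> g \<in> G \<and>
            mt l g m = shift_diag a (fst (L ! i)) then 1 else 0))" by blast
      have "of_int (chi p ?l ?m g) = poly (coeff_at L Z) (of_int a)"
      proof -
        have "(of_int (\<lfloor>poly (snd (L ! i)) (of_int a)\<rfloor> *
          (if ?l = ro (shift_diag a (fst (L ! i))) \<and> ?m = co (shift_diag a (fst (L ! i))) \<and> g \<in> G \<and>
            mt ?l g ?m = shift_diag a (fst (L ! i)) then 1 else 0)) :: rat) =
          poly (if fst (L ! i) = Z then snd (L ! i) else 0) (of_int a)" if "i < length L" for i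
        proof (cases "fst (L ! i) = Z")
          case True
          have "snd (L ! i) \<in> Z1" using L(2) nth_mem[OF that] by (auto simp: case_prod_unfold)
          then show ?thesis using True g by (simp add: floor_Z1)
        next
          case False
          then have "shift_diag a Z \<noteq> shift_diag a (fst (L ! i))"
            using shift_array_inverse(2)[of a] by metis
          then show ?thesis using False g by simp
        qed
        then show ?thesis
          unfolding p(3)[rule_format, OF m] coeff_at_def of_int_sum poly_sum by (intro sum.cong refl) simp
      qed
      then show ?thesis using p eq by (auto simp: expands_at_def Let_def r_def[symmetric])
    qed
    have L: "fst ` set XPs \<subseteq> F" "\<forall>(X, P)\<in>set XPs. P \<in> Z1" "fst ` set YQs \<subseteq> F" "\<forall>(X, P)\<in>set YQs. P \<in> Z1"
      using X Y by (auto simp: F_def stable_expansion_def)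
    obtain p where p: "p \<in> carrier S"
      "bracket1 n r (shift_diag a B) \<otimes>\<^bsub>Q\<^esub> bracket1 n r (shift_diag a A) = cs p"
      "of_int (chi p ?l ?m g) = poly (coeff_at XPs Z) (of_int a)"
      using ex[OF a1[OF a12(1)] L(1,2)] by blast
    obtain p' where p': "p' \<in> carrier S"
      "bracket1 n r (shift_diag a B) \<otimes>\<^bsub>Q\<^esub> bracket1 n r (shift_diag a A) = cs p'"
      "of_int (chi p' ?l ?m g) = poly (coeff_at YQs Z) (of_int a)"
      using ex[OF a2[OF a12(2)] L(3,4)] by blast
    have "cs p = cs p'" using p(2) p'(2) by simp
    then have "chi p ?l ?m g = chi p' ?l ?m g" using cs_eq_iff[OF p(1) p'(1)] m by blast
    then show ?thesis using p(3) p'(3) by simp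
  qed
  then have "of_int ` {a0..} \<subseteq> {x. poly (coeff_at XPs Z - coeff_at YQs Z) x = 0}" by auto
  moreover have "infinite (of_int ` {a0..} :: rat set)"
    using finite_imageD[of "of_int :: int \<Rightarrow> rat" "{a0..}"] infinite_Ici[of a0] by (auto simp: inj_on_def)
  ultimately have "coeff_at XPs Z - coeff_at YQs Z = 0"
    using poly_roots_finite finite_subset by blast
  then show ?thesis by simp
qed

lemma stable_expansion_subset:
  assumes n: "1 \<le> n" and X: "stable_expansion n B A XPs" and Y: "stable_expansion n B A YQs"
  shows "set XPs \<subseteq> set YQs"
proof
  fix ZP assume m: "ZP \<in> set XPs"
  obtain Z P where ZP: "ZP = (Z, P)" by (cases ZP)
  have Z: "Z \<in> Theta_tilde n" "sigma_mat n Z = sigma_mat n A" "P \<noteq> 0" and d: "distinct (map fst XPs)" "distinct (map fst YQs)"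
    using X Y m by (auto simp: ZP stable_expansion_def)
  have "coeff_at YQs Z = P"
    using stable_expansion_coeffs[OF n X Y Z(1,2)] coeff_at_mem[OF d(1), of Z P] m by (simp add: ZP)
  moreover from this have "Z \<in> fst ` set YQs" using Z(3) coeff_at_not_mem by blast
  ultimately show "ZP \<in> set YQs" using coeff_at_mem[OF d(2)] by (auto simp: ZP)
qed

theorem proposition6p1:
  fixes n :: nat and A B :: "int \<Rightarrow> int \<Rightarrow> int"
  assumes "2 \<le> n"
    and "A \<in> Theta_tilde n" and "B \<in> Theta_tilde n"
    and "co B = ro A"
  shows "\<exists>XPs. stable_expansion n B A XPs \<and>
           (\<forall>YQs. stable_expansion n B A YQs \<longrightarrow> mset YQs = mset XPs)"
proof -
  have n: "1 \<le> n" using assms(1) by simp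
  obtain XPs where X: "stable_expansion n B A XPs"
    using stable_expansion_ex[OF n assms(2-4)] by blast
  have "mset YQs = mset XPs" if Y: "stable_expansion n B A YQs" for YQs
  proof -
    have "distinct YQs" "distinct XPs" using X Y by (auto simp: stable_expansion_def distinct_map)
    moreover have "set YQs = set XPs"
      using stable_expansion_subset[OF n X Y] stable_expansion_subset[OF n Y X] by blast
    ultimately show ?thesis by (simp add: set_eq_iff_mset_eq_distinct)
  qed
  then show ?thesis using X by blast
qed

end
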